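(* The Lerch transcendent $\Phi(s,z,c)$ analytically continues to a single-valued holomorphic function $\tilde Z(s,z,c,[\gamma])$ on the universal cover $\tilde{\mathcal N}^{\#}$ of $\mathcal N^{\#}=\mathbb C\times(\mathbb P^1(\mathbb C)\setminus\{0,1,\infty\})\times(\mathbb C\setminus\mathbb Z_{\le0})$. All monodromy functions $M_{[\tau]}(\tilde Z)$ vanish identically for $[\tau]$ in the second commutator subgroup $\pi_1(\mathcal N^{\#},x_0')''$. Thus the analytic continuation becomes single-valued on a covering manifold of $\mathcal N^{\#}$ with a two-step solvable group of deck transformations.
   Context: $\Phi(s,z,c)=\sum_{n\ge0}z^n(n+c)^{-s}$ with principal branch powers, holomorphic on $\{\Re s>1\}\times\{|z|<1\}\times\{0<\Re c<1\}$. Base point $x_0'=(\tfrac12,-1,\tfrac12)$. Points of the universal cover are homotopy classes $[\gamma]$ of paths from $x_0'$ in $\mathcal N^{\#}$. For $[\tau]\in\pi_1(\mathcal N^{\#},x_0')$ the monodromy function is $M_{[\tau]}(f)([\gamma])=f([\tau\gamma])-f([\gamma])$ ($\tau\gamma$: first $\tau$, then $\gamma$). For a group $G$, $G''=[G',G']$, $G'=[G,G]$. *)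

theory Defs
  imports "HOL-Complex_Analysis.Complex_Analysis"
begin

type_synonym pt = "complex \<times> complex \<times> complex"

definition Lerch :: "pt \<Rightarrow> complex" where
  "Lerch x = (case x of (s, z, c) \<Rightarrow> (\<Sum>n. z ^ n * (of_nat n + c) powr (- s)))"

definition LerchDom :: "pt set" where
  "LerchDom = {(s, z, c). Re s > 1 \<and> norm z < 1 \<and> 0 < Re c \<and> Re c < 1}"

definition Nsharp :: "pt set" where
  "Nsharp = {(s, z, c). z \<noteq> 0 \<and> z \<noteq> 1 \<and> (\<forall>n::nat. c \<noteq> - of_nat n)}"

definition x0' :: pt where
  "x0' = (1/2, -1, 1/2)"

text \<open>Auxiliary point in the convergence domain; the segment from x0' to x1 lies in N#.
  It fixes the sheet on which the continuation agrees with the series.\<close>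
definition x1 :: pt where
  "x1 = (2, -1/2, 1/2)"

definition cmul3 :: "complex \<Rightarrow> pt \<Rightarrow> pt" where
  "cmul3 a v = (case v of (s, z, c) \<Rightarrow> (a * s, a * z, a * c))"

definition holo3 :: "(pt \<Rightarrow> complex) \<Rightarrow> pt set \<Rightarrow> bool" where
  "holo3 g U \<longleftrightarrow> open U \<and>
     (\<forall>x\<in>U. \<exists>D. (g has_derivative D) (at x) \<and> (\<forall>a v. D (cmul3 a v) = a * D v))"

text \<open>Paths in N# starting at the base point (representatives of points of the universal cover).\<close>
definition cpaths :: "(real \<Rightarrow> pt) set" where
  "cpaths = {g. path g \<and> path_image g \<subseteq> Nsharp \<and> pathstart g = x0'}"

definition loops :: "pt set \<Rightarrow> pt \<Rightarrow> (real \<Rightarrow> pt) set" where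
  "loops X x = {p. path p \<and> path_image p \<subseteq> X \<and> pathstart p = x \<and> pathfinish p = x}"

text \<open>Loops representing elements of the subgroup of pi_1(X,x) generated by the classes of S.\<close>
inductive_set loopgen :: "pt set \<Rightarrow> pt \<Rightarrow> (real \<Rightarrow> pt) set \<Rightarrow> (real \<Rightarrow> pt) set"
  for X x S where
  base: "p \<in> S \<Longrightarrow> p \<in> loopgen X x S"
| unit: "linepath x x \<in> loopgen X x S"
| join: "p \<in> loopgen X x S \<Longrightarrow> q \<in> loopgen X x S \<Longrightarrow> p +++ q \<in> loopgen X x S"
| rev: "p \<in> loopgen X x S \<Longrightarrow> reversepath p \<in> loopgen X x S"
| hom: "p \<in> loopgen X x S \<Longrightarrow> homotopic_paths X p q \<Longrightarrow> q \<in> loopgen X x S"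

definition commutators :: "(real \<Rightarrow> pt) set \<Rightarrow> (real \<Rightarrow> pt) set" where
  "commutators S = {a +++ (b +++ (reversepath a +++ reversepath b)) | a b. a \<in> S \<and> b \<in> S}"

definition derived1 :: "pt set \<Rightarrow> pt \<Rightarrow> (real \<Rightarrow> pt) set" where
  "derived1 X x = loopgen X x (commutators (loops X x))"

definition derived2 :: "pt set \<Rightarrow> pt \<Rightarrow> (real \<Rightarrow> pt) set" where
  "derived2 X x = loopgen X x (commutators (derived1 X x))"

end

theory Submission
  imports Defs
begin

text \<open>
  Put \<open>w = log z\<close>. For \<open>Re c > 0\<close> and \<open>Re w < 0\<close>, expanding \<open>(n + c)\<^bsup>-s\<^esup>\<close> as a Gamma integral gives
  \<open>e\<^bsup>cw\<^esup> \<Phi>(s, e\<^sup>w, c) = \<Gamma>(s)\<^bsup>-1\<^esup> \<integral>\<^sub>0\<^sup>\<infinity> t\<^bsup>s-1\<^esup> g(w - t) dt\<close> with \<open>g(u) = e\<^bsup>cu\<^esup> / (1 - e\<^sup>u)\<close>. The poles \<open>2 \<pi> \<i> k\<close>, \<open>|k| \<le> K\<close>,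
  of \<open>g\<close> are removed by adding multiples of \<open>e\<^sup>u / (u - 2 \<pi> \<i> k)\<close>, whose transforms are incomplete Gamma
  functions, i.e. entire functions of \<open>s\<close> and \<open>log (2 \<pi> \<i> k - w)\<close>. What remains is holomorphic for
  \<open>|Im w| < 2 \<pi> (K + 1)\<close>, first for \<open>Re s > 0\<close>, and then for all \<open>s\<close> because \<open>d/dw\<close> lowers \<open>s\<close> by one. The
  restriction on \<open>c\<close> is lifted by \<open>\<Phi>(s, z, c) = \<Sum>\<^sub>n\<^sub><\<^sub>N z\<^sup>n (n + c)\<^bsup>-s\<^esup> + z\<^sup>N \<Phi>(s, z, c + N)\<close>.

  Thus the continuation along a path depends only on the end point and on the continuations of
  \<open>log z\<close>, \<open>log (c + n)\<close> and \<open>log (2 \<pi> \<i> k - log z)\<close>. A commutator of loops does not change \<open>log z\<close> and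
  \<open>log (c + n)\<close>. So on the commutator subgroup the path of \<open>log z\<close> is a loop, its winding number around
  \<open>2 \<pi> \<i> k\<close> is a homomorphism, and the second commutator subgroup fixes the third family as well.
\<close>

section \<open>Separately holomorphic functions of three variables\<close>

text \<open>There are infinitely many branch points, \<open>2 * pi * i * k\<close> for
  \<open>log z\<close> and \<open>- n\<close> for \<open>c\<close>, but one path stays in a bounded
  region; hence the cut-offs \<open>K\<close> and \<open>N\<close>. They have to bound the whole
  path and not just its end: then each logarithm outside the cut-offs has its principal value at the
  end, so enlarging a cut-off merely moves terms from the regular part into the explicit sums, and
  any two paths can be compared under common cut-offs.

  No germs are continued. The continuation is a closed formula in the continued logarithms, which
  turns homotopy invariance and monodromy into statements about winding numbers. The identities
  behind the formula are proved for \<open>Re w < 0\<close>, where the series converges, and spread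
  over a strip by the identity theorem.

  The numerator \<open>e^u\<close> of the pole terms keeps them decaying as \<open>Re u\<close>
  tends to minus infinity, and \<open>c\<close> enters their transforms only through the factor
  \<open>exp (per k * c)\<close>.

  Continuity is part of the notion of separate holomorphy, so that Osgood's lemma suffices and
  Hartogs's theorem is avoided.\<close>

definition sep_holo :: "(pt \<Rightarrow> complex) \<Rightarrow> pt set \<Rightarrow> bool" where
  "sep_holo f U \<longleftrightarrow> open U \<and> continuous_on U f \<and>
     (\<forall>s w c. (s, w, c) \<in> U \<longrightarrow>
        (\<lambda>x. f (x, w, c)) field_differentiable at s \<and>
        (\<lambda>x. f (s, x, c)) field_differentiable at w \<and>
        (\<lambda>x. f (s, w, x)) field_differentiable at c)"

lemma sep_holoI:
  assumes "open U" "continuous_on U f"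
    and "\<And>s w c. (s, w, c) \<in> U \<Longrightarrow> (\<lambda>x. f (x, w, c)) field_differentiable at s"
    and "\<And>s w c. (s, w, c) \<in> U \<Longrightarrow> (\<lambda>x. f (s, x, c)) field_differentiable at w"
    and "\<And>s w c. (s, w, c) \<in> U \<Longrightarrow> (\<lambda>x. f (s, w, x)) field_differentiable at c"
  shows "sep_holo f U"
  using assms unfolding sep_holo_def by blast

lemma sep_holoD:
  assumes "sep_holo f U"
  shows "open U" "continuous_on U f"
    and "(s, w, c) \<in> U \<Longrightarrow> (\<lambda>x. f (x, w, c)) field_differentiable at s"
    and "(s, w, c) \<in> U \<Longrightarrow> (\<lambda>x. f (s, x, c)) field_differentiable at w"
    and "(s, w, c) \<in> U \<Longrightarrow> (\<lambda>x. f (s, w, x)) field_differentiable at c"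
  using assms unfolding sep_holo_def by blast+

lemma dist_slice [simp]:
  fixes s w c x :: complex
  shows "dist (s, w, c) (x, w, c) = dist s x"
    and "dist (s, w, c) (s, x, c) = dist w x"
    and "dist (s, w, c) (s, w, x) = dist c x"
  by (simp_all add: dist_Pair_Pair)

lemma dist_triple_component_le:
  fixes s w c s' w' c' :: complex
  shows "dist s s' \<le> dist (s, w, c) (s', w', c')"
    and "dist w w' \<le> dist (s, w, c) (s', w', c')"
    and "dist c c' \<le> dist (s, w, c) (s', w', c')"
  using dist_fst_le[of "(s, w, c)" "(s', w', c')"] dist_snd_le[of "(s, w, c)" "(s', w', c')"]
    dist_fst_le[of "(w, c)" "(w', c')"] dist_snd_le[of "(w, c)" "(w', c')"] by auto

lemma sep_holo_cong:
  assumes "sep_holo f U" "\<And>x. x \<in> U \<Longrightarrow> f x = g x"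
  shows "sep_holo g U"
proof (rule sep_holoI)
  show U: "open U" using assms(1) by (rule sep_holoD)
  show "continuous_on U g"
    using sep_holoD(2)[OF assms(1)] assms(2) by (simp cong: continuous_on_cong)
  fix s w c assume x: "(s, w, c) \<in> U"
  obtain r where r: "r > 0" "ball (s, w, c) r \<subseteq> U" using U x by (meson openE)
  note T = field_differentiable_transform_within[OF r(1)]
  show "(\<lambda>x. g (x, w, c)) field_differentiable at s" "(\<lambda>x. g (s, x, c)) field_differentiable at w"
    "(\<lambda>x. g (s, w, x)) field_differentiable at c"
    using T[OF _ _ sep_holoD(3)[OF assms(1) x]] T[OF _ _ sep_holoD(4)[OF assms(1) x]]
      T[OF _ _ sep_holoD(5)[OF assms(1) x]] r assms(2)
    by (auto simp: dist_commute subset_iff)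
qed

lemma sep_holo_subset: "sep_holo f U \<Longrightarrow> open V \<Longrightarrow> V \<subseteq> U \<Longrightarrow> sep_holo f V"
  unfolding sep_holo_def by (meson continuous_on_subset subsetD)

lemma sep_holo_local:
  assumes "\<And>x. x \<in> U \<Longrightarrow> \<exists>V. x \<in> V \<and> V \<subseteq> U \<and> sep_holo f V"
  shows "sep_holo f U"
proof (rule sep_holoI)
  show U: "open U"
    using assms by (subst open_subopen) (metis sep_holoD(1))
  show "continuous_on U f"
    using assms by (metis U continuous_at_imp_continuous_on continuous_on_eq_continuous_at sep_holoD(1,2))
next
  fix s w c assume "(s, w, c) \<in> U"
  then obtain V where V: "(s, w, c) \<in> V" "sep_holo f V" using assms by blast
  show "(\<lambda>x. f (x, w, c)) field_differentiable at s"
    "(\<lambda>x. f (s, x, c)) field_differentiable at w"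
    "(\<lambda>x. f (s, w, x)) field_differentiable at c"
    using sep_holoD(3-5)[OF V(2,1)] by blast+
qed

lemma sep_holo_mult:
  "sep_holo f U \<Longrightarrow> sep_holo g U \<Longrightarrow> sep_holo (\<lambda>x. f x * g x) U"
  by (auto simp: sep_holo_def intro!: continuous_intros field_differentiable_mult)

lemma sep_holo_diff:
  "sep_holo f U \<Longrightarrow> sep_holo g U \<Longrightarrow> sep_holo (\<lambda>x. f x - g x) U"
  by (auto simp: sep_holo_def intro!: continuous_intros field_differentiable_diff)

lemma sep_holo_add:
  "sep_holo f U \<Longrightarrow> sep_holo g U \<Longrightarrow> sep_holo (\<lambda>x. f x + g x) U"
  by (auto simp: sep_holo_def intro!: continuous_intros field_differentiable_add)

lemma sep_holo_sum:
  assumes "open U" "\<And>i. i \<in> I \<Longrightarrow> sep_holo (f i) U"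
  shows "sep_holo (\<lambda>x. \<Sum>i\<in>I. f i x) U"
  using assms
  by (auto simp: sep_holo_def intro!: continuous_intros field_differentiable_sum)

lemma sep_holo_atoms:
  assumes "open U"
  shows "sep_holo (\<lambda>x. fst x) U" "sep_holo (\<lambda>x. fst (snd x)) U" "sep_holo (\<lambda>x. snd (snd x)) U" "sep_holo (\<lambda>_. a) U"
  using assms by (auto simp: sep_holo_def intro!: continuous_intros)

lemma sep_holo_exp: "sep_holo f U \<Longrightarrow> sep_holo (\<lambda>x. exp (f x)) U"
  unfolding sep_holo_def
  by (auto intro!: continuous_intros field_differentiable_compose[OF _ field_differentiable_within_exp, unfolded o_def])

section \<open>Differentiation under the integral sign\<close>

text \<open>The difference quotients are dominated by Cauchy's estimate for the derivative.\<close>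
lemma has_field_derivative_integral_dominated:
  fixes f f' :: "complex \<Rightarrow> 'a \<Rightarrow> complex"
  assumes r: "r > 0"
    and meas: "\<And>x. x \<in> ball a r \<Longrightarrow> f x \<in> borel_measurable M"
    and der: "\<And>x t. x \<in> ball a r \<Longrightarrow> t \<in> space M \<Longrightarrow>
                ((\<lambda>x. f x t) has_field_derivative f' x t) (at x)"
    and g: "integrable M g"
    and bound: "\<And>x t. x \<in> ball a r \<Longrightarrow> t \<in> space M \<Longrightarrow> norm (f x t) \<le> g t"
  shows "integrable M (f' a)"
    and "((\<lambda>x. \<integral>t. f x t \<partial>M) has_field_derivative (\<integral>t. f' a t \<partial>M)) (at a)"
proof -
  have int: "integrable M (f x)" if "x \<in> ball a r" for x
    using g meas[OF that]
    by (rule Bochner_Integration.integrable_bound)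
       (use bound[OF that] in \<open>auto intro!: AE_I2 order_trans[OF _ abs_ge_self]\<close>)
  \<comment> \<open>Points of the half ball leave room for circles of radius \<open>r/4\<close>;
    this is the origin of the factor 4.\<close>
  have f'_bound: "norm (f' x t) \<le> 4 * g t / r" if "x \<in> ball a (r/2)" "t \<in> space M" for x t
  proof -
    have sub: "cball x (r/4) \<subseteq> ball a r"
    proof
      fix y assume "y \<in> cball x (r/4)"
      then show "y \<in> ball a r"
        using that dist_triangle[of a y x] r by (auto simp: dist_commute)
    qed
    have hol: "(\<lambda>x. f x t) holomorphic_on ball a r"
      using der[OF _ that(2)] unfolding holomorphic_on_open[OF open_ball] by blast
    have "norm ((deriv ^^ 1) (\<lambda>x. f x t) x) \<le> fact 1 * g t / (r/4) ^ 1"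
    proof (rule Cauchy_inequality)
      show "(\<lambda>x. f x t) holomorphic_on ball x (r/4)"
        using hol sub by (meson ball_subset_cball holomorphic_on_subset order_trans)
      show "continuous_on (cball x (r/4)) (\<lambda>x. f x t)"
        using hol sub by (meson continuous_on_subset holomorphic_on_imp_continuous_on)
      show "norm (f y t) \<le> g t" if "norm (x - y) = r/4" for y
        using sub that \<open>t \<in> space M\<close> by (intro bound) (auto simp: dist_norm subset_iff)
    qed (use r in auto)
    moreover have "x \<in> ball a r" using sub r by (auto simp: subset_iff)
    ultimately show ?thesis
      using DERIV_imp_deriv[OF der[OF _ that(2), of x]] by (simp add: field_simps)
  qed
  \<comment> \<open>\<open>f'\<close> inherits measurability from the difference quotients along
    \<open>h\<close>; the denominator \<open>2 + n\<close> keeps \<open>a + h n\<close> inside the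
    ball.\<close>
  have "f' a \<in> borel_measurable M"
  proof (rule borel_measurable_LIMSEQ_metric)
    define h where "h = (\<lambda>n. of_real (r / (2 + real n)) :: complex)"
    have h: "a + h n \<in> ball a r" "h n \<noteq> 0" for n
      using r by (auto simp: h_def dist_norm norm_divide field_simps add_pos_nonneg simp del: of_real_divide of_real_add)
    show "(\<lambda>t. (f (a + h n) t - f a t) / h n) \<in> borel_measurable M" for n
      using meas[OF h(1)[of n]] meas[of a] r
      by (intro borel_measurable_divide borel_measurable_diff) auto
    have "h \<longlonglongrightarrow> of_real 0"
      unfolding h_def by (intro tendsto_of_real real_tendsto_divide_at_top[OF tendsto_const]
          filterlim_tendsto_add_at_top[OF tendsto_const] filterlim_real_sequentially)
    then have h0: "h \<longlonglongrightarrow> 0" by simp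
    show "(\<lambda>n. (f (a + h n) t - f a t) / h n) \<longlonglongrightarrow> f' a t" if "t \<in> space M" for t
      using der[of a t] that r h0 h(2)
      by (auto simp: DERIV_def tendsto_at_iff_sequentially o_def)
  qed
  moreover have "AE t in M. norm (f' a t) \<le> norm (4 * g t / r)"
  proof (rule AE_I2)
    fix t assume "t \<in> space M"
    then have "norm (f' a t) \<le> 4 * g t / r" using f'_bound[of a] r by auto
    then show "norm (f' a t) \<le> norm (4 * g t / r)" unfolding real_norm_def by (rule order_trans[OF _ abs_ge_self])
  qed
  ultimately show "integrable M (f' a)"
    using g by (intro Bochner_Integration.integrable_bound[of M "\<lambda>t. 4 * g t / r" "f' a"] integrable_divide integrable_mult_right)
  have quot: "norm ((f x t - f a t) / (x - a)) \<le> 4 * g t / r"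
    if "x \<in> ball a (r/2)" "t \<in> space M" "x \<noteq> a" for x t
  proof -
    have "norm (f x t - f a t) \<le> 4 * g t / r * norm (x - a)"
    proof (rule field_differentiable_bound[of "ball a (r/2)" _ "\<lambda>x. f' x t"])
      show "((\<lambda>x. f x t) has_field_derivative f' z t) (at z within ball a (r/2))"
        if "z \<in> ball a (r/2)" for z
        using der[of z t] that \<open>t \<in> space M\<close> r by (auto intro: has_field_derivative_at_within)
    qed (use that f'_bound r in auto)
    then show ?thesis using that by (simp add: norm_divide field_simps)
  qed
  show "((\<lambda>x. \<integral>t. f x t \<partial>M) has_field_derivative (\<integral>t. f' a t \<partial>M)) (at a)"
    unfolding has_field_derivative_iff tendsto_at_iff_sequentially
  proof (intro allI impI)
    fix X :: "nat \<Rightarrow> complex" assume X: "\<forall>i. X i \<in> UNIV - {a}" "X \<longlonglongrightarrow> a"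
    have "\<forall>\<^sub>F n in sequentially. X n \<in> ball a (r/2)"
      using X(2) r by (metis centre_in_ball half_gt_zero open_ball topological_tendstoD)
    then obtain N where N: "\<And>n. n \<ge> N \<Longrightarrow> X n \<in> ball a (r/2)"
      by (auto simp: eventually_sequentially)
    define Y where "Y = (\<lambda>n. X (n + N))"
    have Y: "Y n \<in> ball a (r/2)" "Y n \<in> ball a r" "Y n \<noteq> a" for n
      using N[of "n + N"] X(1) r by (auto simp: Y_def)
    have Ya: "Y \<longlonglongrightarrow> a" unfolding Y_def using X(2) by (rule LIMSEQ_ignore_initial_segment)
    have lim: "(\<lambda>n. (f (Y n) t - f a t) / (Y n - a)) \<longlonglongrightarrow> f' a t" if t: "t \<in> space M" for t
    proof -
      have "((\<lambda>x. (f x t - f a t) / (x - a)) \<longlongrightarrow> f' a t) (at a)"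
        using der[of a t] t r by (simp add: has_field_derivative_iff)
      then show ?thesis
        using Ya Y(3) by (auto simp: tendsto_at_iff_sequentially o_def)
    qed
    have measq: "(\<lambda>t. (f (Y n) t - f a t) / (Y n - a)) \<in> borel_measurable M" for n
      using meas[OF Y(2)[of n]] meas[of a] r by (intro borel_measurable_divide borel_measurable_diff) auto
    have "(\<lambda>n. \<integral>t. (f (Y n) t - f a t) / (Y n - a) \<partial>M) \<longlonglongrightarrow> (\<integral>t. f' a t \<partial>M)"
    proof (rule integral_dominated_convergence[where w = "\<lambda>t. 4 * g t / r"])
      show "f' a \<in> borel_measurable M"
        using \<open>integrable M (f' a)\<close> by simp
      show "integrable M (\<lambda>t. 4 * g t / r)" using g by simp
    qed (use measq lim quot Y in auto)
    moreover have "(\<integral>t. (f (Y n) t - f a t) / (Y n - a) \<partial>M) =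
        ((\<integral>t. f (Y n) t \<partial>M) - (\<integral>t. f a t \<partial>M)) / (Y n - a)" for n
      using int[OF Y(2)[of n]] int[of a] r
      by (simp only: integral_divide_zero Bochner_Integration.integral_diff centre_in_ball)
    ultimately have "(\<lambda>n. ((\<lambda>x. ((\<integral>t. f x t \<partial>M) - (\<integral>t. f a t \<partial>M)) / (x - a)) \<circ> X) (n + N))
        \<longlonglongrightarrow> (\<integral>t. f' a t \<partial>M)"
      by (simp only: Y_def o_def)
    then show "((\<lambda>x. ((\<integral>t. f x t \<partial>M) - (\<integral>t. f a t \<partial>M)) / (x - a)) \<circ> X)
        \<longlonglongrightarrow> (\<integral>t. f' a t \<partial>M)"
      by (rule LIMSEQ_offset)
  qed
qed

text \<open>Dominated convergence gives continuity, and the previous lemma gives each partial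
  derivative. The bound is asked for on \<open>ball x r \<inter> U\<close>, so that a user need not
  shrink \<open>r\<close> to remain in \<open>U\<close>.\<close>

lemma sep_holo_integral:
  fixes f :: "pt \<Rightarrow> 'a \<Rightarrow> complex"
  assumes U: "open U"
    and sep: "\<And>t. t \<in> space M \<Longrightarrow> sep_holo (\<lambda>x. f x t) U"
    and meas: "\<And>x. x \<in> U \<Longrightarrow> f x \<in> borel_measurable M"
    and dom: "\<And>x. x \<in> U \<Longrightarrow> \<exists>r>0. \<exists>g. integrable M g \<and>
                (\<forall>y\<in>ball x r \<inter> U. \<forall>t\<in>space M. norm (f y t) \<le> g t)"
  shows "sep_holo (\<lambda>x. \<integral>t. f x t \<partial>M) U"
proof -
  have dom': "\<exists>r>0. ball x r \<subseteq> U \<and> (\<exists>g. integrable M g \<and>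
                (\<forall>y\<in>ball x r. \<forall>t\<in>space M. norm (f y t) \<le> g t))" if "x \<in> U" for x
  proof -
    obtain r g where r: "r > 0" "integrable M g"
      "\<forall>y\<in>ball x r \<inter> U. \<forall>t\<in>space M. norm (f y t) \<le> g t" using dom[OF \<open>x \<in> U\<close>] by blast
    obtain r' where r': "r' > 0" "ball x r' \<subseteq> U" using U \<open>x \<in> U\<close> by (meson openE)
    show ?thesis
      by (rule exI[of _ "min r r'"]) (use r r' in \<open>auto intro!: exI[of _ g]\<close>)
  qed
  show ?thesis
  proof (rule sep_holoI)
    show "continuous_on U (\<lambda>x. \<integral>t. f x t \<partial>M)"
    proof (rule continuous_at_imp_continuous_on, rule ballI)
      fix x assume x: "x \<in> U"
      obtain r g where r: "r > 0" "ball x r \<subseteq> U" "integrable M g"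
        "\<And>y t. y \<in> ball x r \<Longrightarrow> t \<in> space M \<Longrightarrow> norm (f y t) \<le> g t"
        using dom'[OF x] by blast
      show "isCont (\<lambda>x. \<integral>t. f x t \<partial>M) x"
        unfolding continuous_at_sequentially
      proof (intro allI impI)
        fix X :: "nat \<Rightarrow> pt" assume X: "X \<longlonglongrightarrow> x"
        have "\<forall>\<^sub>F n in sequentially. X n \<in> ball x r"
          using X r by (metis centre_in_ball open_ball topological_tendstoD)
        then obtain N where N: "\<And>n. n \<ge> N \<Longrightarrow> X n \<in> ball x r"
          by (auto simp: eventually_sequentially)
        have "(\<lambda>n. \<integral>t. f (X (n + N)) t \<partial>M) \<longlonglongrightarrow> (\<integral>t. f x t \<partial>M)"
        proof (rule integral_dominated_convergence[where w = g])
          show "f x \<in> borel_measurable M" "f (X (n + N)) \<in> borel_measurable M" for n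
            using meas[OF x] meas[of "X (n + N)"] N[of "n + N"] r(2) by (auto simp: subset_iff simp del: split_paired_All)
          show "AE t in M. (\<lambda>n. f (X (n + N)) t) \<longlonglongrightarrow> f x t"
          proof (rule AE_I2)
            fix t assume t: "t \<in> space M"
            have "isCont (\<lambda>x. f x t) x"
              using sep_holoD(1,2)[OF sep[OF t]] x by (simp add: continuous_on_eq_continuous_at)
            then have "(\<lambda>n. f (X n) t) \<longlonglongrightarrow> f x t"
              using X by (simp add: continuous_at_sequentially o_def)
            then show "(\<lambda>n. f (X (n + N)) t) \<longlonglongrightarrow> f x t"
              by (rule LIMSEQ_ignore_initial_segment)
          qed
        qed (use r N in auto)
        then show "((\<lambda>x. \<integral>t. f x t \<partial>M) \<circ> X) \<longlonglongrightarrow> (\<integral>t. f x t \<partial>M)"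
          unfolding o_def by (rule LIMSEQ_offset)
      qed
    qed
  next
    fix s w c assume x: "(s, w, c) \<in> U"
    obtain r g where r: "r > 0" "ball (s, w, c) r \<subseteq> U" "integrable M g"
      "\<And>y t. y \<in> ball (s, w, c) r \<Longrightarrow> t \<in> space M \<Longrightarrow> norm (f y t) \<le> g t"
      using dom'[OF x] by blast
    have slice: "(\<lambda>x. \<integral>t. f (\<phi> x) t \<partial>M) field_differentiable at a"
      if \<phi>: "\<And>x. x \<in> ball a r \<Longrightarrow> \<phi> x \<in> ball (s, w, c) r"
        and d: "\<And>x t. x \<in> ball a r \<Longrightarrow> t \<in> space M \<Longrightarrow> (\<lambda>x. f (\<phi> x) t) field_differentiable at x"
      for \<phi> a
      unfolding field_differentiable_def
      by (rule exI, rule has_field_derivative_integral_dominated(2)[OF r(1), where g = g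
            and f' = "\<lambda>x t. deriv (\<lambda>x. f (\<phi> x) t) x"])
         (use \<phi> d r(3,4) meas[OF subsetD[OF r(2) \<phi>]] in \<open>auto simp: field_differentiable_derivI\<close>)
    show "(\<lambda>x. \<integral>t. f (x, w, c) t \<partial>M) field_differentiable at s"
      by (rule slice) (use r(2) in \<open>auto simp: subset_iff intro!: sep_holoD(3)[OF sep]\<close>)
    show "(\<lambda>x. \<integral>t. f (s, x, c) t \<partial>M) field_differentiable at w"
      by (rule slice) (use r(2) in \<open>auto simp: subset_iff intro!: sep_holoD(4)[OF sep]\<close>)
    show "(\<lambda>x. \<integral>t. f (s, w, x) t \<partial>M) field_differentiable at c"
      by (rule slice) (use r(2) in \<open>auto simp: subset_iff intro!: sep_holoD(5)[OF sep]\<close>)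
  qed (rule U)
qed

section \<open>Cauchy's formula with parameters and Osgood's lemma\<close>

abbreviation munit :: "real measure" where
  "munit \<equiv> restrict_space lborel {0..1}"

lemma integral_restrict_Icc:
  fixes f :: "real \<Rightarrow> complex"
  assumes "continuous_on {a..b} f"
  shows "f \<in> borel_measurable (restrict_space lborel {a..b})"
    and "integrable (restrict_space lborel {a..b}) f"
    and "(\<integral>t. f t \<partial>restrict_space lborel {a..b}) = integral {a..b} f"
proof -
  have "set_integrable lborel {a..b} f"
    using assms by (rule borel_integrable_atLeastAtMost')
  then show 1: "integrable (restrict_space lborel {a..b}) f"
    by (simp add: set_integrable_def integrable_restrict_space)
  then show "f \<in> borel_measurable (restrict_space lborel {a..b})" by simp
  show "(\<integral>t. f t \<partial>restrict_space lborel {a..b}) = integral {a..b} f"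
    using set_borel_integral_eq_integral(2)[OF \<open>set_integrable lborel {a..b} f\<close>]
    by (simp add: integral_restrict_space set_lebesgue_integral_def)
qed

lemma integrable_const_restrict_Icc: "integrable (restrict_space lborel {a..b}) (\<lambda>_::real. B::real)"
proof -
  have "set_integrable lborel {a..b} (\<lambda>_::real. B::real)"
    by (rule borel_integrable_atLeastAtMost') simp
  then show ?thesis by (simp add: set_integrable_def integrable_restrict_space)
qed

text \<open>Cauchy's formula over a fixed circle writes the derivative as an integral whose
  integrand is separately holomorphic in all three variables. It serves Osgood's lemma and, later,
  the continuation in \<open>s\<close>.\<close>

lemma sep_holo_deriv2:
  assumes f: "sep_holo f U"
  shows "sep_holo (\<lambda>(s, w, c). deriv (\<lambda>x. f (s, x, c)) w) U"
proof (rule sep_holo_local)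
  fix x0 assume "x0 \<in> U"
  then obtain s0 w0 c0 where x0: "x0 = (s0, w0, c0)" "(s0, w0, c0) \<in> U" by (cases x0) auto
  obtain e where e: "e > 0" "ball (s0, w0, c0) e \<subseteq> U"
    using sep_holoD(1)[OF f] x0(2) by (meson openE)
  \<comment> \<open>The polydisc \<open>K\<close> has radii \<open>r\<close>, \<open>2 * r\<close>,
    \<open>r\<close>, so its points have distance at most \<open>4 * r = e / 2\<close> from the
    centre.\<close>
  define r where "r = e / 8"
  have r: "r > 0" using e by (simp add: r_def)
  define K where "K = cball s0 r \<times> cball w0 (2 * r) \<times> cball c0 r"
  define V where "V = ball s0 r \<times> ball w0 r \<times> ball c0 r"
  have KU: "K \<subseteq> U"
  proof
    fix y assume "y \<in> K"
    then obtain s w c where y: "y = (s, w, c)" "dist s0 s \<le> r" "dist w0 w \<le> 2 * r" "dist c0 c \<le> r"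
      by (auto simp: K_def)
    have "dist (s0, w0, c0) y \<le> dist s0 s + (dist w0 w + dist c0 c)"
      unfolding y dist_Pair_Pair
      using sqrt_sum_squares_le_sum_abs[of "dist s0 s" "sqrt ((dist w0 w)\<^sup>2 + (dist c0 c)\<^sup>2)"]
        sqrt_sum_squares_le_sum_abs[of "dist w0 w" "dist c0 c"] by simp
    also have "\<dots> < e" using y e by (simp add: r_def)
    finally show "y \<in> U" using e by auto
  qed
  have "compact K" by (auto simp: K_def intro!: compact_Times)
  then have "bounded (f ` K)"
    by (intro compact_imp_bounded compact_continuous_image continuous_on_subset[OF sep_holoD(2)[OF f] KU])
  then obtain B where B: "\<And>y. y \<in> K \<Longrightarrow> norm (f y) \<le> B" by (auto simp: bounded_iff)
  have V: "open V" "x0 \<in> V" "V \<subseteq> U"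
    using r KU by (auto simp: V_def K_def x0 intro!: open_Times)
  define \<gamma> where "\<gamma> = (\<lambda>t::real. w0 + 2 * of_real r * exp (2 * of_real pi * \<i> * of_real t))"
  have \<gamma>_dist: "dist w0 (\<gamma> t) = 2 * r" for t
    using r by (simp add: \<gamma>_def dist_norm norm_mult)
  have \<gamma>_far: "norm (\<gamma> t - w) \<ge> r" if "w \<in> ball w0 r" for w t
    using \<gamma>_dist[of t] dist_triangle[of w0 "\<gamma> t" w] that by (simp add: dist_norm norm_minus_commute)
  \<comment> \<open>The Cauchy integrand on the circle of radius \<open>2 * r\<close>; the last
    factor is the velocity of \<open>\<gamma>\<close>.\<close>
  define h where "h = (\<lambda>(s, w, c) t. f (s, \<gamma> t, c) / (\<gamma> t - w)\<^sup>2 * (4 * of_real pi * \<i> * of_real r * exp (2 * of_real pi * \<i> * of_real t)))"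
  have hK: "(s, \<gamma> t, c) \<in> K" if "(s, w, c) \<in> V" for s w c t
    using that \<gamma>_dist[of t] by (auto simp: V_def K_def)
  have hol: "continuous_on (cball w0 (2 * r)) (\<lambda>x. f (s, x, c))"
    "(\<lambda>x. f (s, x, c)) holomorphic_on ball w0 (2 * r)" if "(s, w, c) \<in> V" for s w c
  proof -
    have *: "(s, x, c) \<in> U" if "x \<in> cball w0 (2 * r)" for x
      using that \<open>(s, w, c) \<in> V\<close> KU by (auto simp: V_def K_def)
    show "continuous_on (cball w0 (2 * r)) (\<lambda>x. f (s, x, c))"
      by (rule continuous_on_compose2[OF sep_holoD(2)[OF f]]) (use * in \<open>auto intro!: continuous_intros\<close>)
    show "(\<lambda>x. f (s, x, c)) holomorphic_on ball w0 (2 * r)"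
      unfolding holomorphic_on_def
      by (intro ballI field_differentiable_at_within[OF sep_holoD(4)[OF f *]]) auto
  qed
  have \<gamma>_cont: "continuous_on S \<gamma>" for S unfolding \<gamma>_def by (intro continuous_intros)
  have h_cont: "continuous_on {0..1} (h y)" if y: "y \<in> V" for y
  proof -
    obtain s w c where y': "y = (s, w, c)" by (cases y)
    have "\<gamma> t \<noteq> w" for t using \<gamma>_far[of w t] y r by (auto simp: y' V_def)
    moreover have "continuous_on {0..1} (\<lambda>t. f (s, \<gamma> t, c))"
      by (rule continuous_on_compose2[OF hol(1)[of s w c]])
         (use y \<gamma>_dist in \<open>auto simp: y' intro!: \<gamma>_cont\<close>)
    ultimately show ?thesis
      unfolding y' h_def by (auto intro!: continuous_intros \<gamma>_cont)
  qed
  have "sep_holo (\<lambda>y. \<integral>t. h y t \<partial>munit) V"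
  proof (rule sep_holo_integral)
    show "h y \<in> borel_measurable munit" if "y \<in> V" for y
      by (intro integral_restrict_Icc(1) h_cont that)
    show "\<exists>r>0. \<exists>g. integrable munit g \<and>
       (\<forall>y\<in>ball x r \<inter> V. \<forall>t\<in>space munit. norm (h y t) \<le> g t)"
      if "x \<in> V" for x
    proof (intro exI conjI ballI)
      show "(1::real) > 0" by simp
      show "integrable munit (\<lambda>_::real. B / r\<^sup>2 * (4 * pi * r))"
        by (rule integrable_const_restrict_Icc)
      fix y t assume "y \<in> ball x 1 \<inter> V"
      then obtain s w c where y: "y = (s, w, c)" "(s, w, c) \<in> V" by (cases y) auto
      have "B \<ge> 0" using B[OF hK[OF y(2)], of t] norm_ge_zero order_trans by blast
      have w: "w \<in> ball w0 r" using y by (auto simp: V_def)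
      have "norm (h y t) = norm (f (s, \<gamma> t, c)) / (norm (\<gamma> t - w))\<^sup>2 * (4 * pi * r)"
        using r by (simp add: h_def y norm_mult norm_divide norm_power)
      also have "\<dots> \<le> B / r\<^sup>2 * (4 * pi * r)"
        using \<gamma>_far[OF w, of t] B[OF hK[OF y(2)], of t] r \<open>B \<ge> 0\<close>
        by (intro mult_right_mono frac_le power_mono) auto
      finally show "norm (h y t) \<le> B / r\<^sup>2 * (4 * pi * r)" .
    qed
    show "sep_holo (\<lambda>y. h y t) V" for t
    proof (rule sep_holoI[OF V(1)])
      have ne: "\<gamma> t - w \<noteq> 0" if "(s, w, c) \<in> V" for s w c
        using \<gamma>_far[of w t] that r by (auto simp: V_def)
      have hU: "(s, \<gamma> t, c) \<in> U" if "(s, w, c) \<in> V" for s w c using hK that KU by blast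
      have "continuous_on V (\<lambda>y. f (fst y, \<gamma> t, snd (snd y)))"
        by (rule continuous_on_compose2[OF sep_holoD(2)[OF f]])
           (use hU in \<open>auto intro!: continuous_intros\<close>)
      moreover have "h y t = f (fst y, \<gamma> t, snd (snd y)) / (\<gamma> t - fst (snd y))\<^sup>2 * (4 * of_real pi * \<i> * of_real r * exp (2 * of_real pi * \<i> * of_real t))" for y
        by (cases y) (simp add: h_def)
      ultimately show "continuous_on V (\<lambda>y. h y t)"
        using ne by (auto intro!: continuous_intros)
      fix s w c assume V': "(s, w, c) \<in> V"
      show "(\<lambda>x. h (x, w, c) t) field_differentiable at s"
        unfolding h_def prod.case using ne[OF V']
        by (intro derivative_intros sep_holoD(3)[OF f] hU[OF V'] field_differentiable_const field_differentiable_divide field_differentiable_mult) auto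
      show "(\<lambda>x. h (s, w, x) t) field_differentiable at c"
        unfolding h_def prod.case using ne[OF V']
        by (intro derivative_intros sep_holoD(5)[OF f] hU[OF V'] field_differentiable_const field_differentiable_divide field_differentiable_mult) auto
      show "(\<lambda>x. h (s, x, c) t) field_differentiable at w"
        unfolding h_def prod.case using ne[OF V']
        by (intro derivative_intros field_differentiable_const field_differentiable_divide field_differentiable_mult field_differentiable_power field_differentiable_diff field_differentiable_ident) auto
    qed
  qed (rule V)
  moreover have "sep_holo (\<lambda>_. 1 / (2 * of_real pi * \<i>)) V"
    using V(1) by (auto intro!: sep_holoI)
  ultimately have "sep_holo (\<lambda>y. 1 / (2 * of_real pi * \<i>) * (\<integral>t. h y t \<partial>munit)) V"
    by (rule sep_holo_mult[rotated])
  then have "sep_holo (\<lambda>(s, w, c). deriv (\<lambda>x. f (s, x, c)) w) V"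
  proof (rule sep_holo_cong)
    fix y assume "y \<in> V"
    then obtain s w c where y: "y = (s, w, c)" "(s, w, c) \<in> V" by (cases y) auto
    have w: "w \<in> ball w0 (2 * r)" using y r by (auto simp: V_def)
    have "deriv (\<lambda>x. f (s, x, c)) w = 1 / (2 * of_real pi * \<i>) *
        contour_integral (circlepath w0 (2 * r)) (\<lambda>u. f (s, u, c) / (u - w)\<^sup>2)"
      by (intro DERIV_imp_deriv Cauchy_derivative_integral_circlepath(2)[OF hol[OF y(2)] w])
    also have "contour_integral (circlepath w0 (2 * r)) (\<lambda>u. f (s, u, c) / (u - w)\<^sup>2) =
        integral {0..1} (h y)"
      unfolding contour_integral_integral
    proof (rule integral_cong)
      fix t :: real assume "t \<in> {0..1}"
      then show "f (s, circlepath w0 (2 * r) t, c) / (circlepath w0 (2 * r) t - w)\<^sup>2 *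
          vector_derivative (circlepath w0 (2 * r)) (at t) = h y t"
        by (simp add: vector_derivative_circlepath h_def y)
           (simp add: circlepath \<gamma>_def mult_ac)
    qed
    also have "integral {0..1} (h y) = (\<integral>t. h y t \<partial>munit)"
      using integral_restrict_Icc(3)[OF h_cont] y by simp
    finally show "1 / (2 * of_real pi * \<i>) * (\<integral>t. h y t \<partial>munit) =
        (case y of (s, w, c) \<Rightarrow> deriv (\<lambda>x. f (s, x, c)) w)"
      by (simp add: y)
  qed
  then show "\<exists>V. x0 \<in> V \<and> V \<subseteq> U \<and> sep_holo (\<lambda>(s, w, c). deriv (\<lambda>x. f (s, x, c)) w) V"
    using V by blast
qed

lemma sep_holo_reindex:
  assumes f: "sep_holo f U" and \<phi>: "continuous_on UNIV \<phi>"
    and "\<And>s w c. \<phi> (s, w, c) \<in> U \<Longrightarrow> (\<lambda>x. f (\<phi> (x, w, c))) field_differentiable at s \<and>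
      (\<lambda>x. f (\<phi> (s, x, c))) field_differentiable at w \<and> (\<lambda>x. f (\<phi> (s, w, x))) field_differentiable at c"
  shows "sep_holo (\<lambda>x. f (\<phi> x)) (\<phi> -` U)"
proof (rule sep_holoI)
  show "open (\<phi> -` U)" by (rule open_vimage[OF sep_holoD(1)[OF f] \<phi>])
  show "continuous_on (\<phi> -` U) (\<lambda>x. f (\<phi> x))"
    by (rule continuous_on_compose2[OF sep_holoD(2)[OF f] continuous_on_subset[OF \<phi>]]) auto
qed (use assms(3) in auto)

text \<open>This swap and the next carry the result on the derivative in the second variable over to
  the other two.\<close>

lemma sep_holo_swap12:
  assumes "sep_holo f U"
  shows "sep_holo (\<lambda>x. f (case x of (w, s, c) \<Rightarrow> (s, w, c))) ((\<lambda>(w, s, c). (s, w, c)) -` U)"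
  by (rule sep_holo_reindex[OF assms])
     (use sep_holoD(3-5)[OF assms] in \<open>auto simp: case_prod_unfold intro!: continuous_intros\<close>)

lemma sep_holo_swap23:
  assumes "sep_holo f U"
  shows "sep_holo (\<lambda>x. f (case x of (s, c, w) \<Rightarrow> (s, w, c))) ((\<lambda>(s, c, w). (s, w, c)) -` U)"
  by (rule sep_holo_reindex[OF assms])
     (use sep_holoD(3-5)[OF assms] in \<open>auto simp: case_prod_unfold intro!: continuous_intros\<close>)

lemma sep_holo_deriv_continuous:
  assumes "sep_holo f U"
  shows "continuous_on U (\<lambda>(s, w, c). deriv (\<lambda>x. f (x, w, c)) s)"
    and "continuous_on U (\<lambda>(s, w, c). deriv (\<lambda>x. f (s, x, c)) w)"
    and "continuous_on U (\<lambda>(s, w, c). deriv (\<lambda>x. f (s, w, x)) c)"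
proof -
  have 1: "continuous_on U (\<lambda>(s, w, c). (w, s, c) :: pt)" and 3: "continuous_on U (\<lambda>(s, c, w). (s, w, c) :: pt)"
    by (auto simp: case_prod_unfold intro!: continuous_intros)
  show "continuous_on U (\<lambda>(s, w, c). deriv (\<lambda>x. f (x, w, c)) s)"
    using continuous_on_compose2[OF sep_holoD(2)[OF sep_holo_deriv2[OF sep_holo_swap12[OF assms]]] 1]
    by (force simp: case_prod_unfold)
  show "continuous_on U (\<lambda>(s, w, c). deriv (\<lambda>x. f (s, x, c)) w)"
    by (rule sep_holoD(2)[OF sep_holo_deriv2[OF assms]])
  show "continuous_on U (\<lambda>(s, w, c). deriv (\<lambda>x. f (s, w, x)) c)"
    using continuous_on_compose2[OF sep_holoD(2)[OF sep_holo_deriv2[OF sep_holo_swap23[OF assms]]] 3]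
    by (force simp: case_prod_unfold)
qed

text \<open>The mean value inequality for \<open>\<phi> z - D * z\<close>, whose derivative is at
  most \<open>e\<close> in norm.\<close>

lemma linear_approx_bound:
  fixes \<phi> :: "complex \<Rightarrow> complex"
  assumes "\<And>z. z \<in> ball a r \<Longrightarrow> \<phi> field_differentiable at z"
    and "\<And>z. z \<in> ball a r \<Longrightarrow> norm (deriv \<phi> z - D) \<le> e"
    and "b \<in> ball a r"
  shows "norm (\<phi> b - \<phi> a - D * (b - a)) \<le> e * norm (b - a)"
proof -
  have "norm ((\<phi> b - D * b) - (\<phi> a - D * a)) \<le> e * norm (b - a)"
  proof (rule field_differentiable_bound[of "ball a r" "\<lambda>z. \<phi> z - D * z" "\<lambda>z. deriv \<phi> z - D"])
    fix z assume z: "z \<in> ball a r"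
    show "((\<lambda>z. \<phi> z - D * z) has_field_derivative deriv \<phi> z - D) (at z within ball a r)"
      using field_differentiable_derivI[OF assms(1)[OF z]]
      
      by (intro has_field_derivative_at_within[OF DERIV_diff[OF _ DERIV_cmult_Id]])
  qed (use assms in \<open>auto intro: le_less_trans[OF zero_le_dist]\<close>)
  then show ?thesis by (simp add: algebra_simps)
qed

text \<open>The partial derivatives are continuous by Cauchy's formula, so changing one coordinate
  at a time, each with error \<open>e/3\<close>, gives total differentiability. The differential is
  complex linear because the partial derivatives are complex numbers.\<close>

lemma osgood_holo3:
  assumes f: "sep_holo f U"
  shows "holo3 f U"
  unfolding holo3_def
proof (intro conjI ballI)
  show U: "open U" using f by (rule sep_holoD)
  fix x assume "x \<in> U"
  then obtain s w c where x: "x = (s, w, c)" "(s, w, c) \<in> U" by (cases x) auto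
  define ds where "ds = (\<lambda>(s, w, c). deriv (\<lambda>x. f (x, w, c)) s)"
  define dw where "dw = (\<lambda>(s, w, c). deriv (\<lambda>x. f (s, x, c)) w)"
  define dc where "dc = (\<lambda>(s, w, c). deriv (\<lambda>x. f (s, w, x)) c)"
  have cont: "isCont ds x" "isCont dw x" "isCont dc x"
    using sep_holo_deriv_continuous[OF f] U \<open>x \<in> U\<close>
    by (simp_all add: ds_def dw_def dc_def continuous_on_eq_continuous_at)
  define D where "D = (\<lambda>(a, b, d). ds x * a + dw x * b + dc x * d)"
  have D_bl: "bounded_linear D"
    unfolding D_def case_prod_unfold
    by (intro bounded_linear_add bounded_linear_const_mult bounded_linear_fst
          bounded_linear_fst_comp bounded_linear_snd_comp bounded_linear_snd) 
  have "(f has_derivative D) (at x)"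
    unfolding has_derivative_at_alt
  proof (intro conjI allI impI)
    fix e :: real assume e: "e > 0"
    have "\<forall>\<^sub>F y in nhds x. dist (ds y) (ds x) < e/3 \<and> dist (dw y) (dw x) < e/3 \<and> dist (dc y) (dc x) < e/3 \<and> y \<in> U"
      using cont e U \<open>x \<in> U\<close> unfolding isCont_def tendsto_at_iff_tendsto_nhds
      by (intro eventually_conj tendstoD eventually_nhds_in_open) auto
    then obtain r where r: "r > 0" and near: "\<And>y. dist y x < r \<Longrightarrow>
        dist (ds y) (ds x) < e/3 \<and> dist (dw y) (dw x) < e/3 \<and> dist (dc y) (dc x) < e/3 \<and> y \<in> U"
      unfolding eventually_nhds_metric by blast
    \<comment> \<open>Three coordinate distances below \<open>r/3\<close> add up to a distance below
      \<open>r\<close>.\<close>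
    have near': "(s', w', c') \<in> U" "norm (deriv (\<lambda>x. f (x, w', c')) s' - ds x) \<le> e/3"
      "norm (deriv (\<lambda>x. f (s', x, c')) w' - dw x) \<le> e/3"
      "norm (deriv (\<lambda>x. f (s', w', x)) c' - dc x) \<le> e/3"
      if "dist s s' < r/3" "dist w w' < r/3" "dist c c' < r/3" for s' w' c'
    proof -
      have "dist (s', w', c') x \<le> dist s s' + (dist w w' + dist c c')"
        unfolding x dist_Pair_Pair
        using sqrt_sum_squares_le_sum_abs[of "dist s' s" "sqrt ((dist w' w)\<^sup>2 + (dist c' c)\<^sup>2)"]
          sqrt_sum_squares_le_sum_abs[of "dist w' w" "dist c' c"] by (simp add: dist_commute)
      also have "\<dots> < r" using that by simp
      finally show "(s', w', c') \<in> U" "norm (deriv (\<lambda>x. f (x, w', c')) s' - ds x) \<le> e/3"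
        "norm (deriv (\<lambda>x. f (s', x, c')) w' - dw x) \<le> e/3"
        "norm (deriv (\<lambda>x. f (s', w', x)) c' - dc x) \<le> e/3"
        using near[of "(s', w', c')"] by (auto simp: ds_def dw_def dc_def dist_norm)
    qed
    show "\<exists>d>0. \<forall>y. norm (y - x) < d \<longrightarrow> norm (f y - f x - D (y - x)) \<le> e * norm (y - x)"
    proof (intro exI[of _ "r/3"] conjI allI impI)
      fix y assume y: "norm (y - x) < r/3"
      obtain s' w' c' where y': "y = (s', w', c')" by (cases y)
      have le: "dist s s' \<le> norm (y - x)" "dist w w' \<le> norm (y - x)" "dist c c' \<le> norm (y - x)"
        using dist_triple_component_le[of s s' w c w' c'] dist_triple_component_le[of w w' s c s' c']
          dist_triple_component_le[of c c' s w s' w']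
        unfolding x y' by (metis dist_commute dist_norm)+
      then have lt: "dist s s' < r/3" "dist w w' < r/3" "dist c c' < r/3" using y by auto
      have 1: "norm (f (s', w', c') - f (s, w', c') - ds x * (s' - s)) \<le> e/3 * norm (s' - s)"
        by (rule linear_approx_bound[where r = "r/3"])
           (use lt near' sep_holoD(3)[OF f] in auto)
      have 2: "norm (f (s, w', c') - f (s, w, c') - dw x * (w' - w)) \<le> e/3 * norm (w' - w)"
        by (rule linear_approx_bound[where r = "r/3"])
           (use lt near' sep_holoD(4)[OF f] r in auto)
      have 3: "norm (f (s, w, c') - f (s, w, c) - dc x * (c' - c)) \<le> e/3 * norm (c' - c)"
        by (rule linear_approx_bound[where r = "r/3"])
           (use lt near' sep_holoD(5)[OF f] r in auto)
      \<comment> \<open>From \<open>x\<close> to \<open>y\<close> first \<open>c\<close> changes,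
        then \<open>w\<close>, then \<open>s\<close>.\<close>
      have "f y - f x - D (y - x) = (f (s', w', c') - f (s, w', c') - ds x * (s' - s)) +
          ((f (s, w', c') - f (s, w, c') - dw x * (w' - w)) +
           (f (s, w, c') - f (s, w, c) - dc x * (c' - c)))"
        by (simp add: x y' D_def)
      also have "norm \<dots> \<le> e/3 * norm (s' - s) + (e/3 * norm (w' - w) + e/3 * norm (c' - c))"
        by (intro norm_triangle_le add_mono 1 2 3)
      also have "\<dots> \<le> e/3 * norm (y - x) + (e/3 * norm (y - x) + e/3 * norm (y - x))"
        using le e by (intro add_mono mult_left_mono) (auto simp: dist_norm norm_minus_commute)
      finally show "norm (f y - f x - D (y - x)) \<le> e * norm (y - x)" by simp
    qed (use r in auto)
  qed (rule D_bl)
  moreover have "D (cmul3 a v) = a * D v" for a v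
    by (cases v) (simp add: D_def cmul3_def algebra_simps)
  ultimately show "\<exists>D. (f has_derivative D) (at x) \<and> (\<forall>a v. D (cmul3 a v) = a * D v)" by blast
qed

section \<open>Gamma integrals\<close>

definition mpos :: "real measure" where
  "mpos = restrict_space lborel {0<..}"

text \<open>The power of a positive real in a form that is visibly entire in the exponent.\<close>

definition cpow :: "complex \<Rightarrow> real \<Rightarrow> complex" where
  "cpow s t = exp (s * of_real (ln t))"

lemma space_mpos [simp]: "space mpos = {0<..}"
  by (simp add: mpos_def space_restrict_space)

lemma measurable_cpow [measurable]: "f \<in> borel_measurable M \<Longrightarrow> (\<lambda>t. cpow s (f t)) \<in> borel_measurable M"
  unfolding cpow_def by measurable

lemma measurable_ident_mpos [measurable]: "(\<lambda>t. t) \<in> borel_measurable mpos"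
  unfolding mpos_def by (rule measurable_restrict_space1) simp

lemma sigma_finite_mpos: "sigma_finite_measure mpos"
  unfolding mpos_def by (rule sigma_finite_measure_restrict_space[OF sigma_finite_lborel]) simp

lemma borel_measurable_mpos_continuous:
  "continuous_on {0<..} f \<Longrightarrow> f \<in> borel_measurable mpos"
  for f :: "real \<Rightarrow> 'a::topological_space"
  using borel_measurable_continuous_on_restrict[of "{0<..}" f]
  by (simp add: mpos_def cong: measurable_cong_sets)

lemma integrable_mpos_iff:
  fixes f :: "real \<Rightarrow> 'a::{banach, second_countable_topology}"
  shows "integrable mpos f \<longleftrightarrow> set_integrable lborel {0<..} f"
  by (simp add: mpos_def set_integrable_def integrable_restrict_space)

lemma cpow_eq_powr: "t > 0 \<Longrightarrow> cpow s t = of_real t powr s"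
  by (simp add: cpow_def powr_def Ln_of_real)

lemma norm_cpow: "t > 0 \<Longrightarrow> norm (cpow s t) = t powr Re s"
  by (simp add: cpow_def powr_def)

lemma integrable_powr_exp:
  fixes p \<delta> :: real
  assumes "p > 0" "\<delta> > 0"
  shows "integrable mpos (\<lambda>t. t powr (p - 1) * exp (- \<delta> * t))"
proof -
  have "set_integrable lebesgue {0<..} (\<lambda>t. complex_of_real t powr (of_real p - 1) / of_real (exp (\<delta> * t)))"
    by (rule absolutely_integrable_Gamma_integral) (use assms in auto)
  then have "set_integrable lebesgue {0<..} (\<lambda>t. norm (complex_of_real t powr (of_real p - 1) / of_real (exp (\<delta> * t))))"
    by (rule set_integrable_norm)
  also have "?this \<longleftrightarrow> set_integrable lebesgue {0<..} (\<lambda>t. t powr (p - 1) * exp (- \<delta> * t))"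
    by (intro set_integrable_cong)
       (auto simp: norm_divide norm_powr_real_powr exp_minus field_simps)
  finally show ?thesis
    unfolding integrable_mpos_iff set_integrable_def
    by (subst (asm) integrable_completion) auto
qed

text \<open>Euler's integral, rescaled by \<open>a\<close>. With the indicator inside
  \<open>f\<close> the substitution can be made on the whole line.\<close>

lemma integral_powr_exp_real:
  assumes s: "Re s > 0" and a: "a > (0::real)"
  shows "(\<integral>t. cpow (s - 1) t * exp (- of_real a * of_real t) \<partial>mpos) = Gamma s * of_real a powr (- s)"
proof -
  define f where "f = (\<lambda>t::real. indicator {0<..} t *\<^sub>R (cpow (s - 1) t * exp (- of_real t)))"
  have int: "set_integrable lborel {0<..} (\<lambda>t. cpow (s - 1) t * exp (- of_real t))"
    unfolding integrable_mpos_iff[symmetric]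
  proof (rule Bochner_Integration.integrable_bound[OF integrable_powr_exp[of "Re s" 1]])
    show "AE t in mpos. norm (cpow (s - 1) t * exp (- complex_of_real t)) \<le>
        norm (t powr (Re s - 1) * exp (- 1 * t))"
      by (rule AE_I2) (simp add: norm_mult norm_cpow)
  qed (use s in measurable)
  have "integral\<^sup>L lborel f = integral {0<..} (\<lambda>t. cpow (s - 1) t * exp (- of_real t))"
    unfolding f_def set_lebesgue_integral_def[symmetric] by (rule set_borel_integral_eq_integral(2)[OF int])
  also have "\<dots> = integral {0<..} (\<lambda>t. of_real t powr (s - 1) / of_real (exp t))"
    by (intro integral_cong) (auto simp: cpow_eq_powr exp_minus field_simps exp_of_real)
  also have "\<dots> = Gamma s"
    using Gamma_integral_complex'[OF s] by (rule integral_unique)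
  finally have Gam: "integral\<^sup>L lborel f = Gamma s" .
  have "integral\<^sup>L lborel f = \<bar>a\<bar> *\<^sub>R (\<integral>t. f (0 + a * t) \<partial>lborel)"
    using a by (intro lborel_integral_real_affine) auto
  also have "(\<lambda>t. f (0 + a * t)) = (\<lambda>t. cpow (s - 1) a * (indicator {0<..} t *\<^sub>R (cpow (s - 1) t * exp (- of_real a * of_real t))))"
  proof
    fix t :: real
    show "f (0 + a * t) = cpow (s - 1) a * (indicator {0<..} t *\<^sub>R (cpow (s - 1) t * exp (- of_real a * of_real t)))"
      using a by (cases "t > 0")
        (auto simp: f_def indicator_def zero_less_mult_iff cpow_def ln_mult algebra_simps exp_add exp_diff)
  qed
  also have "(\<integral>t. cpow (s - 1) a * (indicator {0<..} t *\<^sub>R (cpow (s - 1) t * exp (- of_real a * of_real t))) \<partial>lborel)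
     = cpow (s - 1) a * (\<integral>t. cpow (s - 1) t * exp (- of_real a * of_real t) \<partial>mpos)"
    unfolding mpos_def by (subst integral_restrict_space) (simp_all only: integral_mult_right_zero, simp)
  finally have "Gamma s = of_real a * cpow (s - 1) a * (\<integral>t. cpow (s - 1) t * exp (- of_real a * of_real t) \<partial>mpos)"
    using a by (simp add: Gam scaleR_conv_of_real)
  also have "of_real a * cpow (s - 1) a = of_real a powr s"
    using a by (simp add: cpow_eq_powr powr_diff)
  finally show ?thesis
    using a by (simp add: powr_minus field_simps)
qed

lemma integrable_cpow_exp:
  assumes "Re s > 0" "Re a > 0"
  shows "integrable mpos (\<lambda>t. cpow (s - 1) t * exp (- a * of_real t))"
proof (rule Bochner_Integration.integrable_bound[OF integrable_powr_exp[of "Re s" "Re a"]])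
  show "AE t in mpos. norm (cpow (s - 1) t * exp (- a * of_real t)) \<le> norm (t powr (Re s - 1) * exp (- Re a * t))"
    by (rule AE_I2) (simp add: norm_mult norm_cpow)
qed (use assms in measurable)

text \<open>Both sides are holomorphic in \<open>a\<close> on the right half-plane and agree on the
  positive reals, which accumulate at 1.\<close>

lemma integral_powr_exp:
  assumes s: "Re s > 0" and a: "Re a > 0"
  shows "(\<integral>t. cpow (s - 1) t * exp (- a * of_real t) \<partial>mpos) = Gamma s * a powr (- s)"
proof -
  define F where "F = (\<lambda>a. \<integral>t. cpow (s - 1) t * exp (- a * of_real t) \<partial>mpos)"
  have "F a - Gamma s * a powr (- s) = 0"
  proof (rule analytic_continuation[of "\<lambda>a. F a - Gamma s * a powr (- s)" "{a. Re a > 0}" "of_real ` {0<..}" 1])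
    have "F field_differentiable at b" if "Re b > 0" for b
      unfolding field_differentiable_def F_def
    proof (rule exI, rule has_field_derivative_integral_dominated(2)[where r = "Re b / 2"
          and g = "\<lambda>t. t powr (Re s - 1) * exp (- (Re b / 2) * t)"
          and f' = "\<lambda>a t. cpow (s - 1) t * (exp (- a * of_real t) * (- of_real t))"])
      fix x :: complex and t :: real assume x: "x \<in> ball b (Re b / 2)" and t: "t \<in> space mpos"
      have "Re b - Re x \<le> norm (b - x)" using complex_Re_le_cmod[of "b - x"] by simp
      then have *: "Re x \<ge> Re b / 2" using x by (simp add: dist_norm)
      show "norm (cpow (s - 1) t * exp (- x * of_real t)) \<le> t powr (Re s - 1) * exp (- (Re b / 2) * t)"
        using t mult_right_mono[OF *, of t] by (auto simp: norm_mult norm_cpow)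
      show "((\<lambda>x. cpow (s - 1) t * exp (- x * of_real t)) has_field_derivative
          cpow (s - 1) t * (exp (- x * of_real t) * - of_real t)) (at x)"
        by (auto intro!: derivative_eq_intros)
    qed (use that s integrable_powr_exp[of "Re s" "Re b / 2"] in auto)
    then show "(\<lambda>a. F a - Gamma s * a powr (- s)) holomorphic_on {a. Re a > 0}"
      by (intro holomorphic_intros)
         (auto simp: holomorphic_on_def complex_nonpos_Reals_iff intro: field_differentiable_at_within)
    show "connected {a. Re a > 0}"
      by (intro convex_connected convex_halfspace_Re_gt)
    show "(1::complex) islimpt of_real ` {0<..}"
    proof (rule islimpt_approachable[THEN iffD2], intro allI impI)
      fix e :: real assume "e > 0"
      then show "\<exists>x'\<in>complex_of_real ` {0<..}. x' \<noteq> 1 \<and> dist x' 1 < e"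
        by (intro bexI[of _ "of_real (1 + e / 2)"] imageI) (auto simp: dist_norm norm_divide)
    qed
    show "F z - Gamma s * z powr (- s) = 0" if "z \<in> of_real ` {0<..}" for z
      using that integral_powr_exp_real[OF s] by (auto simp: F_def)
  qed (use a in \<open>auto simp: open_halfspace_Re_gt\<close>)
  then show ?thesis by (simp add: F_def)
qed

lemma integral_powr_exp_norm:
  fixes p \<delta> :: real
  assumes "p > 0" "\<delta> > 0"
  shows "(\<integral>t. t powr (p - 1) * exp (- \<delta> * t) \<partial>mpos) = Gamma p * \<delta> powr (- p)"
proof -
  have "complex_of_real (\<integral>t. t powr (p - 1) * exp (- \<delta> * t) \<partial>mpos) =
      (\<integral>t. complex_of_real (t powr (p - 1) * exp (- \<delta> * t)) \<partial>mpos)"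
    by (rule integral_complex_of_real[symmetric])
  also have "\<dots> = (\<integral>t. cpow (of_real p - 1) t * exp (- of_real \<delta> * of_real t) \<partial>mpos)"
    by (rule Bochner_Integration.integral_cong)
       (auto simp: cpow_def powr_def exp_of_real[symmetric])
  also have "\<dots> = of_real (Gamma p * \<delta> powr (- p))"
    using assms by (subst integral_powr_exp_real)
      (auto simp: Gamma_complex_of_real powr_of_real[symmetric])
  finally show ?thesis by (simp only: of_real_eq_iff)
qed

text \<open>One exchange of integrals for two uses: the Lerch series (\<open>N\<close> the counting
  measure, \<open>X = n + c\<close>) and the pole terms (\<open>N = mpos\<close>,
  \<open>X = exp y\<close>). The hypothesis \<open>int\<close> is absolute convergence after the
  integration over \<open>t\<close> has been carried out.\<close>

lemma integral_Gamma_Fubini: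
  fixes \<rho> X :: "'a \<Rightarrow> complex"
  assumes "sigma_finite_measure N"
    and [measurable]: "\<rho> \<in> borel_measurable N" "X \<in> borel_measurable N"
    and s: "Re s > 0"
    and X: "\<And>\<omega>. \<omega> \<in> space N \<Longrightarrow> Re (X \<omega>) > 0"
    and int: "integrable N (\<lambda>\<omega>. norm (\<rho> \<omega>) * Re (X \<omega>) powr (- Re s))"
  shows "(\<integral>t. cpow (s - 1) t * (\<integral>\<omega>. \<rho> \<omega> * exp (- of_real t * X \<omega>) \<partial>N) \<partial>mpos) =
         Gamma s * (\<integral>\<omega>. \<rho> \<omega> * X \<omega> powr (- s) \<partial>N)"
proof -
  interpret N: sigma_finite_measure N by fact
  interpret P: sigma_finite_measure mpos by (rule sigma_finite_mpos)
  interpret pair_sigma_finite N mpos ..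
  define f where "f = (\<lambda>\<omega> t. \<rho> \<omega> * (cpow (s - 1) t * exp (- X \<omega> * of_real t)))"
  have norm_f: "norm (f \<omega> t) = norm (\<rho> \<omega>) * (t powr (Re s - 1) * exp (- Re (X \<omega>) * t))" if "t > 0" for \<omega> t
    using that by (simp add: f_def norm_mult norm_cpow)
  have "integrable (N \<Otimes>\<^sub>M mpos) (case_prod f)"
  proof (rule Fubini_integrable)
    show "case_prod f \<in> borel_measurable (N \<Otimes>\<^sub>M mpos)"
      unfolding f_def by measurable
    have "(\<integral>t. norm (f \<omega> t) \<partial>mpos) = Gamma (Re s) * (norm (\<rho> \<omega>) * Re (X \<omega>) powr (- Re s))"
      if "\<omega> \<in> space N" for \<omega>
    proof -
      have "(\<integral>t. norm (f \<omega> t) \<partial>mpos) = (\<integral>t. norm (\<rho> \<omega>) * (t powr (Re s - 1) * exp (- Re (X \<omega>) * t)) \<partial>mpos)"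
        by (rule Bochner_Integration.integral_cong) (auto simp: norm_f)
      also have "\<dots> = Gamma (Re s) * (norm (\<rho> \<omega>) * Re (X \<omega>) powr (- Re s))"
        using integral_powr_exp_norm[OF s X[OF that]] by simp
      finally show ?thesis .
    qed
    then have "integrable N (\<lambda>\<omega>. \<integral>t. norm (f \<omega> t) \<partial>mpos) \<longleftrightarrow>
        integrable N (\<lambda>\<omega>. Gamma (Re s) * (norm (\<rho> \<omega>) * Re (X \<omega>) powr (- Re s)))"
      by (intro Bochner_Integration.integrable_cong) auto
    then show "integrable N (\<lambda>\<omega>. \<integral>t. norm (case_prod f (\<omega>, t)) \<partial>mpos)"
      using int by simp
    show "AE \<omega> in N. integrable mpos (\<lambda>t. case_prod f (\<omega>, t))"
      using integrable_cpow_exp[OF s X] by (auto intro!: AE_I2 simp: f_def)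
  qed
  then have "(\<integral>t. \<integral>\<omega>. f \<omega> t \<partial>N \<partial>mpos) = (\<integral>\<omega>. \<integral>t. f \<omega> t \<partial>mpos \<partial>N)"
    by (rule Fubini_integral)
  also have "\<dots> = (\<integral>\<omega>. Gamma s * (\<rho> \<omega> * X \<omega> powr (- s)) \<partial>N)"
    using integral_powr_exp[OF s X] unfolding f_def
    by (intro Bochner_Integration.integral_cong) (auto simp: mult_ac)
  also have "(\<integral>t. \<integral>\<omega>. f \<omega> t \<partial>N \<partial>mpos) =
      (\<integral>t. cpow (s - 1) t * (\<integral>\<omega>. \<rho> \<omega> * exp (- of_real t * X \<omega>) \<partial>N) \<partial>mpos)"
  proof (rule Bochner_Integration.integral_cong)
    fix t
    have "(\<integral>\<omega>. f \<omega> t \<partial>N) = (\<integral>\<omega>. cpow (s - 1) t * (\<rho> \<omega> * exp (- of_real t * X \<omega>)) \<partial>N)"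
      by (simp add: f_def mult_ac)
    then show "(\<integral>\<omega>. f \<omega> t \<partial>N) = cpow (s - 1) t * (\<integral>\<omega>. \<rho> \<omega> * exp (- of_real t * X \<omega>) \<partial>N)"
      by simp
  qed simp
  finally show ?thesis by simp
qed

lemma integral_mpos_FTC:
  fixes f F :: "real \<Rightarrow> complex"
  assumes F: "\<And>y. y \<ge> 0 \<Longrightarrow> (F has_vector_derivative f y) (at y)"
    and f: "\<And>y. y > 0 \<Longrightarrow> isCont f y"
    and int: "integrable mpos f"
    and lim: "(F \<longlongrightarrow> 0) at_top"
  shows "(\<integral>y. f y \<partial>mpos) = - F 0"
proof -
  have e: "einterval 0 \<infinity> = {0::real<..}"
    by (auto simp: einterval_def zero_ereal_def)
  have "isCont F 0" using F[of 0] has_vector_derivative_continuous by auto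
  then have F0: "(F \<longlongrightarrow> F 0) (at_right 0)"
    by (simp add: isCont_def filterlim_at_split)
  have "(LBINT x=0..\<infinity>. f x) = 0 - F 0"
  proof (rule interval_integral_FTC_integrable)
    show "((F \<circ> real_of_ereal) \<longlongrightarrow> F 0) (at_right 0)"
      unfolding zero_ereal_def ereal_tendsto_simps1 by (rule F0)
    show "((F \<circ> real_of_ereal) \<longlongrightarrow> 0) (at_left \<infinity>)"
      unfolding ereal_tendsto_simps1 by (rule lim)
    show "set_integrable lborel (einterval 0 \<infinity>) f"
      using int by (simp add: e integrable_mpos_iff)
  qed (use F f in \<open>auto simp: zero_ereal_def\<close>)
  then show ?thesis
    by (simp add: interval_lebesgue_integral_def e mpos_def integral_restrict_space set_lebesgue_integral_def)
qed

section \<open>Incomplete Gamma functions\<close>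

text \<open>The integrand of the upper incomplete Gamma function \<open>\<Gamma>(1 - s, x)\<close>
  in the variable \<open>y = log x\<close>, in which it is entire.\<close>

definition kap :: "complex \<Rightarrow> complex \<Rightarrow> complex" where
  "kap s y = exp ((1 - s) * y) * exp (- exp y)"

abbreviation dexp :: "complex \<Rightarrow> complex \<Rightarrow> real \<Rightarrow> complex" where
  "dexp s v y \<equiv> exp ((1 - s) * of_real y) * exp (v * of_real (exp y))"

definition sing0 :: "complex \<Rightarrow> complex \<Rightarrow> complex" where
  "sing0 s v = (\<integral>y. dexp s v y \<partial>mpos)"

text \<open>\<open>sing s l = e\<^bsup>l(s - 1)\<^esup> \<Gamma>(1 - s, e\<^sup>l)\<close>, written so that it is visibly entire in \<open>(s, l)\<close>; with
  \<open>v = - e\<^sup>l\<close> and \<open>Re v < 0\<close> it is \<open>sing0 s v = \<integral>\<^sub>1\<^sup>\<infinity> x\<^bsup>-s\<^esup> e\<^bsup>vx\<^esup> dx\<close> (substitute \<open>x = e\<^sup>y\<close>).\<close>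
definition sing :: "complex \<Rightarrow> complex \<Rightarrow> complex" where
  "sing s l = exp (l * (s - 1)) *
     ((\<integral>y. kap s (of_real y) \<partial>mpos) - l * (\<integral>x. kap s (of_real x * l) \<partial>munit))"

lemma integrable_exp_mpos:
  fixes \<delta> :: real
  assumes "\<delta> > 0"
  shows "integrable mpos (\<lambda>t. exp (- \<delta> * t))"
proof -
  have "integrable mpos (\<lambda>t. t powr (1 - 1) * exp (- \<delta> * t))"
    by (rule integrable_powr_exp) (use assms in auto)
  also have "?this \<longleftrightarrow> ?thesis"
    by (rule Bochner_Integration.integrable_cong) auto
  finally show ?thesis .
qed

lemma exp_uminus_at_top: "((\<lambda>y::real. exp (- 1 * y)) \<longlongrightarrow> 0) at_top"
  by (rule filterlim_compose[OF exp_at_bot]) (simp add: filterlim_uminus_at_bot_at_top)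

text \<open>The quadratic Taylor bound for \<open>exp y\<close> absorbs the linear term by
  completing the square. One more \<open>y\<close> is absorbed than asked for; the
  \<open>- y\<close> left on the right makes the majorant integrable.\<close>

lemma double_exp_bound:
  fixes p \<delta> y :: real
  assumes \<delta>: "\<delta> > 0" and y: "y \<ge> 0"
  shows "p * y - \<delta> * exp y \<le> (p + 1)\<^sup>2 / (2 * \<delta>) - y"
proof -
  have "exp y \<ge> 1 + y + y\<^sup>2 / 2" using y by (rule exp_lower_Taylor_quadratic)
  then have "\<delta> * exp y \<ge> \<delta> * (y\<^sup>2 / 2)"
    using y \<delta> by (intro mult_left_mono) auto
  moreover have "(p + 1) * y \<le> (p + 1)\<^sup>2 / (2 * \<delta>) + \<delta> * (y\<^sup>2 / 2)"
  proof -
    have "0 \<le> (\<delta> * y - (p + 1))\<^sup>2 / (2 * \<delta>)" using \<delta> by simp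
    also have "\<dots> = (p + 1)\<^sup>2 / (2 * \<delta>) + \<delta> * (y\<^sup>2 / 2) - (p + 1) * y"
      using \<delta> by (simp add: field_simps power2_eq_square)
    finally show ?thesis by simp
  qed
  ultimately show ?thesis by (simp add: algebra_simps)
qed

text \<open>Uniform in \<open>s\<close> and in \<open>v\<close>, so one majorant serves
  integrability, differentiation in \<open>v\<close>, holomorphy in \<open>s\<close> and the limits
  at infinity.\<close>

lemma sing0_integrand_bound:
  assumes "\<delta> > 0" "Re v \<le> - \<delta>" "1 - Re s \<le> p" "y \<ge> 0"
  shows "norm (dexp s v y) \<le>
         exp ((p + 1)\<^sup>2 / (2 * \<delta>)) * exp (- 1 * y)"
proof -
  have "(1 - Re s) * y \<le> p * y" "Re v * exp y \<le> - \<delta> * exp y"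
    using assms by (intro mult_right_mono; simp)+
  then have "(1 - Re s) * y + Re v * exp y \<le> (p + 1)\<^sup>2 / (2 * \<delta>) - y"
    using double_exp_bound[of \<delta> y p] assms by simp
  then show ?thesis
    by (simp add: norm_mult flip: exp_add)
qed

lemma measurable_sing0_integrand:
  "(\<lambda>y. dexp s v y :: complex) \<in> borel_measurable mpos"
  by (intro borel_measurable_mpos_continuous continuous_intros)

lemma integrable_sing0:
  assumes "Re v < 0"
  shows "integrable mpos (\<lambda>y. dexp s v y)"
proof (rule Bochner_Integration.integrable_bound)
  show "integrable mpos (\<lambda>y. exp ((1 - Re s + 1)\<^sup>2 / (2 * - Re v)) * exp (- 1 * y))"
    by (intro integrable_mult_right integrable_exp_mpos) auto
  show "AE y in mpos. norm (dexp s v y) \<le>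
      norm (exp ((1 - Re s + 1)\<^sup>2 / (2 * - Re v)) * exp (- 1 * y))"
    using sing0_integrand_bound[of "- Re v" v s "1 - Re s"] assms by (intro AE_I2) auto
qed (rule measurable_sing0_integrand)

lemma Re_ball_bounds:
  assumes "x \<in> ball b r"
  shows "Re b - r \<le> Re x" "Re x \<le> Re b + r"
  using assms complex_Re_le_cmod[of "b - x"] complex_Re_le_cmod[of "x - b"] norm_minus_commute[of b x]
  unfolding mem_ball dist_norm minus_complex.sel by linarith+

text \<open>Differentiation brings down \<open>x = exp y\<close> and so turns \<open>x\<close> to
  the power \<open>-(s + 1)\<close> into \<open>x\<close> to the power \<open>-s\<close>. The Lerch
  series obeys the same rule (\<open>Eser_deriv\<close>), so it passes to the difference
  \<open>Lpart\<close>.\<close>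

lemma sing0_deriv:
  assumes v: "Re v < 0"
  shows "(sing0 (s + 1) has_field_derivative sing0 s v) (at v)"
proof -
  let ?g = "\<lambda>y::real. exp ((- Re s + 1)\<^sup>2 / (2 * (- Re v / 2))) * exp (- 1 * y)"
  have "((\<lambda>v. \<integral>y. dexp (s + 1) v y \<partial>mpos) has_field_derivative
     (\<integral>y. exp ((1 - (s + 1)) * of_real y) * (exp (v * of_real (exp y)) * of_real (exp y)) \<partial>mpos)) (at v)"
  proof (rule has_field_derivative_integral_dominated(2)[where r = "- Re v / 2" and g = ?g
      and f' = "\<lambda>v y. exp ((1 - (s + 1)) * of_real y) * (exp (v * of_real (exp y)) * of_real (exp y))"])
    show "integrable mpos ?g" by (intro integrable_mult_right integrable_exp_mpos) auto
    fix x y assume x: "x \<in> ball v (- Re v / 2)" and y: "y \<in> space mpos"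
    show "norm (dexp (s + 1) x y) \<le> ?g y"
      using Re_ball_bounds[OF x] v y by (intro sing0_integrand_bound) auto
    show "((\<lambda>x. dexp (s + 1) x y) has_field_derivative
        exp ((1 - (s + 1)) * complex_of_real y) * (exp (x * complex_of_real (exp y)) * complex_of_real (exp y))) (at x)"
      by (auto intro!: derivative_eq_intros)
  qed (use v in \<open>auto intro: measurable_sing0_integrand\<close>)
  also have "(\<integral>y. exp ((1 - (s + 1)) * of_real y) * (exp (v * of_real (exp y)) * of_real (exp y)) \<partial>mpos) = sing0 s v"
    unfolding sing0_def
    by (rule Bochner_Integration.integral_cong)
       (auto simp: exp_of_real[symmetric] algebra_simps simp flip: exp_add)
  finally show ?thesis by (simp add: sing0_def[abs_def])
qed

lemma Re_exp_pos: "\<bar>Im l\<bar> < pi / 2 \<Longrightarrow> Re (exp l) > 0"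
  unfolding Re_exp by (intro mult_pos_pos cos_gt_zero_pi) auto

abbreviation kap' :: "complex \<Rightarrow> complex \<Rightarrow> complex" where
  "kap' s y \<equiv> ((1 - s) - exp y) * kap s y"

lemma kap_deriv: "(kap s has_field_derivative kap' s y) (at y)"
  unfolding kap_def by (rule derivative_eq_intros refl)+ (simp add: algebra_simps)

lemma continuous_kap [continuous_intros]:
  "continuous_on A f \<Longrightarrow> continuous_on A (\<lambda>x. kap s (f x))"
  unfolding kap_def by (intro continuous_intros)

text \<open>The integral on the left is \<open>\<Gamma>(1 - s, e\<^sup>l)\<close>, taken along a horizontal ray; its derivative in
  \<open>l\<close> is \<open>- kap s l\<close>.\<close>
lemma integral_kap_shift:
  assumes l: "\<bar>Im l\<bar> < pi / 2"
  shows "(\<integral>y. kap s (l + of_real y) \<partial>mpos) =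
         (\<integral>y. kap s (of_real y) \<partial>mpos) - l * (\<integral>x. kap s (of_real x * l) \<partial>munit)"
proof -
  define Y where "Y = (\<lambda>l. \<integral>y. kap s (l + of_real y) \<partial>mpos)"
  have kap_eq: "kap s (l + of_real y) = exp ((1 - s) * l) * (dexp s (- exp l) y)" for l y
    by (simp add: kap_def exp_add distrib_left exp_of_real mult.assoc)
  have Y: "(Y has_field_derivative - kap s l) (at l)" if l: "\<bar>Im l\<bar> < pi / 2" for l
  proof -
    have pos: "Re (exp l) > 0" using l by (rule Re_exp_pos)
    define d where "d = Re (exp l) / 2"
    \<comment> \<open>One radius has to control both the decay rate \<open>Re (exp x)\<close> and
      the prefactor in \<open>kap_eq\<close>.\<close>
    define h where "h = (\<lambda>x. (exp x, exp ((1 - s) * x)))"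
    have "isCont h l" unfolding h_def by (intro continuous_intros)
    then have "\<forall>\<^sub>F x in nhds l. dist (h x) (h l) < min d 1"
      using pos unfolding isCont_def tendsto_at_iff_tendsto_nhds by (intro tendstoD) (auto simp: d_def)
    then obtain r where r: "r > 0"
      "\<And>x. dist x l < r \<Longrightarrow> dist (h x) (h l) < min d 1"
      unfolding eventually_nhds_metric by blast
    have b: "- Re (exp x) \<le> - d" "norm (exp ((1 - s) * x)) \<le> norm (exp ((1 - s) * l)) + 1" if "x \<in> ball l r" for x
    proof -
      have *: "dist (h x) (h l) < min d 1" using r(2)[of x] that by (simp add: dist_commute)
      have "dist (exp x) (exp l) < d" "dist (exp ((1 - s) * x)) (exp ((1 - s) * l)) < 1"
        using * dist_fst_le[of "h x" "h l"] dist_snd_le[of "h x" "h l"] by (auto simp: h_def)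
      then show "- Re (exp x) \<le> - d" "norm (exp ((1 - s) * x)) \<le> norm (exp ((1 - s) * l)) + 1"
        using Re_ball_bounds[of "exp x" "exp l" d] norm_triangle_sub[of "exp ((1 - s) * x)" "exp ((1 - s) * l)"]
        by (auto simp: dist_norm norm_minus_commute d_def)
    qed
    let ?g = "\<lambda>y::real. (norm (exp ((1 - s) * l)) + 1) * (exp ((1 - Re s + 1)\<^sup>2 / (2 * d)) * exp (- 1 * y))"
    note D = has_field_derivative_integral_dominated[where M = mpos and r = r and g = ?g and a = l
        and f = "\<lambda>l y. kap s (l + of_real y)"
        and f' = "\<lambda>l y. kap' s (l + of_real y)"]
    have g: "integrable mpos ?g" by (intro integrable_mult_right integrable_exp_mpos) auto
    have m: "(\<lambda>y. kap s (x + of_real y)) \<in> borel_measurable mpos" for x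
      by (intro borel_measurable_mpos_continuous continuous_intros)
    have der: "((\<lambda>x. kap s (x + of_real y)) has_field_derivative kap' s (x + of_real y)) (at x)" for x y
      using DERIV_shift[of "kap s" "kap' s (x + of_real y)" x "of_real y"] kap_deriv by simp
    have dom: "norm (kap s (x + of_real y)) \<le> ?g y" if "x \<in> ball l r" "y > 0" for x y
      unfolding kap_eq norm_mult[of "exp ((1 - s) * x)"]
      using b[OF that(1)] that(2) pos by (intro mult_mono sing0_integrand_bound) (auto simp: d_def)
    have int': "integrable mpos (\<lambda>y. kap' s (l + of_real y))"
      by (rule D(1)) (use r(1) g m der dom in auto)
    have Yd: "(Y has_field_derivative (\<integral>y. kap' s (l + of_real y) \<partial>mpos)) (at l)"
      unfolding Y_def by (rule D(2)) (use r(1) g m der dom in auto)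
    \<comment> \<open>The derivative in \<open>l\<close> is also the derivative in \<open>y\<close>,
      so only a boundary term remains.\<close>
    have "(\<integral>y. kap' s (l + of_real y) \<partial>mpos) = - kap s (l + of_real 0)"
    proof (rule integral_mpos_FTC)
      show "((\<lambda>y. kap s (l + of_real y)) has_vector_derivative kap' s (l + of_real y)) (at y)" for y
      proof -
        have "((\<lambda>z. kap s (l + z)) has_field_derivative kap' s (l + of_real y)) (at (of_real y))"
          using DERIV_shift[of "kap s" _ "of_real y" l] kap_deriv[of s "l + of_real y"] by (simp add: add.commute)
        then show ?thesis by (rule has_vector_derivative_real_field)
      qed
      show "isCont (\<lambda>y. kap' s (l + of_real y)) y" for y
        unfolding kap_def by (intro continuous_intros)
      show "((\<lambda>y. kap s (l + of_real y)) \<longlongrightarrow> 0) at_top"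
      proof (rule Lim_null_comparison)
        show "\<forall>\<^sub>F y in at_top. norm (kap s (l + of_real y)) \<le> ?g y"
          using eventually_gt_at_top[of 0] by eventually_elim (use dom[of l] r(1) in auto)
        show "(?g \<longlongrightarrow> 0) at_top" by (intro tendsto_mult_right_zero exp_uminus_at_top)
      qed
    qed (rule int')
    with Yd show ?thesis by simp
  qed
  \<comment> \<open>The derivative of \<open>Y\<close> will be integrated along the segment from 0
    to \<open>l\<close>, which stays in the strip where it is known.\<close>
  have seg: "\<bar>Im (of_real x * l)\<bar> < pi / 2" if "x \<in> {0..1}" for x
  proof -
    have "\<bar>x * Im l\<bar> \<le> 1 * \<bar>Im l\<bar>" unfolding abs_mult using that by (intro mult_right_mono) auto
    then show ?thesis using l by simp
  qed
  have "((\<lambda>x. - kap s (of_real x * l) * l) has_integral Y (of_real 1 * l) - Y (of_real 0 * l)) {0..1}"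
  proof (rule fundamental_theorem_of_calculus)
    fix x :: real assume x: "x \<in> {0..1}"
    have "((\<lambda>z. Y (z * l)) has_field_derivative - kap s (of_real x * l) * l) (at (of_real x))"
      by (rule DERIV_chain2[where f = Y and g = "\<lambda>z. z * l", OF Y[OF seg[OF x]]]) (auto intro!: derivative_eq_intros)
    then show "((\<lambda>x. Y (of_real x * l)) has_vector_derivative - kap s (of_real x * l) * l) (at x within {0..1})"
      by (rule has_vector_derivative_at_within[OF has_vector_derivative_real_field])
  qed simp
  then have "integral {0..1} (\<lambda>x. - kap s (of_real x * l) * l) = Y (of_real 1 * l) - Y (of_real 0 * l)"
    by (rule integral_unique)
  moreover have "integral {0..1} (\<lambda>x. - kap s (of_real x * l) * l) = - l * integral {0..1} (\<lambda>x. kap s (of_real x * l))"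
    by (simp add: mult.commute[of _ l])
  moreover have "continuous_on {0..1} (\<lambda>x. kap s (of_real x * l))" by (intro continuous_intros)
  note integral_restrict_Icc(3)[OF this]
  ultimately show ?thesis by (simp add: Y_def algebra_simps)
qed

text \<open>\<open>Re v < 0\<close> puts \<open>Ln (- v)\<close> into the strip of
  \<open>integral_kap_shift\<close>, and the prefactor of \<open>sing\<close> undoes the shift. Thus
  \<open>sing\<close> is the entire function through which \<open>sing0\<close> continues around
  \<open>v = 0\<close>.\<close>

lemma sing_Ln:
  assumes v: "Re v < 0"
  shows "sing s (Ln (- v)) = sing0 s v"
proof -
  have v0: "v \<noteq> 0" using v by auto
  have "\<bar>Im (Ln (- v))\<bar> < pi / 2"
    using v v0 by (subst Re_Ln_pos_lt) auto
  then have "sing s (Ln (- v)) = exp (Ln (- v) * (s - 1)) * (\<integral>y. kap s (Ln (- v) + of_real y) \<partial>mpos)"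
    unfolding sing_def by (subst integral_kap_shift) auto
  also have "\<dots> = (\<integral>y. exp (Ln (- v) * (s - 1)) * kap s (Ln (- v) + of_real y) \<partial>mpos)"
    by simp
  also have "\<dots> = sing0 s v"
    unfolding sing0_def
  proof (rule Bochner_Integration.integral_cong)
    fix y
    have "exp (Ln (- v) + of_real y) = - v * of_real (exp y)"
      using v0 by (simp add: exp_add exp_of_real)
    moreover have "exp (Ln (- v) * (s - 1)) * exp ((1 - s) * (Ln (- v) + of_real y)) = exp ((1 - s) * of_real y)"
      by (simp add: algebra_simps flip: exp_add)
    ultimately show "exp (Ln (- v) * (s - 1)) * kap s (Ln (- v) + of_real y) =
        dexp s v y"
      by (simp add: kap_def flip: mult.assoc)
  qed simp
  finally show ?thesis .
qed

text \<open>The coordinate \<open>c\<close> is a dummy that makes the three-variable closure lemmas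
  applicable; likewise for \<open>sing\<close>.\<close>

lemma sep_holo_kap: "sep_holo (\<lambda>(s, l, c). kap s (f l)) UNIV" if "f holomorphic_on UNIV"
proof (rule sep_holoI)
  have "continuous_on UNIV f" using that by (rule holomorphic_on_imp_continuous_on)
  then have "continuous_on UNIV (\<lambda>x :: pt. f (fst (snd x)))"
    by (rule continuous_on_compose2) (auto intro!: continuous_intros)
  then show "continuous_on UNIV (\<lambda>(s :: complex, l, c :: complex). kap s (f l))"
    unfolding kap_def case_prod_unfold by (intro continuous_intros)
  fix s w c :: complex
  show "(\<lambda>x. case (x, w, c) of (s, l, c) \<Rightarrow> kap s (f l)) field_differentiable at s"
    unfolding kap_def prod.case field_differentiable_def by (rule exI) (rule derivative_eq_intros refl)+
  have "f field_differentiable at w" using that by (simp add: holomorphic_on_def)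
  then obtain f' where f': "(f has_field_derivative f') (at w)" by (auto simp: field_differentiable_def)
  show "(\<lambda>x. case (s, x, c) of (s, l, c) \<Rightarrow> kap s (f l)) field_differentiable at w"
    unfolding prod.case field_differentiable_def by (rule exI) (rule DERIV_chain2[OF kap_deriv f'])
qed auto

lemma sep_holo_sing: "sep_holo (\<lambda>(s, l, c). sing s l) UNIV"
proof -
  have 1: "sep_holo (\<lambda>x. \<integral>y. (case x of (s, l, c) \<Rightarrow> kap s (of_real y)) \<partial>mpos) UNIV"
  proof (rule sep_holo_integral)
    show "sep_holo (\<lambda>(s, l, c). kap s (of_real y)) UNIV" for y
      by (rule sep_holo_kap) (rule holomorphic_on_const)
    show "(\<lambda>y. case x of (s, l, c) \<Rightarrow> kap s (of_real y)) \<in> borel_measurable mpos" for x :: pt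
      by (cases x) (auto intro!: borel_measurable_mpos_continuous continuous_intros)
    show "\<exists>r>0. \<exists>g. integrable mpos g \<and> (\<forall>y\<in>ball x r \<inter> UNIV. \<forall>t\<in>space mpos.
        norm (case y of (s, l, c) \<Rightarrow> kap s (of_real t)) \<le> g t)" for x :: pt
    proof (intro exI conjI ballI)
      let ?g = "\<lambda>y::real. exp ((2 - Re (fst x) + 1)\<^sup>2 / (2 * 1)) * exp (- 1 * y)"
      show "integrable mpos ?g" by (intro integrable_mult_right integrable_exp_mpos) auto
      fix y t assume y: "y \<in> ball x 1 \<inter> UNIV" and t: "t \<in> space mpos"
      have "dist (fst x) (fst y) < 1" using y dist_fst_le[of x y] by auto
      then have "1 - Re (fst y) \<le> 2 - Re (fst x)" using Re_ball_bounds(1)[of "fst y" "fst x" 1] by simp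
      \<comment> \<open>On the real axis \<open>kap\<close> is the integrand of \<open>sing0\<close>
        at \<open>v = -1\<close>.\<close>
      then have "norm (dexp (fst y) (- 1) t) \<le> ?g t"
        using t by (intro sing0_integrand_bound) auto
      then show "norm (case y of (s, l, c) \<Rightarrow> kap s (of_real t)) \<le> ?g t"
        by (simp add: case_prod_unfold kap_def exp_of_real)
    qed auto
  qed simp
  have 2: "sep_holo (\<lambda>x. \<integral>y. (case x of (s, l, c) \<Rightarrow> kap s (of_real y * l)) \<partial>munit) UNIV"
  proof (rule sep_holo_integral)
    show "sep_holo (\<lambda>(s, l, c). kap s (of_real y * l)) UNIV" for y
      by (rule sep_holo_kap) (intro holomorphic_intros)
    show "(\<lambda>y. case x of (s, l, c) \<Rightarrow> kap s (of_real y * l)) \<in> borel_measurable munit" for x :: pt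
      by (cases x) (auto intro!: integral_restrict_Icc(1) continuous_intros)
    show "\<exists>r>0. \<exists>g. integrable munit g \<and> (\<forall>y\<in>ball x r \<inter> UNIV.
        \<forall>t\<in>space munit. norm (case y of (s, l, c) \<Rightarrow> kap s (of_real t * l)) \<le> g t)" for x :: pt
    proof -
      have "compact ((\<lambda>(y, t). kap (fst y) (of_real t * fst (snd y))) ` (cball x 1 \<times> {0..1::real}))"
        unfolding kap_def case_prod_unfold
        by (intro compact_continuous_image compact_Times continuous_intros) auto
      then obtain B where B: "\<And>y t. y \<in> cball x 1 \<Longrightarrow> t \<in> {0..1} \<Longrightarrow> norm (kap (fst y) (of_real t * fst (snd y))) \<le> B"
        by (force dest!: compact_imp_bounded simp: bounded_iff simp del: split_paired_All split_paired_Ball_Sigma)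
      show ?thesis
      proof (intro exI conjI ballI)
        fix y t assume "y \<in> ball x 1 \<inter> UNIV" "t \<in> space munit"
        then show "norm (case y of (s, l, c) \<Rightarrow> kap s (of_real t * l)) \<le> B"
          using B[of y t] by (simp add: space_restrict_space case_prod_unfold)
      qed (use integrable_const_restrict_Icc in auto)
    qed
  qed simp
  have 3: "sep_holo (\<lambda>x. exp (fst (snd x) * (fst x - 1))) UNIV"
    by (intro sep_holo_exp sep_holo_diff sep_holo_mult sep_holo_atoms open_UNIV)
  have 4: "sep_holo (\<lambda>x. fst (snd x)) UNIV" by (rule sep_holo_atoms) simp
  show ?thesis
    by (rule sep_holo_cong[OF sep_holo_mult[OF 3 sep_holo_diff[OF 1 sep_holo_mult[OF 4 2]]]])
       (auto simp: sing_def)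
qed

text \<open>The elementary case \<open>s = 0\<close> of \<open>sing0\<close>, with primitive
  \<open>exp (p * exp y) / p\<close>.\<close>

lemma integral_exp_exp:
  assumes "Re p < 0"
  shows "(\<integral>y. of_real (exp y) * exp (p * of_real (exp y)) \<partial>mpos) = - exp p / p"
proof -
  have p0: "p \<noteq> 0" using assms by auto
  have "(\<integral>y. of_real (exp y) * exp (p * of_real (exp y)) \<partial>mpos) = - (exp (p * of_real (exp 0)) / p)"
  proof (rule integral_mpos_FTC)
    show "((\<lambda>y. exp (p * of_real (exp y)) / p) has_vector_derivative of_real (exp y) * exp (p * of_real (exp y))) (at y)" for y :: real
    proof -
      have "((\<lambda>y. exp (p * exp y) / p) has_field_derivative exp (of_real y) * exp (p * exp (of_real y))) (at (of_real y))"
        using p0 by (auto intro!: derivative_eq_intros)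
      from has_vector_derivative_real_field[OF this] show ?thesis by (simp add: exp_of_real)
    qed
    show "integrable mpos (\<lambda>y. of_real (exp y) * exp (p * of_real (exp y)))"
      using integrable_sing0[OF assms, of 0] by (simp add: exp_of_real)
    show "isCont (\<lambda>y. complex_of_real (exp y) * exp (p * of_real (exp y))) y" for y
      by (intro continuous_intros)
    show "((\<lambda>y. exp (p * of_real (exp y)) / p) \<longlongrightarrow> 0) at_top"
    proof (rule tendsto_divide_zero, rule Lim_null_comparison)
      let ?g = "\<lambda>y::real. exp ((0 + 1)\<^sup>2 / (2 * - Re p)) * exp (- 1 * y)"
      show "\<forall>\<^sub>F y in at_top. norm (exp (p * of_real (exp y))) \<le> ?g y"
        using eventually_gt_at_top[of 0]
      proof eventually_elim
        case (elim y)
        then show ?case using sing0_integrand_bound[of "- Re p" p 1 0 y] assms by simp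
      qed
      show "(?g \<longlongrightarrow> 0) at_top" by (intro tendsto_mult_right_zero exp_uminus_at_top)
    qed
  qed
  then show ?thesis by simp
qed

text \<open>\<open>integral_exp_exp\<close> at \<open>p = v - t\<close> shows that the pole term is
  itself an exponential integral over \<open>exp y\<close>, to which the exchange of integrals
  applies. With \<open>u = v - t\<close> the kernel is \<open>- exp u / u\<close>: this dictates the
  shape of the terms that remove the poles.\<close>

lemma sing0_Gamma:
  assumes s: "Re s > 0" and v: "Re v < 0"
  shows "(\<integral>t. cpow (s - 1) t * (exp (v - of_real t) / (of_real t - v)) \<partial>mpos) = Gamma s * sing0 s v"
proof -
  let ?I = "\<lambda>t. \<integral>y. (of_real (exp y) * exp (v * of_real (exp y))) * exp (- of_real t * of_real (exp y)) \<partial>mpos"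
  have "(\<integral>t. cpow (s - 1) t * ?I t \<partial>mpos) =
         Gamma s * (\<integral>y. (of_real (exp y) * exp (v * of_real (exp y))) * of_real (exp y) powr (- s) \<partial>mpos)"
  proof (rule integral_Gamma_Fubini[OF sigma_finite_mpos])
    show "integrable mpos (\<lambda>y. norm (of_real (exp y) * exp (v * of_real (exp y))) * Re (of_real (exp y)) powr (- Re s))"
    proof -
      have "integrable mpos (\<lambda>y. norm (dexp s v y))"
        by (intro integrable_norm integrable_sing0 v)
      also have "?this \<longleftrightarrow> ?thesis"
        by (rule Bochner_Integration.integrable_cong)
           (auto simp: norm_mult powr_def algebra_simps simp flip: exp_add)
      finally show ?thesis .
    qed
  qed (use s in \<open>auto intro!: borel_measurable_mpos_continuous continuous_intros\<close>)
  also have "(\<integral>y. (of_real (exp y) * exp (v * of_real (exp y))) * of_real (exp y) powr (- s) \<partial>mpos) = sing0 s v"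
    unfolding sing0_def
  proof (rule Bochner_Integration.integral_cong)
    fix y :: real
    have "Ln (of_real (exp y)) = of_real y" by (simp add: Ln_of_real)
    then show "of_real (exp y) * exp (v * of_real (exp y)) * of_real (exp y) powr (- s) =
        dexp s v y"
      by (simp add: powr_def exp_of_real algebra_simps exp_add exp_diff exp_minus divide_inverse)
  qed simp
  also have "(\<integral>t. cpow (s - 1) t * ?I t \<partial>mpos) =
      (\<integral>t. cpow (s - 1) t * (exp (v - of_real t) / (of_real t - v)) \<partial>mpos)"
  proof (rule Bochner_Integration.integral_cong)
    fix t assume t: "t \<in> space mpos"
    have "?I t =
        (\<integral>y. of_real (exp y) * exp ((v - of_real t) * of_real (exp y)) \<partial>mpos)"
      by (simp add: algebra_simps exp_diff exp_minus divide_inverse)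
    also have "\<dots> = - exp (v - of_real t) / (v - of_real t)"
      using t v by (intro integral_exp_exp) auto
    also have "\<dots> = exp (v - of_real t) / (of_real t - v)"
      using minus_divide_divide[of "exp (v - of_real t)" "of_real t - v"] by simp
    finally show "cpow (s - 1) t * ?I t =
      cpow (s - 1) t * (exp (v - of_real t) / (of_real t - v))" by simp
  qed simp
  finally show ?thesis .
qed

section \<open>The regular part\<close>

definition per :: "int \<Rightarrow> complex" where
  "per k = 2 * of_real pi * \<i> * of_int k"

text \<open>The width is such that the point \<open>per k\<close> is inside exactly when
  \<open>k \<in> ibox K\<close>.\<close>

definition strip :: "nat \<Rightarrow> complex set" where
  "strip K = {u. \<bar>Im u\<bar> < 2 * pi * (real K + 1)}"

definition ibox :: "nat \<Rightarrow> int set" where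
  "ibox K = {- int K..int K}"

lemma Re_per [simp]: "Re (per k) = 0" and Im_per [simp]: "Im (per k) = 2 * pi * of_int k"
  by (simp_all add: per_def)

lemma exp_per [simp]: "exp (per k) = 1"
  unfolding exp_eq_1 by (auto intro!: exI[of _ k])

lemma exp_diff_per [simp]: "exp (u - per k) = exp u"
  by (simp add: exp_diff)

lemma finite_ibox [simp, intro]: "finite (ibox K)"
  by (simp add: ibox_def)

lemma open_strip [simp, intro]: "open (strip K)"
  unfolding strip_def by (intro open_Collect_less continuous_intros)

lemma convex_strip: "convex (strip K)"
proof -
  have "strip K = {u. Im u < 2 * pi * (real K + 1)} \<inter> {u. Im u > - (2 * pi * (real K + 1))}"
    by (auto simp: strip_def)
  then show ?thesis
    by (metis convex_Int convex_halfspace_Im_lt convex_halfspace_Im_gt)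
qed

lemma strip_diff_of_real [simp]: "u - of_real t \<in> strip K \<longleftrightarrow> u \<in> strip K"
  by (simp add: strip_def)

lemma exp_eq_1_strip:
  assumes "u \<in> strip K" "exp u = 1"
  shows "\<exists>k\<in>ibox K. u = per k"
proof -
  obtain k :: int where k: "Re u = 0" "Im u = of_int (2 * k) * pi"
    using assms by (auto simp: exp_eq_1)
  then have u: "u = per k" by (auto simp: complex_eq_iff)
  have "2 * pi * \<bar>of_int k\<bar> < 2 * pi * (real K + 1)"
    using assms(1) k by (simp add: strip_def abs_mult)
  then have "\<bar>real_of_int k\<bar> < real K + 1" by (subst (asm) mult_less_cancel_left_pos) auto
  then show ?thesis using u by (intro bexI[of _ k]) (auto simp: ibox_def)
qed

section \<open>Removal of the poles from the kernel\<close>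

definition expq :: "complex \<Rightarrow> complex" where
  "expq v = (if v = 0 then 1 else (exp v - 1) / v)"

lemma expq_holomorphic: "expq holomorphic_on A"
proof -
  have "(\<lambda>z. if z = 0 then deriv exp 0 else (exp z - exp 0) / (z - 0)) holomorphic_on UNIV"
    by (intro pole_lemma_open holomorphic_intros) auto
  also have "?this \<longleftrightarrow> expq holomorphic_on UNIV"
    by (intro holomorphic_cong) (auto simp: expq_def DERIV_imp_deriv[OF DERIV_exp])
  finally show ?thesis by (rule holomorphic_on_subset) auto
qed

text \<open>Since \<open>exp v - 1 = v * expq v\<close>, the sum
  \<open>1 / (1 - exp v) + 1 / v\<close> is minus the difference quotient of \<open>1 / expq\<close>
  at 0, where the singularity is removable. In particular the residue of
  \<open>1 / (1 - exp v)\<close> is \<open>-1\<close>.\<close>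

lemma one_minus_exp_regular_part:
  obtains L :: complex and \<phi> :: "complex \<Rightarrow> complex" and e :: real where
    "e > 0" "\<phi> holomorphic_on ball 0 e" "\<phi> 0 = L"
    "\<And>v. v \<in> ball 0 e \<Longrightarrow> v \<noteq> 0 \<Longrightarrow> exp v \<noteq> (1::complex)" 
    "\<And>v. v \<in> ball 0 e \<Longrightarrow> v \<noteq> 0 \<Longrightarrow> \<phi> v = 1 / (1 - exp v) + 1 / v"
proof -
  have "isCont expq 0"
    using expq_holomorphic[of UNIV] by (metis UNIV_I holomorphic_on_imp_continuous_on continuous_on_eq_continuous_at open_UNIV)
  then obtain e where e: "e > 0" "\<And>v. dist v 0 < e \<Longrightarrow> dist (expq v) (expq 0) < 1"
    unfolding continuous_at_eps_delta by (metis zero_less_one)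
  have ne: "expq v \<noteq> 0" if "v \<in> ball 0 e" for v
    using e(2)[of v] that by (auto simp: expq_def[of 0] dist_norm norm_minus_commute)
  define f where "f = (\<lambda>v. 1 / expq v)"
  have "f holomorphic_on ball 0 e"
    unfolding f_def by (intro holomorphic_intros expq_holomorphic) (use ne in auto)
  then have hol: "(\<lambda>z. if z = 0 then deriv f 0 else (f z - f 0) / (z - 0)) holomorphic_on ball 0 e"
    by (intro pole_lemma_open) auto
  show ?thesis
  proof (rule that[of e "\<lambda>z. - (if z = 0 then deriv f 0 else (f z - f 0) / (z - 0))" "- deriv f 0"])
    fix v :: complex assume v: "v \<in> ball 0 e" "v \<noteq> 0"
    show *: "exp v \<noteq> 1" using ne[OF v(1)] v(2) by (auto simp: expq_def)
    show "- (if v = 0 then deriv f 0 else (f v - f 0) / (v - 0)) = 1 / (1 - exp v) + 1 / v"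
      using v(2) * by (simp add: f_def expq_def field_simps)
  qed (use e hol in \<open>auto intro!: holomorphic_on_minus\<close>)
qed

lemma poles_removed:
  obtains h where "h holomorphic_on strip K"
    "\<And>u. u \<in> strip K \<Longrightarrow> exp u \<noteq> 1 \<Longrightarrow> h u = 1 / (1 - exp u) + (\<Sum>k\<in>ibox K. 1 / (u - per k))"
proof -
  obtain L \<phi> e where e: "e > 0" "\<phi> holomorphic_on ball 0 e" "\<phi> 0 = L"
    "\<And>v. v \<in> ball 0 e \<Longrightarrow> v \<noteq> 0 \<Longrightarrow> exp v \<noteq> (1::complex)"
    "\<And>v. v \<in> ball 0 e \<Longrightarrow> v \<noteq> 0 \<Longrightarrow> \<phi> v = 1 / (1 - exp v) + 1 / v"
    by (rule one_minus_exp_regular_part) blast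
  \<comment> \<open>At a pole, \<open>1 / (1 - e\<^sup>u)\<close> and its partner \<open>1 / (u - per k)\<close> are both \<open>0\<close> (as \<open>x / 0 = 0\<close>),
    so there \<open>L\<close> supplies the value of the regular part.\<close>
  define h where "h = (\<lambda>u. 1 / (1 - exp u) + (\<Sum>k\<in>ibox K. 1 / (u - per k)) + (if exp u = 1 then L else 0))"
  have "h field_differentiable at u" if u: "u \<in> strip K" for u
  proof (cases "exp u = 1")
    case False
    have "(\<lambda>u. 1 / (1 - exp u) + (\<Sum>k\<in>ibox K. 1 / (u - per k))) holomorphic_on {u. exp u \<noteq> 1}"
      by (intro holomorphic_intros) auto
    then have "h holomorphic_on {u. exp u \<noteq> 1}"
      by (rule holomorphic_transform) (auto simp: h_def)
    moreover have "open {u::complex. exp u \<noteq> 1}" by (intro open_Collect_neq continuous_intros)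
    ultimately show ?thesis using False by (simp add: holomorphic_on_imp_differentiable_at)
  next
    case True
    then obtain k where k: "k \<in> ibox K" "u = per k" using exp_eq_1_strip[OF u] by auto
    \<comment> \<open>Different poles are at least \<open>2 * pi > 1\<close> apart, so a ball of
      radius at most 1 around \<open>per k\<close> contains no other pole.\<close>
    define e' where "e' = min e 1"
    have far: "y \<noteq> per j" if "y \<in> ball u e'" "j \<noteq> k" for y j
    proof
      assume "y = per j"
      then have "norm (per k - per j) < 1" using that k by (simp add: dist_norm e'_def)
      moreover have "norm (per k - per j) = 2 * pi * \<bar>of_int (k - j)\<bar>"
        by (simp add: per_def norm_mult flip: right_diff_distrib of_int_diff)
      moreover have "1 \<le> \<bar>real_of_int (k - j)\<bar>" using that(2) by linarith
      then have "2 * pi * 1 \<le> 2 * pi * \<bar>real_of_int (k - j)\<bar>" by (intro mult_left_mono) auto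
      ultimately show False using pi_gt3 by linarith
    qed
    have "(\<lambda>y. \<phi> (y - per k) + (\<Sum>j\<in>ibox K - {k}. 1 / (y - per j))) holomorphic_on ball u e'"
    proof (intro holomorphic_intros)
      show "(\<lambda>y. \<phi> (y - per k)) holomorphic_on ball u e'"
        by (rule holomorphic_on_compose_gen[of "\<lambda>y. y - per k" _ \<phi> "ball 0 e", unfolded o_def])
           (use e(2) k in \<open>auto intro!: holomorphic_intros simp: dist_norm e'_def norm_minus_commute\<close>)
    qed (use far in auto)
    then have "h holomorphic_on ball u e'"
    proof (rule holomorphic_transform)
      fix y assume y: "y \<in> ball u e'"
      have split: "(\<Sum>j\<in>ibox K. 1 / (y - per j)) = 1 / (y - per k) + (\<Sum>j\<in>ibox K - {k}. 1 / (y - per j))"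
        using k by (subst sum.remove[of _ k]) auto
      show "\<phi> (y - per k) + (\<Sum>j\<in>ibox K - {k}. 1 / (y - per j)) = h y"
      proof (cases "y = u")
        case True
        then show ?thesis unfolding h_def split by (simp add: e(3) k)
      next
        case False
        then have "y - per k \<in> ball 0 e" "y - per k \<noteq> 0"
          using y k by (simp_all add: dist_norm e'_def norm_minus_commute)
        with e(4,5)[OF this] show ?thesis unfolding h_def split by simp
      qed
    qed
    moreover have "e' > 0" using e by (simp add: e'_def)
    ultimately show ?thesis
      by (meson centre_in_ball holomorphic_on_imp_differentiable_at open_ball)
  qed
  then have "h holomorphic_on strip K"
    unfolding holomorphic_on_def by (blast intro: field_differentiable_at_within)
  then show ?thesis by (rule that) (simp add: h_def)
qed

definition hreg :: "nat \<Rightarrow> complex \<Rightarrow> complex" where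
  "hreg K = (SOME h. h holomorphic_on strip K \<and>
     (\<forall>u\<in>strip K. exp u \<noteq> 1 \<longrightarrow> h u = 1 / (1 - exp u) + (\<Sum>k\<in>ibox K. 1 / (u - per k))))"

lemma hreg:
  shows "hreg K holomorphic_on strip K"
    and "u \<in> strip K \<Longrightarrow> exp u \<noteq> 1 \<Longrightarrow> hreg K u = 1 / (1 - exp u) + (\<Sum>k\<in>ibox K. 1 / (u - per k))"
proof -
  have "\<exists>h. h holomorphic_on strip K \<and>
     (\<forall>u\<in>strip K. exp u \<noteq> 1 \<longrightarrow> h u = 1 / (1 - exp u) + (\<Sum>k\<in>ibox K. 1 / (u - per k)))"
    by (rule poles_removed[of K]) blast
  from someI_ex[OF this]
  show "hreg K holomorphic_on strip K"
    and "u \<in> strip K \<Longrightarrow> exp u \<noteq> 1 \<Longrightarrow> hreg K u = 1 / (1 - exp u) + (\<Sum>k\<in>ibox K. 1 / (u - per k))"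
    unfolding hreg_def by auto
qed

text \<open>Away from the poles this is \<open>e\<^bsup>cu\<^esup> / (1 - e\<^sup>u) + \<Sum>\<^sub>k e\<^bsup>c per k\<^esup> e\<^sup>u / (u - per k)\<close>, see \<open>Gker_eq\<close>.\<close>
definition Gker :: "nat \<Rightarrow> complex \<Rightarrow> complex \<Rightarrow> complex" where
  "Gker K c u = exp (c * u) * hreg K u -
     (\<Sum>k\<in>ibox K. exp (per k * c) * exp u * ((c - 1) * expq ((c - 1) * (u - per k))))"

text \<open>\<open>hreg\<close> removes the poles with numerator \<open>exp (c * u)\<close>; the sum
  in \<open>Gker\<close> trades this numerator for \<open>exp (per k * c) * exp u\<close>. The two
  agree at \<open>u = per k\<close>, so the quotient of their difference is entire, and
  \<open>expq\<close> writes it without division.\<close>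

lemma Gker_eq:
  assumes u: "u \<in> strip K" and eu: "exp u \<noteq> 1"
  shows "Gker K c u = exp (c * u) / (1 - exp u) + (\<Sum>k\<in>ibox K. exp (per k * c) * (exp u / (u - per k)))"
proof -
  have ne: "u \<noteq> per k" for k using eu by auto
  have "exp (per k * c) * exp u * ((c - 1) * expq ((c - 1) * (u - per k))) =
      exp (c * u) * (1 / (u - per k)) - exp (per k * c) * (exp u / (u - per k))" for k
  proof (cases "c = 1")
    case True
    then show ?thesis by simp
  next
    case False
    have "exp (per k * c) * exp u * exp ((c - 1) * (u - per k)) = exp (c * u + per k)"
      by (simp add: algebra_simps flip: exp_add)
    then have "exp (per k * c) * exp u * exp ((c - 1) * (u - per k)) = exp (c * u)"
      by (simp add: exp_add)
    moreover have "(c - 1) * expq ((c - 1) * (u - per k)) = (exp ((c - 1) * (u - per k)) - 1) / (u - per k)"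
      using False ne[of k] by (simp add: expq_def)
    ultimately show ?thesis
      by (simp only: times_divide_eq_right right_diff_distrib diff_divide_distrib mult_1_right)
  qed
  then have "Gker K c u = exp (c * u) * (1 / (1 - exp u) + (\<Sum>k\<in>ibox K. 1 / (u - per k))) -
      (\<Sum>k\<in>ibox K. exp (c * u) * (1 / (u - per k)) - exp (per k * c) * (exp u / (u - per k)))"
    by (simp only: Gker_def hreg(2)[OF u eu])
  then show ?thesis
    by (simp add: sum_subtractf sum_distrib_left distrib_left)
qed

lemma continuous_Gker:
  assumes "continuous_on A f" "continuous_on A g" "g ` A \<subseteq> strip K"
  shows "continuous_on A (\<lambda>x. Gker K (f x) (g x))"
proof -
  have 1: "continuous_on A (\<lambda>x. hreg K (g x))"
    by (rule continuous_on_compose2[OF holomorphic_on_imp_continuous_on[OF hreg(1)] assms(2,3)])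
  have 2: "continuous_on A (\<lambda>x. expq ((f x - 1) * (g x - per k)))" for k
    by (rule continuous_on_compose2[OF holomorphic_on_imp_continuous_on[OF expq_holomorphic[of UNIV]]])
       (use assms in \<open>auto intro!: continuous_intros\<close>)
  show ?thesis
    unfolding Gker_def by (intro continuous_intros assms 1 2)
qed

lemma Gker_holomorphic:
  assumes "f holomorphic_on A" "g holomorphic_on A" "g ` A \<subseteq> strip K"
  shows "(\<lambda>x. Gker K (f x) (g x)) holomorphic_on A"
proof -
  have 1: "(\<lambda>x. hreg K (g x)) holomorphic_on A"
    by (rule holomorphic_on_compose_gen[OF assms(2) hreg(1) assms(3), unfolded o_def])
  have 2: "(\<lambda>x. expq ((f x - 1) * (g x - per k))) holomorphic_on A" for k
    by (rule holomorphic_on_compose[of "\<lambda>x. (f x - 1) * (g x - per k)" A expq, unfolded o_def])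
       (use assms in \<open>auto intro!: holomorphic_intros expq_holomorphic\<close>)
  show ?thesis
    unfolding Gker_def by (intro holomorphic_intros assms 1 2)
qed

text \<open>\<open>exp (c * u)\<close> decays at rate \<open>Re c\<close> and the pole terms at rate
  1, hence the choice of \<open>\<delta>\<close>. \<open>Gker_eq\<close> fails at the poles, so a
  compactness bound takes over for \<open>t \<le> t0\<close>.\<close>

lemma Gker_decay:
  assumes w0: "w0 \<in> strip K" and c0: "Re c0 > 0"
  obtains r \<delta> C where "r > 0" "\<delta> > 0" "C \<ge> 0"
    "\<And>w c t. w \<in> ball w0 r \<Longrightarrow> c \<in> ball c0 r \<Longrightarrow> t \<ge> 0 \<Longrightarrow>
       norm (Gker K c (w - of_real t)) \<le> C * exp (- \<delta> * t)"
proof -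
  obtain r1 where r1: "r1 > 0" "cball w0 r1 \<subseteq> strip K"
    using w0 open_contains_cball[of "strip K"] open_strip by blast
  define r where "r = min r1 (Re c0 / 2)"
  define \<delta> where "\<delta> = min 1 (Re c0 / 2)"
  have r: "r > 0" and \<delta>: "\<delta> > 0" "\<delta> \<le> 1" using r1 c0 by (auto simp: r_def \<delta>_def)
  \<comment> \<open>Beyond \<open>t0\<close> the point \<open>u = w - t\<close> has
    \<open>Re u \<le> -1\<close>: then \<open>norm (exp u) \<le> 1/2\<close> and every
    \<open>per k\<close> is at distance at least 1.\<close>
  define t0 where "t0 = norm w0 + r + 1"
  define M where "M = (norm c0 + r) * (norm w0 + r)"
  have t0: "t0 \<ge> 0" using r by (simp add: t0_def)
  have "compact ((\<lambda>(w, c, t). Gker K c (w - of_real t)) ` (cball w0 r \<times> cball c0 r \<times> {0..t0}))"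
    unfolding case_prod_unfold
  proof (intro compact_continuous_image compact_Times continuous_Gker continuous_intros)
    show "(\<lambda>p. fst p - complex_of_real (snd (snd p))) ` (cball w0 r \<times> cball c0 r \<times> {0..t0}) \<subseteq> strip K"
      using r1(2) by (auto simp: r_def)
  qed auto
  then have "bounded ((\<lambda>(w, c, t). Gker K c (w - of_real t)) ` (cball w0 r \<times> cball c0 r \<times> {0..t0}))"
    by (rule compact_imp_bounded)
  then obtain C1 where C1: "\<And>x. x \<in> (\<lambda>(w, c, t). Gker K c (w - of_real t)) ` (cball w0 r \<times> cball c0 r \<times> {0..t0}) \<Longrightarrow> norm x \<le> C1"
    unfolding bounded_iff by blast
  have C1': "norm (Gker K c (w - of_real t)) \<le> C1" if "w \<in> cball w0 r" "c \<in> cball c0 r" "t \<in> {0..t0}" for w c t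
    by (rule C1) (use that in force)
  have "C1 \<ge> 0" using order_trans[OF norm_ge_zero C1'[of w0 c0 0]] r t0 by auto
  define C2 where "C2 = 2 * exp (norm w0 + r + M) +
     (\<Sum>k\<in>ibox K. exp (2 * pi * real K * (norm c0 + r)) * exp (norm w0 + r))"
  have C2: "C2 \<ge> 0" unfolding C2_def by (intro add_nonneg_nonneg sum_nonneg) auto
  show ?thesis
  proof (rule that[of r \<delta> "C1 * exp (\<delta> * t0) + C2"])
    fix w c t assume w: "w \<in> ball w0 r" and c: "c \<in> ball c0 r" and t: "t \<ge> (0::real)"
    show "norm (Gker K c (w - of_real t)) \<le> (C1 * exp (\<delta> * t0) + C2) * exp (- \<delta> * t)"
    proof (cases "t \<le> t0")
      case True
      have "C1 * 1 \<le> C1 * exp (\<delta> * (t0 - t))" using \<open>C1 \<ge> 0\<close> True \<delta> by (intro mult_left_mono) auto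
      also have "\<dots> = C1 * exp (\<delta> * t0) * exp (- \<delta> * t)" by (simp add: algebra_simps flip: exp_add)
      also have "\<dots> \<le> (C1 * exp (\<delta> * t0) + C2) * exp (- \<delta> * t)" using C2 by (intro mult_right_mono) auto
      finally show ?thesis using C1'[of w c t] w c t True by auto
    next
      case False
      define u where "u = w - of_real t"
      have nw: "norm w \<le> norm w0 + r" and nc: "norm c \<le> norm c0 + r"
        using w c norm_triangle_sub[of w w0] norm_triangle_sub[of c c0]
        by (auto simp: dist_norm norm_minus_commute)
      have Rew: "\<bar>Re w\<bar> \<le> norm w0 + r" "\<bar>Im w\<bar> \<le> norm w0 + r" and Imc: "\<bar>Im c\<bar> \<le> norm c0 + r"
        using nw nc abs_Re_le_cmod[of w] abs_Im_le_cmod[of w] abs_Im_le_cmod[of c] by linarith+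
      have Reu: "Re u \<le> - 1" using False Rew by (simp add: u_def t0_def)
      have Rec: "Re c \<ge> \<delta>" using Re_ball_bounds(1)[OF c] by (auto simp: r_def \<delta>_def)
      have eu: "norm (exp u) \<le> 1/2"
      proof -
        have "exp (Re u) \<le> exp (- 1)" using Reu by simp
        also have "exp (- 1) \<le> (1/2 :: real)" using exp_ge_add_one_self[of 1] by (simp add: exp_minus field_simps)
        finally show ?thesis by simp
      qed
      have ne: "exp u \<noteq> 1"
      proof
        assume "exp u = 1"
        then show False using eu by (simp only: norm_one)
      qed
      have us: "u \<in> strip K" using w r1(2) by (auto simp: u_def r_def)
      have 1: "norm (exp (c * u) / (1 - exp u)) \<le> 2 * exp (norm w0 + r + M) * exp (- \<delta> * t)"
      proof -
        have "Re c * Re u \<le> \<delta> * Re u" using Rec Reu by (intro mult_right_mono_neg) auto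
        also have "\<dots> = \<delta> * Re w - \<delta> * t" by (simp add: u_def algebra_simps)
        also have "\<delta> * Re w \<le> \<delta> * \<bar>Re w\<bar>" using \<delta> by (intro mult_left_mono) auto
        also have "\<dots> \<le> 1 * \<bar>Re w\<bar>" using \<delta> by (intro mult_right_mono) auto
        finally have a: "Re c * Re u \<le> norm w0 + r - \<delta> * t" using Rew by simp
        have "\<bar>Im c * Im u\<bar> \<le> (norm c0 + r) * (norm w0 + r)"
          unfolding abs_mult using Rew Imc by (intro mult_mono) (auto simp: u_def)
        then have "- (Im c * Im u) \<le> M" by (simp add: M_def)
        with a have b: "norm (exp (c * u)) \<le> exp (norm w0 + r + M) * exp (- \<delta> * t)"
          by (simp flip: exp_add)
        have "norm (1 - exp u) \<ge> 1/2" using norm_triangle_ineq2[of 1 "exp u"] eu by simp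
        then have "norm (exp (c * u)) / norm (1 - exp u) \<le> (exp (norm w0 + r + M) * exp (- \<delta> * t)) / (1/2)"
          using b by (intro frac_le) auto
        then show ?thesis by (simp add: norm_divide)
      qed
      have 2: "norm (exp (per k * c) * (exp u / (u - per k))) \<le>
          exp (2 * pi * real K * (norm c0 + r)) * exp (norm w0 + r) * exp (- \<delta> * t)" if "k \<in> ibox K" for k
      proof -
        have "norm (u - per k) \<ge> \<bar>Re (u - per k)\<bar>" by (rule abs_Re_le_cmod)
        then have a: "norm (u - per k) \<ge> 1" using Reu by simp
        have "\<bar>of_int k * Im c\<bar> \<le> real K * (norm c0 + r)"
          unfolding abs_mult using that Imc by (intro mult_mono) (auto simp: ibox_def abs_le_iff)
        then have "- (2 * pi * (of_int k * Im c)) \<le> 2 * pi * (real K * (norm c0 + r))"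
          by (subst mult_minus_right[symmetric], intro mult_left_mono) auto
        then have b: "norm (exp (per k * c)) \<le> exp (2 * pi * real K * (norm c0 + r))"
          by (simp add: mult.assoc)
        have "Re w - t \<le> norm w0 + r - \<delta> * t"
          using Rew mult_right_mono[OF \<delta>(2) t] by simp
        then have d: "norm (exp u) \<le> exp (norm w0 + r) * exp (- \<delta> * t)"
          by (simp add: u_def flip: exp_add)
        have "norm (exp u) / norm (u - per k) \<le> (exp (norm w0 + r) * exp (- \<delta> * t)) / 1"
          using a d by (intro frac_le) auto
        with b show ?thesis unfolding norm_mult norm_divide mult.assoc by (intro mult_mono) auto
      qed
      have "norm (Gker K c u) \<le> norm (exp (c * u) / (1 - exp u)) + (\<Sum>k\<in>ibox K. norm (exp (per k * c) * (exp u / (u - per k))))"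
        unfolding Gker_eq[OF us ne] by (intro norm_triangle_mono order_refl norm_sum)
      also have "\<dots> \<le> 2 * exp (norm w0 + r + M) * exp (- \<delta> * t) +
          (\<Sum>k\<in>ibox K. exp (2 * pi * real K * (norm c0 + r)) * exp (norm w0 + r) * exp (- \<delta> * t))"
        by (intro add_mono 1 sum_mono 2)
      also have "\<dots> = C2 * exp (- \<delta> * t)"
        by (simp add: C2_def distrib_right sum_distrib_right)
      also have "\<dots> \<le> (C1 * exp (\<delta> * t0) + C2) * exp (- \<delta> * t)" using \<open>C1 \<ge> 0\<close> by (intro mult_right_mono) auto
      finally show ?thesis by (simp add: u_def)
    qed
  qed (use r \<delta> \<open>C1 \<ge> 0\<close> C2 in auto)
qed

section \<open>The Mellin transform of the kernel without poles\<close>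

abbreviation rterm :: "nat \<Rightarrow> complex \<Rightarrow> complex \<Rightarrow> complex \<Rightarrow> real \<Rightarrow> complex" where
  "rterm K s w c t \<equiv> cpow (s - 1) t * Gker K c (w - of_real t)"

definition Rdom :: "real \<Rightarrow> nat \<Rightarrow> pt set" where
  "Rdom a K = {s. Re s > a} \<times> strip K \<times> {c. Re c > 0}"

lemma open_Rdom [simp, intro]: "open (Rdom a K)"
  unfolding Rdom_def by (intro open_Times open_halfspace_Re_gt open_strip)

definition Rint :: "nat \<Rightarrow> pt \<Rightarrow> complex" where
  "Rint K = (\<lambda>(s, w, c). rGamma s * (\<integral>t. rterm K s w c t \<partial>mpos))"

text \<open>The smaller exponent dominates near 0 and the larger one near infinity; their sum is a
  majorant uniform in the exponent.\<close>

lemma powr_le_sum_powr: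
  fixes t a p b :: real
  assumes "t > 0" "a \<le> p" "p \<le> b"
  shows "t powr p \<le> t powr a + t powr b"
proof (cases "t \<le> 1")
  case True
  then have "t powr p \<le> t powr a" using assms by (intro powr_mono') auto
  then show ?thesis using powr_ge_zero[of t b] by linarith
next
  case False
  then have "t powr p \<le> t powr b" using assms by (intro powr_mono) auto
  then show ?thesis using powr_ge_zero[of t a] by linarith
qed

lemma cpow_continuous: "continuous_on {0<..} (\<lambda>t. cpow s t)"
  unfolding cpow_def by (intro continuous_intros) auto

lemma sep_holo_Rint: "sep_holo (Rint K) (Rdom 0 K)"
proof -
  let ?f = "\<lambda>(s, w, c) t. rterm K s w c t"
  have "sep_holo (\<lambda>x. \<integral>t. ?f x t \<partial>mpos) (Rdom 0 K)"
  proof (rule sep_holo_integral)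
    show "(?f x) \<in> borel_measurable mpos"
      if "x \<in> Rdom 0 K" for x
      using that by (auto simp: Rdom_def intro!: borel_measurable_mpos_continuous continuous_intros cpow_continuous continuous_Gker)
    show "sep_holo (\<lambda>x. ?f x t) (Rdom 0 K)" for t
    proof (rule sep_holoI)
      show "continuous_on (Rdom 0 K) (\<lambda>x. ?f x t)"
        unfolding cpow_def case_prod_unfold
        by (intro continuous_intros continuous_Gker) (auto simp: Rdom_def)
      fix s w c assume x: "(s, w, c) \<in> Rdom 0 K"
      show "(\<lambda>x. ?f (x, w, c) t) field_differentiable at s"
        unfolding prod.case
        by (rule holomorphic_on_imp_differentiable_at[of _ UNIV]) (auto simp: cpow_def intro!: holomorphic_intros)
      show "(\<lambda>x. ?f (s, x, c) t) field_differentiable at w"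
        unfolding prod.case using x
        by (intro holomorphic_on_imp_differentiable_at[of _ "strip K"] holomorphic_intros Gker_holomorphic)
           (auto simp: Rdom_def)
      show "(\<lambda>x. ?f (s, w, x) t) field_differentiable at c"
        unfolding prod.case using x
        by (intro holomorphic_on_imp_differentiable_at[of _ UNIV] holomorphic_intros Gker_holomorphic)
           (auto simp: Rdom_def)
    qed simp
    fix x assume "x \<in> Rdom 0 K"
    then obtain s0 w0 c0 where x: "x = (s0, w0, c0)" "Re s0 > 0" "w0 \<in> strip K" "Re c0 > 0"
      by (auto simp: Rdom_def)
    obtain r \<delta> C where r: "r > 0" "\<delta> > 0" "C \<ge> 0"
      "\<And>w c t. w \<in> ball w0 r \<Longrightarrow> c \<in> ball c0 r \<Longrightarrow> t \<ge> 0 \<Longrightarrow>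
         norm (Gker K c (w - of_real t)) \<le> C * exp (- \<delta> * t)"
      using Gker_decay[OF x(3,4)] by blast
    define r' where "r' = min r (Re s0 / 2)"
    \<comment> \<open>On the ball of radius \<open>r'\<close>, \<open>Re s\<close> stays between
      \<open>Re s0 / 2\<close> and \<open>3 * Re s0 / 2\<close>.\<close>
    define g where "g = (\<lambda>t. C * (t powr (Re s0 / 2 - 1) * exp (- \<delta> * t)) + C * (t powr (3 * Re s0 / 2 - 1) * exp (- \<delta> * t)))"
    show "\<exists>r>0. \<exists>g. integrable mpos g \<and> (\<forall>y\<in>ball x r \<inter> Rdom 0 K. \<forall>t\<in>space mpos.
        norm (?f y t) \<le> g t)"
    proof (intro exI conjI ballI)
      show "r' > 0" using r x by (simp add: r'_def)
      show "integrable mpos g" unfolding g_def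
        by (intro Bochner_Integration.integrable_add integrable_mult_right integrable_powr_exp) (use x r in auto)
      fix y t assume "y \<in> ball x r' \<inter> Rdom 0 K" and t: "t \<in> space mpos"
      then obtain s w c where y: "y = (s, w, c)" "dist (s0, w0, c0) (s, w, c) < r'" by (cases y) (auto simp: x)
      have d: "dist s0 s < r'" "dist w0 w < r'" "dist c0 c < r'"
        using dist_triple_component_le[of s0 s w0 c0 w c] dist_triple_component_le[of w0 w s0 c0 s c]
          dist_triple_component_le[of c0 c s0 w0 s w] y(2) by linarith+
      have "norm (Gker K c (w - of_real t)) \<le> C * exp (- \<delta> * t)"
        by (rule r(4)) (use d t in \<open>auto simp: r'_def\<close>)
      moreover have "t powr (Re s - 1) \<le> t powr (Re s0 / 2 - 1) + t powr (3 * Re s0 / 2 - 1)"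
        using Re_ball_bounds[of s s0 "Re s0 / 2"] d(1) t
        by (intro powr_le_sum_powr) (auto simp: r'_def)
      ultimately have "t powr (Re s - 1) * norm (Gker K c (w - of_real t)) \<le>
          (t powr (Re s0 / 2 - 1) + t powr (3 * Re s0 / 2 - 1)) * (C * exp (- \<delta> * t))"
        by (intro mult_mono) auto
      also have "\<dots> = g t" by (simp add: g_def algebra_simps)
      finally show "norm (?f y t) \<le> g t"
        using t by (simp add: y norm_mult norm_cpow)
    qed
  qed simp
  moreover have "sep_holo (\<lambda>x. rGamma (fst x)) (Rdom 0 K)"
    by (rule sep_holoI) (auto intro!: continuous_intros field_differentiable_rGamma
        continuous_on_compose2[OF continuous_on_rGamma[of UNIV]])
  ultimately have "sep_holo (\<lambda>x. rGamma (fst x) *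
      (\<integral>t. ?f x t \<partial>mpos)) (Rdom 0 K)"
    by (intro sep_holo_mult)
  then show ?thesis
    by (rule sep_holo_cong) (auto simp: Rint_def)
qed

section \<open>The Lerch series as a function of \<open>log z\<close>\<close>

abbreviation eterm :: "complex \<Rightarrow> complex \<Rightarrow> complex \<Rightarrow> nat \<Rightarrow> complex" where
  "eterm s w c n \<equiv> exp ((of_nat n + c) * w) * (of_nat n + c) powr (- s)"

text \<open>This is \<open>exp (c * w)\<close> times the Lerch series at \<open>z = exp w\<close>.
  As an integral over counting measure it falls under the lemmas on differentiation and on exchange
  of integrals.\<close>

definition Eser :: "pt \<Rightarrow> complex" where
  "Eser = (\<lambda>(s, w, c). \<integral>n. eterm s w c n \<partial>count_space (UNIV :: nat set))"

text \<open>\<open>norm (Ln (n + c))\<close> grows only logarithmically, so for every complex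
  \<open>s\<close> the coefficients grow more slowly than any exponential. The series with
  \<open>Re w < 0\<close> therefore converges for all \<open>s\<close>.\<close>

lemma powr_coeff_bound:
  assumes c: "Re c > 0" and \<delta>: "\<delta> > 0"
  obtains C where "C > 0" "\<And>n::nat. norm ((of_nat n + c) powr (- s)) \<le> C * exp (\<delta> * real n)"
proof -
  \<comment> \<open>Chosen so that \<open>norm s * \<epsilon> \<le> \<delta>\<close>; the
    \<open>+ 1\<close> covers \<open>s = 0\<close>.\<close>
  define \<epsilon> where "\<epsilon> = \<delta> / (norm s + 1)"
  have \<epsilon>: "\<epsilon> > 0" using \<delta> by (simp add: \<epsilon>_def add_nonneg_pos)
  have s\<epsilon>: "norm s * \<epsilon> \<le> \<delta>"
  proof -
    have "norm s / (norm s + 1) \<le> 1" by (simp add: divide_le_eq_1 add_nonneg_pos)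
    then have "\<delta> * (norm s / (norm s + 1)) \<le> \<delta> * 1" using \<delta> by (intro mult_left_mono) auto
    then show ?thesis by (simp add: \<epsilon>_def mult.commute)
  qed
  define B where "B = \<epsilon> * norm c + \<bar>1 + ln \<epsilon>\<bar> + \<bar>ln (Re c)\<bar> + pi"
  show ?thesis
  proof (rule that[of "exp (norm s * B)"])
    fix n :: nat
    define x where "x = of_nat n + c"
    have Rex: "Re c \<le> norm x" using complex_Re_le_cmod[of x] by (simp add: x_def)
    have x0: "x \<noteq> 0" using Rex c by auto
    have nx: "norm x \<le> real n + norm c" unfolding x_def by (rule norm_triangle_le) simp
    have "ln (\<epsilon> * norm x) \<le> \<epsilon> * norm x - 1" using \<epsilon> x0 by (intro ln_le_minus_one) auto
    then have "ln (norm x) \<le> \<epsilon> * norm x - 1 - ln \<epsilon>" using \<epsilon> x0 by (simp add: ln_mult)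
    also have "\<epsilon> * norm x \<le> \<epsilon> * (real n + norm c)" using nx \<epsilon> by (intro mult_left_mono) auto
    finally have 1: "ln (norm x) \<le> \<epsilon> * real n + \<epsilon> * norm c + \<bar>1 + ln \<epsilon>\<bar>" by (simp add: algebra_simps)
    have "ln (Re c) \<le> ln (norm x)" using Rex c x0 by (subst ln_le_cancel_iff) auto
    then have 2: "- ln (norm x) \<le> \<bar>ln (Re c)\<bar>" by simp
    have "0 \<le> \<epsilon> * real n" "0 \<le> \<epsilon> * norm c" using \<epsilon> by auto
    with 1 2 have "\<bar>ln (norm x)\<bar> \<le> \<epsilon> * real n + (\<epsilon> * norm c + \<bar>1 + ln \<epsilon>\<bar> + \<bar>ln (Re c)\<bar>)"
      by linarith
    moreover have "\<bar>Im (Ln x)\<bar> \<le> pi" using mpi_less_Im_Ln[OF x0] Im_Ln_le_pi[OF x0] by simp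
    moreover have "norm (Ln x) \<le> \<bar>ln (norm x)\<bar> + \<bar>Im (Ln x)\<bar>"
      using cmod_le[of "Ln x"] x0 by simp
    ultimately have Lnx: "norm (Ln x) \<le> \<epsilon> * real n + B" by (simp add: B_def)
    have "x powr (- s) = exp (- s * Ln x)" using x0 by (simp add: powr_def)
    then have "norm (x powr (- s)) \<le> exp (norm (- s * Ln x))" by (simp only: norm_exp)
    also have "norm (- s * Ln x) \<le> norm s * (\<epsilon> * real n + B)"
      unfolding norm_mult norm_minus_cancel using Lnx by (intro mult_left_mono) auto
    also have "\<dots> \<le> norm s * B + \<delta> * real n"
      using mult_right_mono[OF s\<epsilon>, of "real n"] by (simp add: algebra_simps)
    finally show "norm ((of_nat n + c) powr (- s)) \<le> exp (norm s * B) * exp (\<delta> * real n)"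
      by (simp add: x_def exp_add)
  qed simp
qed

lemma integrable_count_exp:
  fixes C \<delta> :: real
  assumes "\<delta> > 0"
  shows "integrable (count_space UNIV) (\<lambda>n::nat. C * exp (- \<delta> * real n))"
proof -
  have "summable (\<lambda>n. exp (- \<delta>) ^ n)" using assms by (intro summable_geometric) auto
  moreover have "exp (- \<delta> * real n) = exp (- \<delta>) ^ n" for n
    by (simp flip: exp_of_nat_mult add: mult.commute)
  ultimately show ?thesis
    by (intro integrable_mult_right) (simp add: integrable_count_space_nat_iff)
qed

text \<open>On the ball the exponentials decay at rate \<open>- Re w0 / 2\<close>. Half of that rate
  pays for the coefficients, and the other half is left for the majorant.\<close>

lemma Eser_dominated:
  assumes w: "Re w0 < 0" and c: "Re c > 0"
  obtains C where "\<And>w n. w \<in> ball w0 (- Re w0 / 2) \<Longrightarrow>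
     norm (eterm s w c n) \<le> C * exp (- (- Re w0 / 4) * real n)"
proof -
  obtain C where C: "C > 0" "\<And>n::nat. norm ((of_nat n + c) powr (- s)) \<le> C * exp ((- Re w0 / 4) * real n)"
    using powr_coeff_bound[OF c, of "- Re w0 / 4" s] w by auto
  define M where "M = norm c * (norm w0 - Re w0 / 2)"
  show ?thesis
  proof (rule that[of "exp M * C"])
    fix w and n :: nat assume wb: "w \<in> ball w0 (- Re w0 / 2)"
    have "norm w \<le> norm w0 - Re w0 / 2"
      using wb norm_triangle_sub[of w w0] by (simp add: dist_norm norm_minus_commute)
    then have "norm (c * w) \<le> M" unfolding M_def norm_mult by (intro mult_left_mono) auto
    then have 1: "Re (c * w) \<le> M" using complex_Re_le_cmod order_trans by blast
    have "Re w \<le> Re w0 / 2" using Re_ball_bounds(2)[OF wb] by simp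
    then have 2: "real n * Re w \<le> real n * (Re w0 / 2)" by (intro mult_left_mono) auto
    have "norm (exp ((of_nat n + c) * w)) = exp (real n * Re w + Re (c * w))"
      by (simp add: distrib_right)
    also have "\<dots> \<le> exp (real n * (Re w0 / 2) + M)" using 1 2 by simp
    finally have "norm (exp ((of_nat n + c) * w)) * norm ((of_nat n + c) powr (- s)) \<le>
        exp (real n * (Re w0 / 2) + M) * (C * exp ((- Re w0 / 4) * real n))"
      using C by (intro mult_mono) auto
    also have "\<dots> = exp M * C * exp (real n * (Re w0 / 2) + (- Re w0 / 4) * real n)"
      by (simp only: exp_add mult_ac)
    also have "real n * (Re w0 / 2) + (- Re w0 / 4) * real n = - (- Re w0 / 4) * real n"
      by (simp add: field_simps)
    finally show "norm (eterm s w c n) \<le>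
        exp M * C * exp (- (- Re w0 / 4) * real n)"
      by (simp add: norm_mult)
  qed
qed

lemma Eser_integrable:
  assumes "Re w < 0" "Re c > 0"
  shows "integrable (count_space UNIV) (\<lambda>n::nat. eterm s w c n)"
proof -
  obtain C where C: "\<And>x n. x \<in> ball w (- Re w / 2) \<Longrightarrow>
     norm (eterm s x c n) \<le> C * exp (- (- Re w / 4) * real n)"
    using Eser_dominated[OF assms, of s] by blast
  show ?thesis
    by (rule Bochner_Integration.integrable_bound[OF integrable_count_exp[of "- Re w / 4" C]])
       (use assms C[of w] in \<open>auto intro!: AE_I2 order_trans[OF _ abs_ge_self]\<close>)
qed

lemma Eser_deriv:
  assumes w: "Re w < 0" and c: "Re c > 0"
  shows "((\<lambda>w. Eser (s + 1, w, c)) has_field_derivative Eser (s, w, c)) (at w)"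
proof -
  obtain C where C: "\<And>x n. x \<in> ball w (- Re w / 2) \<Longrightarrow>
     norm (eterm (s + 1) x c n) \<le> C * exp (- (- Re w / 4) * real n)"
    using Eser_dominated[OF assms, of "s + 1"] by blast
  have "((\<lambda>w. Eser (s + 1, w, c)) has_field_derivative
    (\<integral>n. exp ((of_nat n + c) * w) * (of_nat n + c) * (of_nat n + c) powr (- (s + 1)) \<partial>count_space (UNIV :: nat set))) (at w)"
    unfolding Eser_def prod.case
  proof (rule has_field_derivative_integral_dominated(2)[where r = "- Re w / 2"
        and f' = "\<lambda>w n. exp ((of_nat n + c) * w) * (of_nat n + c) * (of_nat n + c) powr (- (s + 1))"
        and g = "\<lambda>n. C * exp (- (- Re w / 4) * real n)"])
    show "((\<lambda>x. eterm (s + 1) x c n) has_field_derivative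
        exp ((of_nat n + c) * x) * (of_nat n + c) * (of_nat n + c) powr - (s + 1)) (at x)" for x and n :: nat
      by (auto intro!: derivative_eq_intros)
    show "integrable (count_space UNIV) (\<lambda>n. C * exp (- (- Re w / 4) * real n))"
      using w by (intro integrable_count_exp) auto
  qed (use w C in auto)
  also have "(\<integral>n. exp ((of_nat n + c) * w) * (of_nat n + c) * (of_nat n + c) powr (- (s + 1)) \<partial>count_space (UNIV :: nat set)) = Eser (s, w, c)"
    unfolding Eser_def prod.case
  proof (rule Bochner_Integration.integral_cong)
    fix n :: nat
    have "of_nat n + c \<noteq> 0" using c by (auto simp: complex_eq_iff)
    then have "(of_nat n + c) * (of_nat n + c) powr (- (s + 1)) = (of_nat n + c) powr (- s)"
      using powr_add[of "of_nat n + c" 1 "- (s + 1)"] by simp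
    then show "exp ((of_nat n + c) * w) * (of_nat n + c) * (of_nat n + c) powr (- (s + 1)) =
        eterm s w c n"
      by (simp only: mult.assoc)
  qed simp
  finally show ?thesis .
qed

lemma Eser_Lerch:
  assumes "Re w < 0" "Re c > 0"
  shows "Eser (s, w, c) = exp (c * w) * Lerch (s, exp w, c)"
    and "summable (\<lambda>n. exp w ^ n * (of_nat n + c) powr (- s))"
proof -
  note int = Eser_integrable[OF assms, of s]
  have trm: "eterm s w c n =
      exp (c * w) * (exp w ^ n * (of_nat n + c) powr (- s))" for n
    unfolding distrib_right exp_add exp_of_nat_mult by (simp only: mult_ac)
  have "summable (\<lambda>n. exp (c * w) * (exp w ^ n * (of_nat n + c) powr (- s)))"
    using int unfolding integrable_count_space_nat_iff trm by (rule summable_norm_cancel)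
  then show *: "summable (\<lambda>n. exp w ^ n * (of_nat n + c) powr (- s))"
    by (simp add: summable_cmult_iff)
  have "Eser (s, w, c) = (\<Sum>n. eterm s w c n)"
    using integral_count_space_nat[OF int] by (simp add: Eser_def)
  also have "\<dots> = exp (c * w) * Lerch (s, exp w, c)"
    unfolding trm by (simp add: Lerch_def suminf_mult[OF *])
  finally show "Eser (s, w, c) = exp (c * w) * Lerch (s, exp w, c)" .
qed

lemma Eser_shift:
  assumes "Re w < 0" "Re c > 0"
  shows "Eser (s, w, c) = Eser (s, w, c + 1) + exp (c * w) * c powr (- s)"
proof -
  have "Lerch (s, exp w, c) = (\<Sum>n. exp w ^ Suc n * (of_nat (Suc n) + c) powr (- s)) + c powr (- s)"
    using suminf_split_head[OF Eser_Lerch(2)[OF assms, of s]] by (simp add: Lerch_def)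
  also have "(\<Sum>n. exp w ^ Suc n * (of_nat (Suc n) + c) powr (- s)) =
      (\<Sum>n. exp w * (exp w ^ n * (of_nat n + (c + 1)) powr (- s)))"
    by (simp add: add_ac mult_ac)
  also have "\<dots> = exp w * Lerch (s, exp w, c + 1)"
    using Eser_Lerch(2)[of w "c + 1" s] assms by (simp add: Lerch_def suminf_mult)
  finally show ?thesis
    using assms by (simp add: Eser_Lerch(1) exp_add distrib_left distrib_right mult_ac)
qed

text \<open>Under the Gamma integral the terms form a geometric series of ratio
  \<open>exp (w - t)\<close>.\<close>

lemma Eser_Gamma:
  assumes s: "Re s > 0" and w: "Re w < 0" and c: "Re c > 0"
  shows "(\<integral>t. cpow (s - 1) t * (exp (c * (w - of_real t)) / (1 - exp (w - of_real t))) \<partial>mpos) =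
         Gamma s * Eser (s, w, c)"
proof -
  let ?I = "\<lambda>t. \<integral>n. exp ((of_nat n + c) * w) * exp (- of_real t * (of_nat n + c)) \<partial>count_space (UNIV :: nat set)"
  have "(\<integral>t. cpow (s - 1) t * ?I t \<partial>mpos) =
         Gamma s * (\<integral>n. eterm s w c n \<partial>count_space (UNIV :: nat set))"
  proof (rule integral_Gamma_Fubini[OF _ _ _ s])
    show "sigma_finite_measure (count_space (UNIV :: nat set))"
      by (rule sigma_finite_measure_count_space)
    show "integrable (count_space UNIV) (\<lambda>n::nat. norm (exp ((of_nat n + c) * w)) * Re (of_nat n + c) powr (- Re s))"
    proof (rule Bochner_Integration.integrable_bound[OF integrable_count_exp[of "- Re w" "exp (Re (c * w)) * Re c powr (- Re s)"]])
      show "AE n in count_space UNIV. norm (norm (exp ((of_nat n + c) * w)) * Re (of_nat n + c) powr (- Re s)) \<le>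
          norm (exp (Re (c * w)) * Re c powr (- Re s) * exp (- (- Re w) * real n))"
      proof (rule AE_I2)
        fix n :: nat
        have "Re (of_nat n + c) powr (- Re s) \<le> Re c powr (- Re s)"
          using c s by (intro powr_mono2') auto
        moreover have "norm (exp ((of_nat n + c) * w)) = exp (Re (c * w)) * exp (- (- Re w) * real n)"
          by (simp add: algebra_simps flip: exp_add)
        ultimately show "norm (norm (exp ((of_nat n + c) * w)) * Re (of_nat n + c) powr (- Re s)) \<le>
          norm (exp (Re (c * w)) * Re c powr (- Re s) * exp (- (- Re w) * real n))"
          by (simp add: abs_mult mult_ac)
      qed
    qed (use w in auto)
  qed (use c in auto)
  also have "(\<integral>n. eterm s w c n \<partial>count_space (UNIV :: nat set)) = Eser (s, w, c)"
    by (simp add: Eser_def)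
  also have "(\<integral>t. cpow (s - 1) t * ?I t \<partial>mpos) =
      (\<integral>t. cpow (s - 1) t * (exp (c * (w - of_real t)) / (1 - exp (w - of_real t))) \<partial>mpos)"
  proof (rule Bochner_Integration.integral_cong)
    fix t assume "t \<in> space mpos"
    define u where "u = w - of_real t"
    have u: "norm (exp u) < 1" using w \<open>t \<in> space mpos\<close> by (simp add: u_def)
    have trm: "exp ((of_nat n + c) * w) * exp (- of_real t * (of_nat n + c)) = exp (c * u) * exp u ^ n" for n :: nat
      by (simp add: u_def algebra_simps flip: exp_add exp_of_nat_mult)
    have sm: "summable (\<lambda>n. norm (exp (c * u) * exp u ^ n))"
      using u by (simp add: norm_mult norm_power summable_cmult_iff del: norm_exp_eq_Re)
    have "?I t =
        (\<Sum>n. exp (c * u) * exp u ^ n)"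
      unfolding trm using sm by (intro integral_count_space_nat) (simp add: integrable_count_space_nat_iff)
    also have "\<dots> = exp (c * u) * (\<Sum>n. exp u ^ n)"
      using u by (intro suminf_mult summable_geometric)
    also have "\<dots> = exp (c * u) / (1 - exp u)"
      using u by (simp add: suminf_geometric)
    finally show "cpow (s - 1) t * ?I t =
       cpow (s - 1) t * (exp (c * (w - of_real t)) / (1 - exp (w - of_real t)))"
      by (simp add: u_def)
  qed simp
  finally show ?thesis .
qed

text \<open>The series without the contributions of the branch points \<open>per k\<close> in the
  strip. It is meaningful for \<open>Re w < 0\<close>; \<open>Rreg\<close> continues it to the whole
  strip.\<close>

definition Lpart :: "nat \<Rightarrow> pt \<Rightarrow> complex" where
  "Lpart K = (\<lambda>(s, w, c). Eser (s, w, c) - (\<Sum>k\<in>ibox K. exp (per k * c) * sing0 s (w - per k)))"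

lemma Lpart_deriv:
  assumes w: "Re w < 0" and c: "Re c > 0"
  shows "((\<lambda>w. Lpart K (s + 1, w, c)) has_field_derivative Lpart K (s, w, c)) (at w)"
proof -
  have "((\<lambda>w. sing0 (s + 1) (w - per k)) has_field_derivative sing0 s (w - per k)) (at w)" for k
    using DERIV_shift[of "sing0 (s + 1)" "sing0 s (w - per k)" w "- per k"] sing0_deriv[of "w - per k" s] w by simp
  then show ?thesis
    unfolding Lpart_def prod.case by (intro DERIV_diff Eser_deriv w c DERIV_sum DERIV_cmult)
qed

text \<open>For \<open>Re w < 0\<close> the path \<open>w - t\<close> meets no pole, so the kernel
  and its pole terms are integrable separately, and both transforms are known.\<close>

lemma Rint_eq_Lpart:
  assumes x: "(s, w, c) \<in> Rdom 0 K" and w: "Re w < 0"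
  shows "Rint K (s, w, c) = Lpart K (s, w, c)"
proof -
  have s: "Re s > 0" and ws: "w \<in> strip K" and c: "Re c > 0" using x by (auto simp: Rdom_def)
  have int_G: "integrable mpos (\<lambda>t. rterm K s w c t)"
  proof -
    obtain r \<delta> C where r: "r > 0" "\<delta> > 0" "C \<ge> 0"
      "\<And>x y t. x \<in> ball w r \<Longrightarrow> y \<in> ball c r \<Longrightarrow> t \<ge> 0 \<Longrightarrow>
         norm (Gker K y (x - of_real t)) \<le> C * exp (- \<delta> * t)"
      using Gker_decay[OF ws c] by blast
    show ?thesis
    proof (rule Bochner_Integration.integrable_bound)
      show "integrable mpos (\<lambda>t. C * (t powr (Re s - 1) * exp (- \<delta> * t)))"
        by (intro integrable_mult_right integrable_powr_exp s r)
      show "AE t in mpos. norm (rterm K s w c t) \<le>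
          norm (C * (t powr (Re s - 1) * exp (- \<delta> * t)))"
      proof (rule AE_I2)
        fix t assume t: "t \<in> space mpos"
        have "t powr (Re s - 1) * norm (Gker K c (w - of_real t)) \<le> t powr (Re s - 1) * (C * exp (- \<delta> * t))"
          using r(1) t by (intro mult_left_mono r(4)) auto
        then show "norm (rterm K s w c t) \<le>
          norm (C * (t powr (Re s - 1) * exp (- \<delta> * t)))"
          using t r(3) by (simp add: norm_mult norm_cpow mult_ac abs_mult)
      qed
    qed (use ws in \<open>auto intro!: borel_measurable_mpos_continuous continuous_intros cpow_continuous continuous_Gker\<close>)
  qed
  let ?a = "\<lambda>v t. cpow (s - 1) t * (exp (v - of_real t) / (of_real t - v))" and ?b = "\<lambda>v t. exp (Re v) / (- Re v) * (t powr (Re s - 1) * exp (- 1 * t))"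
  have int_B: "integrable mpos (?a v)"
    if v: "Re v < 0" for v
  proof (rule Bochner_Integration.integrable_bound)
    show "integrable mpos (?b v)"
      by (intro integrable_mult_right integrable_powr_exp s) auto
    show "AE t in mpos. norm (?a v t) \<le>
          norm (?b v t)"
    proof (rule AE_I2)
      fix t assume t: "t \<in> space mpos"
      have "norm (of_real t - v) \<ge> - Re v" using complex_Re_le_cmod[of "of_real t - v"] t by simp
      then have "exp (Re v - t) / norm (of_real t - v) \<le> exp (Re v - t) / (- Re v)"
        using v by (intro divide_left_mono mult_pos_pos) (linarith | simp)+
      then have "t powr (Re s - 1) * (exp (Re v - t) / norm (of_real t - v)) \<le> t powr (Re s - 1) * (exp (Re v - t) / (- Re v))"
        by (intro mult_left_mono) auto
      moreover have "norm (?b v t) =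
          t powr (Re s - 1) * (exp (Re v - t) / (- Re v))"
        using v by (simp add: abs_mult exp_diff exp_minus field_simps)
      ultimately show "norm (?a v t) \<le>
          norm (?b v t)"
        using t by (simp add: norm_mult norm_divide norm_cpow)
    qed
    have "of_real t \<noteq> v" if "t > 0" for t using v that by auto
    then show "(?a v) \<in> borel_measurable mpos"
      by (auto intro!: borel_measurable_mpos_continuous continuous_intros cpow_continuous)
  qed
  have v: "Re (w - per k) < 0" for k using w by simp
  let ?B = "\<lambda>k t. exp (per k * c) * (cpow (s - 1) t * (exp (w - per k - of_real t) / (of_real t - (w - per k))))"
  have intB: "integrable mpos (?B k)" for k by (rule integrable_mult_right[OF int_B[OF v]])
  have "(\<integral>t. rterm K s w c t + (\<Sum>k\<in>ibox K. ?B k t) \<partial>mpos) =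
      (\<integral>t. cpow (s - 1) t * (exp (c * (w - of_real t)) / (1 - exp (w - of_real t))) \<partial>mpos)"
  proof (rule Bochner_Integration.integral_cong)
    fix t assume t: "t \<in> space mpos"
    have "norm (exp (w - of_real t)) < 1" using w t by simp
    then have ne: "exp (w - of_real t) \<noteq> 1" using norm_one less_irrefl by metis
    \<comment> \<open>With \<open>u = w - t\<close>, \<open>sing0_Gamma\<close> transforms
      \<open>exp u / (per k - u)\<close>, the negative of the pole term in \<open>Gker_eq\<close>.
      This is why \<open>Lpart\<close> subtracts the sum.\<close>
    have B: "?B k t = - (cpow (s - 1) t * (exp (per k * c) * (exp (w - of_real t) / (w - of_real t - per k))))" for k
    proof -
      have "exp (w - per k - of_real t) = exp (w - of_real t)"
        using exp_diff_per[of "w - of_real t" k] by (simp add: algebra_simps del: exp_diff_per)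
      moreover have "of_real t - (w - per k) = - (w - of_real t - per k)" by simp
      ultimately show ?thesis by (simp only: divide_minus_right mult_minus_right mult_ac)
    qed
    show "rterm K s w c t + (\<Sum>k\<in>ibox K. ?B k t) =
      cpow (s - 1) t * (exp (c * (w - of_real t)) / (1 - exp (w - of_real t)))"
      unfolding B using ws ne
      by (simp add: Gker_eq sum_negf distrib_left sum_distrib_left)
  qed simp
  also have "(\<integral>t. rterm K s w c t + (\<Sum>k\<in>ibox K. ?B k t) \<partial>mpos) =
      (\<integral>t. rterm K s w c t \<partial>mpos) + (\<Sum>k\<in>ibox K. \<integral>t. ?B k t \<partial>mpos)"
    by (simp only: Bochner_Integration.integral_add[OF int_G Bochner_Integration.integrable_sum[OF intB]]
        Bochner_Integration.integral_sum[OF intB])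
  also have "(\<Sum>k\<in>ibox K. \<integral>t. ?B k t \<partial>mpos) = (\<Sum>k\<in>ibox K. exp (per k * c) * (Gamma s * sing0 s (w - per k)))"
    using sing0_Gamma[OF s v] by (intro sum.cong refl) (simp only: integral_mult_right_zero)
  finally have "(\<integral>t. rterm K s w c t \<partial>mpos) =
      Gamma s * Eser (s, w, c) - (\<Sum>k\<in>ibox K. exp (per k * c) * (Gamma s * sing0 s (w - per k)))"
    by (simp only: Eser_Gamma[OF s w c] eq_diff_eq)
  also have "\<dots> = Gamma s * Lpart K (s, w, c)"
    by (simp add: Lpart_def right_diff_distrib sum_distrib_left mult_ac)
  finally have "Rint K (s, w, c) = rGamma s * Gamma s * Lpart K (s, w, c)"
    by (simp add: Rint_def)
  \<comment> \<open>\<open>Gamma\<close> takes the default value 0 exactly at its poles, which are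
    excluded by \<open>Re s > 0\<close>.\<close>
  moreover have "Gamma s \<noteq> 0"
    using s by (auto simp: Gamma_eq_zero_iff elim!: nonpos_Ints_cases)
  then have "rGamma s * Gamma s = 1" by (simp add: rGamma_inverse_Gamma)
  ultimately show ?thesis by simp
qed

section \<open>Continuation of the regular part to all \<open>s\<close>\<close>

lemma sep_holo_shift1:
  assumes "sep_holo f U"
  shows "sep_holo (\<lambda>x. f (case x of (s, w, c) \<Rightarrow> (s + a, w, c))) ((\<lambda>(s, w, c). (s + a, w, c)) -` U)"
proof (rule sep_holo_reindex[OF assms])
  show "continuous_on UNIV (\<lambda>(s, w, c). (s + a, w, c) :: pt)"
    by (auto simp: case_prod_unfold intro!: continuous_intros)
  fix s w c assume "(case (s, w, c) of (s, w, c) \<Rightarrow> (s + a, w, c)) \<in> U"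
  then have x: "(s + a, w, c) \<in> U" by simp
  have "(\<lambda>x. f (x + a, w, c)) field_differentiable at s"
    using sep_holoD(3)[OF assms x] DERIV_shift[of "\<lambda>x. f (x, w, c)" _ s a]
    by (auto simp: field_differentiable_def)
  then show "(\<lambda>x. f (case (x, w, c) of (s, w, c) \<Rightarrow> (s + a, w, c))) field_differentiable at s \<and>
    (\<lambda>x. f (case (s, x, c) of (s, w, c) \<Rightarrow> (s + a, w, c))) field_differentiable at w \<and>
    (\<lambda>x. f (case (s, w, x) of (s, w, c) \<Rightarrow> (s + a, w, c))) field_differentiable at c"
    using sep_holoD(4,5)[OF assms x] by simp
qed

text \<open>The transfer principle for all relations between regular parts: they are checked where
  the series converges and then hold on the connected strip.\<close>

lemma strip_identity:
  assumes "f holomorphic_on strip K" "g holomorphic_on strip K"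
    and "\<And>w. w \<in> strip K \<Longrightarrow> Re w < 0 \<Longrightarrow> f w = g w" and "w \<in> strip K"
  shows "f w = g w"
proof (rule analytic_continuation_open[of "strip K \<inter> {w. Re w < 0}" "strip K" f g])
  have "- 1 \<in> strip K \<inter> {w. Re w < 0}" by (simp add: strip_def)
  then show "strip K \<inter> {w. Re w < 0} \<noteq> {}" by blast
qed (use assms convex_connected[OF convex_strip] in \<open>auto simp: open_halfspace_Re_lt\<close>)

lemma sep_holo_slice2:
  assumes "sep_holo f (Rdom a K)" "Re s > a" "Re c > 0"
  shows "(\<lambda>w. f (s, w, c)) holomorphic_on strip K"
  unfolding holomorphic_on_def
proof
  fix w assume "w \<in> strip K"
  then show "(\<lambda>w. f (s, w, c)) field_differentiable at w within strip K"
    using assms by (intro field_differentiable_at_within[OF sep_holoD(4)[OF assms(1)]]) (auto simp: Rdom_def)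
qed

text \<open>The continuation in \<open>s\<close> comes from \<open>\<partial>R(s + 1, w, c)/\<partial>w = R(s, w, c)\<close>.\<close>
lemma Rint_extend_left:
  "\<exists>R. sep_holo R (Rdom (- real m) K) \<and>
     (\<forall>s w c. (s, w, c) \<in> Rdom (- real m) K \<longrightarrow> Re w < 0 \<longrightarrow> R (s, w, c) = Lpart K (s, w, c))"
proof (induction m)
  case 0
  show ?case using sep_holo_Rint[of K] Rint_eq_Lpart[of _ _ _ K] by (intro exI[of _ "Rint K"]) auto
next
  case (Suc m)
  then obtain R where R: "sep_holo R (Rdom (- real m) K)"
    "\<And>s w c. (s, w, c) \<in> Rdom (- real m) K \<Longrightarrow> Re w < 0 \<Longrightarrow> R (s, w, c) = Lpart K (s, w, c)" by blast
  define R' where "R' = (\<lambda>(s, w, c). deriv (\<lambda>x. R (s + 1, x, c)) w)"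
  have dom: "(\<lambda>(s, w, c). (s + 1, w, c)) -` Rdom (- real m) K = Rdom (- real (Suc m)) K"
    by (auto simp: Rdom_def)
  have "sep_holo R' (Rdom (- real (Suc m)) K)"
    using sep_holo_deriv2[OF sep_holo_shift1[OF R(1), of 1]] unfolding dom by (simp add: R'_def)
  moreover have "R' (s, w, c) = Lpart K (s, w, c)" if x: "(s, w, c) \<in> Rdom (- real (Suc m)) K" and w: "Re w < 0" for s w c
  proof -
    have c: "Re c > 0" using x by (auto simp: Rdom_def)
    have "((\<lambda>x. R (s + 1, x, c)) has_field_derivative Lpart K (s, w, c)) (at w)"
    proof (rule has_field_derivative_transform_within_open[OF Lpart_deriv[OF w c, of K s], of "strip K \<inter> {w. Re w < 0}"])
      show "Lpart K (s + 1, y, c) = R (s + 1, y, c)" if "y \<in> strip K \<inter> {w. Re w < 0}" for y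
        using R(2)[of "s + 1" y c] that x by (auto simp: Rdom_def)
    qed (use x w in \<open>auto simp: Rdom_def open_halfspace_Re_lt\<close>)
    then show ?thesis by (simp add: R'_def DERIV_imp_deriv)
  qed
  ultimately show ?case by blast
qed

definition Udom :: "nat \<Rightarrow> pt set" where
  "Udom K = UNIV \<times> strip K \<times> {c. Re c > 0}"

lemma open_Udom [simp, intro]: "open (Udom K)"
  unfolding Udom_def by (intro open_Times open_halfspace_Re_gt open_strip) auto

text \<open>The extensions for different \<open>m\<close> agree with \<open>Lpart\<close> for
  \<open>Re w < 0\<close>, hence with each other by the identity theorem in \<open>w\<close>, and so
  they glue.\<close>

lemma Lpart_extension:
  "\<exists>R. sep_holo R (Udom K) \<and> (\<forall>s w c. (s, w, c) \<in> Udom K \<longrightarrow> Re w < 0 \<longrightarrow> R (s, w, c) = Lpart K (s, w, c))"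
proof -
  obtain R where R: "\<And>m. sep_holo (R m) (Rdom (- real m) K)"
    "\<And>m s w c. (s, w, c) \<in> Rdom (- real m) K \<Longrightarrow> Re w < 0 \<Longrightarrow> R m (s, w, c) = Lpart K (s, w, c)"
    using Rint_extend_left[of _ K] by metis
  \<comment> \<open>An index \<open>m\<close> with \<open>- m < Re s\<close>; the \<open>+ 1\<close>
    makes the inequality strict.\<close>
  define S where "S = (\<lambda>(s, w, c). R (nat \<lceil>- Re s\<rceil> + 1) (s, w, c))"
  have big: "- real (nat \<lceil>- Re s\<rceil> + 1) < Re s" for s
  proof -
    have "- Re s \<le> real_of_int \<lceil>- Re s\<rceil>" by (rule le_of_int_ceiling)
    also have "\<dots> \<le> real (nat \<lceil>- Re s\<rceil>)" by simp
    finally show ?thesis by simp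
  qed
  have agree: "S (s, w, c) = R m (s, w, c)" if "(s, w, c) \<in> Rdom (- real m) K" for m s w c
  proof -
    have *: "- real m < Re s" "w \<in> strip K" "Re c > 0" using that by (auto simp: Rdom_def)
    show ?thesis
      unfolding S_def prod.case
    proof (rule strip_identity[of "\<lambda>w. R (nat \<lceil>- Re s\<rceil> + 1) (s, w, c)" K "\<lambda>w. R m (s, w, c)"])
      show "(\<lambda>w. R (nat \<lceil>- Re s\<rceil> + 1) (s, w, c)) holomorphic_on strip K"
        by (rule sep_holo_slice2[OF R(1)]) (use big * in auto)
      show "(\<lambda>w. R m (s, w, c)) holomorphic_on strip K"
        by (rule sep_holo_slice2[OF R(1)]) (use * in auto)
      fix w assume "w \<in> strip K" "Re w < 0"
      then show "R (nat \<lceil>- Re s\<rceil> + 1) (s, w, c) = R m (s, w, c)"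
        using big[of s] * by (subst (1 2) R(2)) (auto simp: Rdom_def simp del: of_nat_add)
    qed (rule *)
  qed
  have mem: "(s, w, c) \<in> Rdom (- real (nat \<lceil>- Re s\<rceil> + 1)) K" if "(s, w, c) \<in> Udom K" for s w c
    using that big[of s] unfolding Udom_def Rdom_def by blast
  show ?thesis
  proof (intro exI[of _ S] conjI allI impI)
    show "sep_holo S (Udom K)"
    proof (rule sep_holo_local)
      fix x assume "x \<in> Udom K"
      then obtain s w c where x: "x = (s, w, c)" "(s, w, c) \<in> Udom K" by (cases x) auto
      define m where "m = nat \<lceil>- Re s\<rceil> + 1"
      have "sep_holo S (Rdom (- real m) K)"
        by (rule sep_holo_cong[OF R(1)[of m]]) (use agree[of _ _ _ m] in auto)
      then show "\<exists>V. x \<in> V \<and> V \<subseteq> Udom K \<and> sep_holo S V"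
        using mem[OF x(2)] x(1) unfolding m_def
        by (intro exI[of _ "Rdom (- real (nat \<lceil>- Re s\<rceil> + 1)) K"]) (auto simp: Rdom_def Udom_def)
    qed
    show "S (s, w, c) = Lpart K (s, w, c)" if "(s, w, c) \<in> Udom K" "Re w < 0" for s w c
      using R(2)[OF mem[OF that(1)] that(2)] by (simp add: S_def)
  qed
qed

definition Rreg :: "nat \<Rightarrow> pt \<Rightarrow> complex" where
  "Rreg K = (SOME R. sep_holo R (Udom K) \<and>
     (\<forall>s w c. (s, w, c) \<in> Udom K \<longrightarrow> Re w < 0 \<longrightarrow> R (s, w, c) = Lpart K (s, w, c)))"

lemma sep_holo_Rreg: "sep_holo (Rreg K) (Udom K)"
  and Rreg_Lpart: "(s, w, c) \<in> Udom K \<Longrightarrow> Re w < 0 \<Longrightarrow> Rreg K (s, w, c) = Lpart K (s, w, c)"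
  using someI_ex[OF Lpart_extension[of K]] unfolding Rreg_def by blast+

lemma Rreg_holomorphic:
  assumes "Re c > 0"
  shows "(\<lambda>w. Rreg K (s, w, c)) holomorphic_on strip K"
  unfolding holomorphic_on_def
proof
  fix w assume "w \<in> strip K"
  then show "(\<lambda>w. Rreg K (s, w, c)) field_differentiable at w within strip K"
    using assms by (intro field_differentiable_at_within[OF sep_holoD(4)[OF sep_holo_Rreg]]) (auto simp: Udom_def)
qed

section \<open>Dependence of the regular part on \<open>K\<close> and on shifts of
  \<open>c\<close>\<close>

lemma sing_holomorphic: "sing s holomorphic_on A"
  unfolding holomorphic_on_def
  using field_differentiable_at_within[OF sep_holoD(4)[OF sep_holo_sing, of s _ 0]] by simp

text \<open>For a branch point outside the strip, \<open>per k - w\<close> is never real, so its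
  principal logarithm is holomorphic on the whole strip.\<close>

lemma per_minus_strip:
  assumes "w \<in> strip K" "k \<notin> ibox K"
  shows "Im (per k - w) \<noteq> 0" "per k - w \<notin> \<real>\<^sub>\<le>\<^sub>0"
proof -
  have "real K + 1 \<le> \<bar>real_of_int k\<bar>" using assms(2) by (auto simp: ibox_def)
  then have "2 * pi * (real K + 1) \<le> 2 * pi * \<bar>real_of_int k\<bar>" by (intro mult_left_mono) auto
  moreover have "\<bar>Im w\<bar> < 2 * pi * (real K + 1)" using assms(1) unfolding strip_def by blast
  moreover have "\<bar>2 * pi * real_of_int k\<bar> = 2 * pi * \<bar>real_of_int k\<bar>" by (simp add: abs_mult)
  ultimately have "\<bar>Im w\<bar> < \<bar>2 * pi * real_of_int k\<bar>" by linarith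
  then show "Im (per k - w) \<noteq> 0" by auto
  then show "per k - w \<notin> \<real>\<^sub>\<le>\<^sub>0" by (auto simp: complex_nonpos_Reals_iff)
qed

lemma strip_mono: "K \<le> K' \<Longrightarrow> strip K \<subseteq> strip K'"
proof
  fix w assume K: "K \<le> K'" and w: "w \<in> strip K"
  have "2 * pi * (real K + 1) \<le> 2 * pi * (real K' + 1)" using K by (intro mult_left_mono) auto
  then show "w \<in> strip K'" using w unfolding strip_def mem_Collect_eq by linarith
qed

text \<open>For \<open>Re w < 0\<close> this is the difference of two \<open>Lpart\<close> with
  \<open>sing0\<close> rewritten by \<open>sing_Ln\<close>. The added terms are holomorphic on the
  smaller strip since their branch points lie outside it.\<close>

lemma Rreg_change_K:
  assumes w: "w \<in> strip K" and c: "Re c > 0" and K: "K \<le> K'"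
  shows "Rreg K (s, w, c) = Rreg K' (s, w, c) + (\<Sum>k\<in>ibox K' - ibox K. exp (per k * c) * sing s (Ln (per k - w)))"
proof (rule strip_identity[of "\<lambda>w. Rreg K (s, w, c)" K "\<lambda>w. Rreg K' (s, w, c) + (\<Sum>k\<in>ibox K' - ibox K. exp (per k * c) * sing s (Ln (per k - w)))"])
  show "(\<lambda>w. Rreg K (s, w, c)) holomorphic_on strip K" by (rule Rreg_holomorphic[OF c])
  have "(\<lambda>w. sing s (Ln (per k - w))) holomorphic_on strip K" if "k \<in> ibox K' - ibox K" for k
    by (rule holomorphic_on_compose[of "\<lambda>w. Ln (per k - w)" _ "sing s", unfolded o_def])
       (use that per_minus_strip in \<open>auto intro!: holomorphic_intros sing_holomorphic\<close>)
  then show "(\<lambda>w. Rreg K' (s, w, c) + (\<Sum>k\<in>ibox K' - ibox K. exp (per k * c) * sing s (Ln (per k - w)))) holomorphic_on strip K"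
    by (intro holomorphic_intros holomorphic_on_subset[OF Rreg_holomorphic[OF c] strip_mono[OF K]]) 
  fix w assume w: "w \<in> strip K" "Re w < 0"
  have "sing s (Ln (per k - w)) = sing0 s (w - per k)" for k
    using sing_Ln[of "w - per k" s] w by simp
  moreover have "ibox K \<subseteq> ibox K'" using K by (auto simp: ibox_def)
  ultimately show "Rreg K (s, w, c) = Rreg K' (s, w, c) + (\<Sum>k\<in>ibox K' - ibox K. exp (per k * c) * sing s (Ln (per k - w)))"
    using w c strip_mono[OF K] by (subst (1 2) Rreg_Lpart) (auto simp: Udom_def Lpart_def sum_diff)
qed (rule w)

text \<open>The singular sum has period 1 in \<open>c\<close> up to its \<open>c\<close>-free
  factors, because \<open>exp (per k) = 1\<close>. So only the first term of the series is split
  off.\<close>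

lemma Rreg_shift:
  assumes w: "w \<in> strip K" and c: "Re c > 0"
  shows "Rreg K (s, w, c) = Rreg K (s, w, c + 1) + exp (c * w) * c powr (- s)"
proof (rule strip_identity[of "\<lambda>w. Rreg K (s, w, c)" K "\<lambda>w. Rreg K (s, w, c + 1) + exp (c * w) * c powr (- s)"])
  show "(\<lambda>w. Rreg K (s, w, c)) holomorphic_on strip K"
    "(\<lambda>w. Rreg K (s, w, c + 1) + exp (c * w) * c powr (- s)) holomorphic_on strip K"
    using c by (auto intro!: holomorphic_intros Rreg_holomorphic)
  fix w assume w: "w \<in> strip K" "Re w < 0"
  have "exp (per k * (c + 1)) = exp (per k * c)" for k by (simp add: distrib_left exp_add)
  then show "Rreg K (s, w, c) = Rreg K (s, w, c + 1) + exp (c * w) * c powr (- s)"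
    using w c by (subst (1 2) Rreg_Lpart) (auto simp: Udom_def Lpart_def Eser_shift[of w c])
qed (rule w)

section \<open>Continuation of logarithms along paths\<close>

lemma exp_lift_unique:
  fixes q1 q2 :: "real \<Rightarrow> complex"
  assumes "continuous_on {0..1} q1" "continuous_on {0..1} q2"
    and "\<And>t. t \<in> {0..1} \<Longrightarrow> exp (q1 t) = exp (q2 t)" and "q1 0 = q2 0" and "t \<in> {0..1}"
  shows "q1 t = q2 t"
proof (rule covering_space_lift_unique[OF covering_space_exp_punctured_plane,
      where f = "\<lambda>t. exp (q1 t)" and T = "{0..1}" and a = 0])
  show "continuous_on {0..1} (\<lambda>t. exp (q1 t))" by (intro continuous_intros assms)
qed (use assms in auto)

text \<open>Paths need not be closed here, so \<open>winding_number\<close> need not be an integer: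
  this is the total change of a continuous logarithm of \<open>p t - \<zeta>\<close>.\<close>

abbreviation logvar :: "(real \<Rightarrow> complex) \<Rightarrow> complex \<Rightarrow> complex" where
  "logvar p \<zeta> \<equiv> 2 * of_real pi * \<i> * winding_number p \<zeta>"

lemma winding_number_eq_log_diff:
  assumes p: "path p" "\<zeta> \<notin> path_image p"
    and q: "continuous_on {0..1} q" "\<And>t. t \<in> {0..1} \<Longrightarrow> exp (q t) = p t - \<zeta>"
  shows "logvar p \<zeta> = q 1 - q 0"
proof -
  obtain q' where q': "path q'" "pathfinish q' - pathstart q' = logvar p \<zeta>"
    "\<And>t. t \<in> {0..1} \<Longrightarrow> p t = \<zeta> + exp (q' t)"
    by (rule winding_number_as_continuous_log[OF p]) blast
  have cont: "continuous_on {0..1} q'" using q'(1) by (simp add: path_def)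
  have e0: "exp (q 0) = exp (q' 0)" using q(2)[of 0] q'(3)[of 0] by simp
  have "q 1 = q' 1 + (q 0 - q' 0)"
  proof (rule exp_lift_unique[of q "\<lambda>t. q' t + (q 0 - q' 0)"])
    show "continuous_on {0..1} (\<lambda>t. q' t + (q 0 - q' 0))" by (intro continuous_intros cont)
    show "exp (q t) = exp (q' t + (q 0 - q' 0))" if "t \<in> {0..1}" for t
      using q(2)[OF that] q'(3)[OF that] by (simp add: exp_add exp_diff e0)
  qed (use q in auto)
  then show ?thesis using q'(2) by (simp add: pathstart_def pathfinish_def)
qed

text \<open>Adding the constant \<open>\<i> * pi\<close> turns a logarithm of
  \<open>\<zeta> - p t\<close> into one of \<open>p t - \<zeta>\<close>; it cancels in the
  difference.\<close>

lemma winding_number_eq_log_diff_neg: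
  assumes p: "path p" "\<zeta> \<notin> path_image p"
    and q: "continuous_on {0..1} q" "\<And>t. t \<in> {0..1} \<Longrightarrow> exp (q t) = \<zeta> - p t"
  shows "logvar p \<zeta> = q 1 - q 0"
proof -
  have "logvar p \<zeta> = (q 1 + \<i> * of_real pi) - (q 0 + \<i> * of_real pi)"
    by (rule winding_number_eq_log_diff[OF p]) (use q in \<open>auto intro!: continuous_intros simp: exp_add\<close>)
  then show ?thesis by simp
qed

lemma winding_number_cong:
  assumes "path p" "\<zeta> \<notin> path_image p" "\<And>t. t \<in> {0..1} \<Longrightarrow> p t = q t"
  shows "winding_number p \<zeta> = winding_number q \<zeta>"
  by (rule winding_number_homotopic_paths, rule homotopic_paths_eq) (use assms in auto)

definition loglift :: "complex \<Rightarrow> (real \<Rightarrow> complex) \<Rightarrow> real \<Rightarrow> complex" where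
  "loglift a p = (SOME q. path q \<and> q 0 = a \<and> (\<forall>t\<in>{0..1}. exp (q t) = p t))"

lemma loglift:
  assumes p: "path p" "0 \<notin> path_image p" and a: "exp a = p 0"
  shows "path (loglift a p)" "loglift a p 0 = a" "\<And>t. t \<in> {0..1} \<Longrightarrow> exp (loglift a p t) = p t"
proof -
  obtain q where q: "path q" "\<And>t. t \<in> {0..1} \<Longrightarrow> p t = 0 + exp (q t)"
    by (rule winding_number_as_continuous_log[OF p]) blast
  have "path (\<lambda>t. q t + (a - q 0))" using q(1) unfolding path_def by (intro continuous_intros)
  moreover have "exp (q t + (a - q 0)) = p t" if "t \<in> {0..1}" for t
    using q(2)[OF that] q(2)[of 0] a by (simp add: exp_add exp_diff)
  ultimately have "\<exists>q. path q \<and> q 0 = a \<and> (\<forall>t\<in>{0..1}. exp (q t) = p t)"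
    by (intro exI[of _ "\<lambda>t. q t + (a - q 0)"]) auto
  from someI_ex[OF this] show "path (loglift a p)" "loglift a p 0 = a"
    "\<And>t. t \<in> {0..1} \<Longrightarrow> exp (loglift a p t) = p t"
    unfolding loglift_def by blast+
qed

lemma loglift_unique:
  assumes "path p" "0 \<notin> path_image p" "exp a = p 0"
    and "continuous_on {0..1} q" "\<And>t. t \<in> {0..1} \<Longrightarrow> exp (q t) = p t" "q 0 = a" "t \<in> {0..1}"
  shows "loglift a p t = q t"
  by (rule exp_lift_unique[of "loglift a p" q])
     (use loglift[OF assms(1-3)] assms(4-7) in \<open>auto simp: path_def\<close>)

lemma loglift_end:
  assumes "path p" "0 \<notin> path_image p" "exp a = p 0"
  shows "loglift a p 1 = a + logvar p 0"
  using winding_number_eq_log_diff[OF assms(1,2), of "loglift a p"] loglift[OF assms]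
  by (simp add: path_def)

text \<open>A homotopy that avoids 0 lifts through \<open>exp\<close>, and since it also avoids 1
  its lift avoids all \<open>per k\<close>. Hence the winding numbers of the lift around these
  points are homotopy invariants.\<close>

lemma loglift_homotopic:
  assumes hom: "homotopic_paths (- {0, 1}) p p'" and a: "exp a = p 0"
  shows "homotopic_paths (- range per) (loglift a p) (loglift a p')"
proof -
  obtain h :: "real \<times> real \<Rightarrow> complex" where h: "continuous_on ({0..1} \<times> {0..1}) h" "h \<in> ({0..1} \<times> {0..1}) \<rightarrow> - {0, 1}"
    "\<And>x. x \<in> {0..1} \<Longrightarrow> h (0, x) = p x" "\<And>x. x \<in> {0..1} \<Longrightarrow> h (1, x) = p' x"
    "\<And>t. t \<in> {0..1} \<Longrightarrow> h (t, 0) = p 0" "\<And>t. t \<in> {0..1} \<Longrightarrow> h (t, 1) = p 1"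
    using hom unfolding homotopic_paths pathstart_def pathfinish_def o_def by blast
  have paths: "path p" "path p'" "path_image p \<subseteq> - {0, 1}" "path_image p' \<subseteq> - {0, 1}"
    using homotopic_paths_imp_path[OF hom] homotopic_paths_imp_subset[OF hom] by auto
  have p0: "0 \<notin> path_image p" "0 \<notin> path_image p'" using paths by auto
  have a': "exp a = p' 0" using a h(4)[of 0] h(5)[of 1] by simp
  note lp = loglift[OF paths(1) p0(1) a]
  obtain k where k: "continuous_on ({0..1} \<times> {0..1}) k"
    "\<And>y. y \<in> {0..1} \<Longrightarrow> k (0, y) = loglift a p y"
    "\<And>z. z \<in> {0..1} \<times> {0..1} \<Longrightarrow> h z = exp (k z)"
  proof (rule covering_space_lift_homotopy[OF covering_space_exp_punctured_plane,
        of "{0..1::real}" h "loglift a p"])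
    show "continuous_on {0..1} (loglift a p)" using lp(1) by (simp add: path_def)
  qed (use h lp(3) in \<open>auto simp: Pi_iff\<close>)
  \<comment> \<open>The end points stay fixed because a lift of a constant path is constant.\<close>
  have k0: "k (t, 0) = a" if "t \<in> {0..1}" for t
  proof (rule exp_lift_unique[of "\<lambda>t. k (t, 0)" "\<lambda>_. a"])
    show "continuous_on {0..1} (\<lambda>t. k (t, 0))"
      by (rule continuous_on_compose2[OF k(1)]) (auto intro!: continuous_intros)
    show "exp (k (t, 0)) = exp a" if "t \<in> {0..1}" for t using k(3)[of "(t, 0)"] h(5)[OF that] that a by auto
  qed (use that k(2)[of 0] lp(2) in auto)
  have k1: "k (t, 1) = loglift a p 1" if "t \<in> {0..1}" for t
  proof (rule exp_lift_unique[of "\<lambda>t. k (t, 1)" "\<lambda>_. loglift a p 1"])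
    show "continuous_on {0..1} (\<lambda>t. k (t, 1))"
      by (rule continuous_on_compose2[OF k(1)]) (auto intro!: continuous_intros)
    show "exp (k (t, 1)) = exp (loglift a p 1)" if "t \<in> {0..1}" for t
      using k(3)[of "(t, 1)"] h(6)[OF that] that lp(3)[of 1] by auto
  qed (use that k(2)[of 1] in auto)
  have kend: "k (1, x) = loglift a p' x" if "x \<in> {0..1}" for x
  proof (rule loglift_unique[OF paths(2) p0(2) a', symmetric])
    show "continuous_on {0..1} (\<lambda>x. k (1, x))"
      by (rule continuous_on_compose2[OF k(1)]) (auto intro!: continuous_intros)
    show "exp (k (1, t)) = p' t" if "t \<in> {0..1}" for t using k(3)[of "(1, t)"] h(4)[OF that] that by simp
  qed (use that k0[of 1] in auto)
  show ?thesis
    unfolding homotopic_paths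
  proof (intro exI[of _ k] conjI ballI)
    show "k \<in> {0..1} \<times> {0..1} \<rightarrow> - range per"
    proof
      fix z assume z: "z \<in> {0..1::real} \<times> {0..1::real}"
      have "exp (k z) \<noteq> 1" using k(3)[OF z] h(2) z by (auto simp: Pi_iff)
      then show "k z \<in> - range per" by auto
    qed
  qed (use k kend k0 k1 lp(2) in \<open>auto simp: pathstart_def pathfinish_def\<close>)
qed

section \<open>The continued logarithms attached to a path\<close>

definition zp :: "(real \<Rightarrow> pt) \<Rightarrow> real \<Rightarrow> complex" where
  "zp g = (\<lambda>t. fst (snd (g t)))"

definition cp :: "(real \<Rightarrow> pt) \<Rightarrow> real \<Rightarrow> complex" where
  "cp g = (\<lambda>t. snd (snd (g t)))"

definition Wl :: "(real \<Rightarrow> pt) \<Rightarrow> real \<Rightarrow> complex" where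
  "Wl g = loglift (\<i> * of_real pi) (zp g)"

text \<open>\<open>Wl g\<close>, \<open>ell k g\<close> and \<open>lam n g\<close> are the continuations along \<open>g\<close> of \<open>log z\<close>, \<open>log (2 \<pi> \<i> k - log z)\<close> and
  \<open>log (c + n)\<close>.\<close>
definition ell :: "int \<Rightarrow> (real \<Rightarrow> pt) \<Rightarrow> complex" where
  "ell k g = Ln (per k - \<i> * of_real pi) + logvar (Wl g) (per k)"

definition lam :: "nat \<Rightarrow> (real \<Rightarrow> pt) \<Rightarrow> complex" where
  "lam n g = Ln (1 / 2 + of_nat n) + logvar (cp g) (- of_nat n)"

lemma zp_join [simp]: "zp (g +++ d) = zp g +++ zp d" and cp_join [simp]: "cp (g +++ d) = cp g +++ cp d"
  by (auto simp: zp_def cp_def joinpaths_def)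

lemma zp_reversepath [simp]: "zp (reversepath g) = reversepath (zp g)"
  and cp_reversepath [simp]: "cp (reversepath g) = reversepath (cp g)"
  by (auto simp: zp_def cp_def reversepath_def)

lemma zp_facts:
  assumes "path g" "path_image g \<subseteq> Nsharp"
  shows "path (zp g)" "0 \<notin> path_image (zp g)" "path_image (zp g) \<subseteq> - {0, 1}"
    and "path (cp g)" "- of_nat n \<notin> path_image (cp g)"
proof -
  show "path (zp g)" "path (cp g)"
    using assms(1) unfolding path_def zp_def cp_def by (auto intro!: continuous_intros)
  have *: "g t \<in> Nsharp" if "t \<in> {0..1}" for t using assms(2) that by (auto simp: path_image_def)
  show "0 \<notin> path_image (zp g)" "path_image (zp g) \<subseteq> - {0, 1}" "- of_nat n \<notin> path_image (cp g)"
    using * by (force simp: path_image_def zp_def cp_def Nsharp_def)+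
qed

lemma zp_ends: "pathstart (zp g) = fst (snd (pathstart g))" "pathfinish (zp g) = fst (snd (pathfinish g))"
  "pathstart (cp g) = snd (snd (pathstart g))" "pathfinish (cp g) = snd (snd (pathfinish g))"
  by (simp_all add: zp_def cp_def pathstart_def pathfinish_def)

lemma cpathsD:
  assumes "g \<in> cpaths"
  shows "path g" "path_image g \<subseteq> Nsharp" "pathstart g = x0'" "exp (\<i> * of_real pi) = zp g 0" "cp g 0 = 1 / 2"
  using assms by (auto simp: cpaths_def zp_def cp_def x0'_def pathstart_def)

lemma Wl_facts:
  assumes g: "g \<in> cpaths"
  shows "path (Wl g)" "Wl g 0 = \<i> * of_real pi" "\<And>t. t \<in> {0..1} \<Longrightarrow> exp (Wl g t) = zp g t"
    and "per k \<notin> path_image (Wl g)"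
proof -
  note c = cpathsD[OF g]
  note z = zp_facts[OF c(1,2)]
  show "path (Wl g)" "Wl g 0 = \<i> * of_real pi" and e: "\<And>t. t \<in> {0..1} \<Longrightarrow> exp (Wl g t) = zp g t"
    unfolding Wl_def by (rule loglift[OF z(1,2) c(4)]; assumption?)+
  show "per k \<notin> path_image (Wl g)"
  proof
    assume "per k \<in> path_image (Wl g)"
    then obtain t where "t \<in> {0..1}" "Wl g t = per k" by (auto simp: path_image_def)
    then have "zp g t = 1" using e[of t] by simp
    moreover have "zp g t \<in> path_image (zp g)" using \<open>t \<in> {0..1}\<close> by (auto simp: path_image_def)
    ultimately show False using z(3) by auto
  qed
qed

lemma Wl_unique:
  assumes g: "g \<in> cpaths"
    and "continuous_on {0..1} q" "\<And>t. t \<in> {0..1} \<Longrightarrow> exp (q t) = zp g t" "q 0 = \<i> * of_real pi" "t \<in> {0..1}"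
  shows "Wl g t = q t"
  unfolding Wl_def using zp_facts[OF cpathsD(1,2)[OF g]] cpathsD[OF g] assms(2-)
  by (intro loglift_unique) auto

lemma Wl_end:
  assumes g: "g \<in> cpaths"
  shows "Wl g 1 = \<i> * of_real pi + logvar (zp g) 0"
  unfolding Wl_def using zp_facts[OF cpathsD(1,2)[OF g]] cpathsD[OF g] by (intro loglift_end) auto

lemma exp_Wl_end: "g \<in> cpaths \<Longrightarrow> exp (Wl g 1) = fst (snd (pathfinish g))"
  using Wl_facts(3)[of g 1] by (simp add: zp_def pathfinish_def)

lemma exp_ell:
  assumes g: "g \<in> cpaths"
  shows "exp (ell k g) = per k - Wl g 1"
proof -
  \<comment> \<open>The lift starts at \<open>\<i> * pi\<close>, the logarithm of the base value
    \<open>-1\<close>; an odd multiple of \<open>pi\<close> is no multiple of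
    \<open>2 * pi\<close>.\<close>
  have "Im (per k) \<noteq> Im (\<i> * of_real pi)"
  proof
    assume "Im (per k) = Im (\<i> * of_real pi)"
    then have "real_of_int (2 * k) = 1" by simp
    then have "2 * k = 1" by linarith
    then show False by presburger
  qed
  then have ne: "per k - \<i> * of_real pi \<noteq> 0" by (metis eq_iff_diff_eq_0)
  have "pathfinish (Wl g) - per k = exp (logvar (Wl g) (per k)) * (pathstart (Wl g) - per k)"
    using winding_number_exp_2pi[OF Wl_facts(1,4)[OF g], of k] by simp
  then show ?thesis
    using ne by (simp add: ell_def exp_add pathstart_def pathfinish_def Wl_facts(2)[OF g] algebra_simps)
qed

lemma exp_lam:
  assumes g: "g \<in> cpaths"
  shows "exp (lam n g) = snd (snd (pathfinish g)) + of_nat n"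
proof -
  have "Re (1 / 2 + of_nat n) > 0" by (simp add: add_pos_nonneg)
  then have ne: "1 / 2 + of_nat n \<noteq> (0 :: complex)" by (metis less_irrefl zero_complex.sel(1))
  note z = zp_facts[OF cpathsD(1,2)[OF g]]
  have "pathfinish (cp g) - - of_nat n = exp (logvar (cp g) (- of_nat n)) * (pathstart (cp g) - - of_nat n)"
    using winding_number_exp_2pi[OF z(4,5), of n] by simp
  then show ?thesis
    unfolding lam_def exp_add exp_Ln[OF ne] zp_ends(4)
    using cpathsD(5)[OF g] by (simp add: pathstart_def[of "cp g"] mult.commute)
qed

lemma cpaths_join:
  assumes "g \<in> cpaths" "path d" "path_image d \<subseteq> Nsharp" "pathstart d = pathfinish g"
  shows "g +++ d \<in> cpaths"
  using assms by (auto simp: cpaths_def path_image_join)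

text \<open>\<open>q\<close> is any continuous logarithm of \<open>z\<close> along \<open>d\<close>
  that starts where the lift along \<open>g\<close> ends. It will be an explicit local branch in
  \<open>Zfun_local\<close> and a lift from the base point in
  \<open>closedlift_join_data\<close>.\<close>

context
  fixes g d q
  assumes g: "g \<in> cpaths" and d: "path d" "path_image d \<subseteq> Nsharp" "pathstart d = pathfinish g"
    and q: "continuous_on {0..1} q" "\<And>t. t \<in> {0..1} \<Longrightarrow> exp (q t) = zp d t" "q 0 = Wl g 1"
begin

lemma Wl_join:
  assumes t: "t \<in> {0..1}"
  shows "Wl (g +++ d) t = (Wl g +++ q) t"
proof (rule Wl_unique[OF cpaths_join[OF g d]])
  have "path (Wl g +++ q)"
    using Wl_facts(1)[OF g] q by (intro path_join_imp) (auto simp: path_def pathstart_def pathfinish_def)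
  then show "continuous_on {0..1} (Wl g +++ q)" by (simp add: path_def)
  show "exp ((Wl g +++ q) t) = zp (g +++ d) t" if "t \<in> {0..1}" for t
    using that Wl_facts(3)[OF g, of "2 * t"] q(2)[of "2 * t - 1"]
    unfolding zp_join by (auto simp: joinpaths_def)
  show "(Wl g +++ q) 0 = \<i> * of_real pi" using Wl_facts(2)[OF g] by (simp add: joinpaths_def)
qed (rule t)

lemma ell_join:
  shows "winding_number (Wl (g +++ d)) (per k) = winding_number (Wl g) (per k) + winding_number q (per k)"
    and "per k \<notin> path_image q" "Wl (g +++ d) 1 = q 1"
proof -
  note z = zp_facts[OF d(1,2)]
  show nq: "per k \<notin> path_image q"
  proof
    assume "per k \<in> path_image q"
    then obtain t where "t \<in> {0..1}" "q t = per k" by (auto simp: path_image_def)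
    then have "zp d t = 1" using q(2)[of t] by simp
    moreover have "zp d t \<in> path_image (zp d)" using \<open>t \<in> {0..1}\<close> by (auto simp: path_image_def)
    ultimately show False using z(3) by auto
  qed
  have "winding_number (Wl (g +++ d)) (per k) = winding_number (Wl g +++ q) (per k)"
    by (rule winding_number_cong) (use Wl_facts(1,4)[OF cpaths_join[OF g d]] Wl_join in auto)
  also have "\<dots> = winding_number (Wl g) (per k) + winding_number q (per k)"
    using Wl_facts(1,4)[OF g] q nq by (intro winding_number_join) (auto simp: path_def pathstart_def pathfinish_def)
  finally show "winding_number (Wl (g +++ d)) (per k) = winding_number (Wl g) (per k) + winding_number q (per k)" .
  show "Wl (g +++ d) 1 = q 1" using Wl_join[of 1] by (simp add: joinpaths_def)
qed

end

lemma lam_join: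
  assumes g: "g \<in> cpaths" and d: "path d" "path_image d \<subseteq> Nsharp" "pathstart d = pathfinish g"
  shows "lam n (g +++ d) = lam n g + logvar (cp d) (- of_nat n)"
proof -
  have "winding_number (cp g +++ cp d) (- of_nat n) = winding_number (cp g) (- of_nat n) + winding_number (cp d) (- of_nat n)"
    using zp_facts[OF cpathsD(1,2)[OF g]] zp_facts[OF d(1,2)] d(3) by (intro winding_number_join) (auto simp: zp_ends)
  then show ?thesis by (simp add: lam_def algebra_simps)
qed

lemma homotopic_data:
  assumes hom: "homotopic_paths Nsharp g h"
  shows "homotopic_paths (- {0, 1}) (zp g) (zp h)" "winding_number (zp g) 0 = winding_number (zp h) 0"
    and "winding_number (cp g) (- of_nat n) = winding_number (cp h) (- of_nat n)"
proof -
  have "homotopic_paths (- {0, 1}) ((fst \<circ> snd) \<circ> g) ((fst \<circ> snd) \<circ> h)"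
    by (rule homotopic_paths_continuous_image[OF hom]) (auto intro!: continuous_intros simp: Nsharp_def o_def)
  then show 1: "homotopic_paths (- {0, 1}) (zp g) (zp h)" by (simp add: zp_def o_def)
  then have "homotopic_paths (- {0}) (zp g) (zp h)" by (rule homotopic_paths_subset) auto
  then show "winding_number (zp g) 0 = winding_number (zp h) 0" by (rule winding_number_homotopic_paths)
  have "homotopic_paths (- {- of_nat n}) ((snd \<circ> snd) \<circ> g) ((snd \<circ> snd) \<circ> h)"
    by (rule homotopic_paths_continuous_image[OF hom]) (auto intro!: continuous_intros simp: Nsharp_def o_def)
  then have "homotopic_paths (- {- of_nat n}) (cp g) (cp h)" by (simp add: cp_def o_def)
  then show "winding_number (cp g) (- of_nat n) = winding_number (cp h) (- of_nat n)"
    by (rule winding_number_homotopic_paths)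
qed

lemma homotopic_lift_data:
  assumes hom: "homotopic_paths Nsharp g h" and g: "g \<in> cpaths" and h: "h \<in> cpaths"
  shows "Wl g 1 = Wl h 1" "winding_number (Wl g) (per k) = winding_number (Wl h) (per k)"
    "lam n g = lam n h"
proof -
  show "Wl g 1 = Wl h 1" using homotopic_data(2)[OF hom] by (simp add: Wl_end g h)
  have "homotopic_paths (- range per) (Wl g) (Wl h)"
    unfolding Wl_def by (rule loglift_homotopic[OF homotopic_data(1)[OF hom] cpathsD(4)[OF g]])
  then have "homotopic_paths (- {per k}) (Wl g) (Wl h)" by (rule homotopic_paths_subset) auto
  then show "winding_number (Wl g) (per k) = winding_number (Wl h) (per k)"
    by (rule winding_number_homotopic_paths)
  show "lam n g = lam n h" using homotopic_data(3)[OF hom] by (simp add: lam_def)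
qed

section \<open>Loops in the commutator subgroups\<close>

text \<open>The second conjunct says that the lift \<open>Wl \<tau>\<close> is again a loop, so that its winding numbers around
  the points \<open>2 \<pi> \<i> k\<close> are additive.\<close>
definition closedlift :: "(real \<Rightarrow> pt) \<Rightarrow> bool" where
  "closedlift \<tau> \<longleftrightarrow> \<tau> \<in> loops Nsharp x0' \<and> winding_number (zp \<tau>) 0 = 0 \<and>
     (\<forall>n::nat. winding_number (cp \<tau>) (- of_nat n) = 0)"

lemma loops_cpaths: "p \<in> loops Nsharp x0' \<Longrightarrow> p \<in> cpaths"
  by (auto simp: loops_def cpaths_def)

lemma half_neq_neg_nat: "1 / 2 \<noteq> - (of_nat n :: complex)"
proof
  assume "1 / 2 = - (of_nat n :: complex)"
  then have "Re (1 / 2) = Re (- (of_nat n :: complex))" by (rule arg_cong)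
  then show False by simp
qed

lemma x0'_Nsharp: "x0' \<in> Nsharp"
  using half_neq_neg_nat by (auto simp: Nsharp_def x0'_def)

lemma loops_join: "p \<in> loops Nsharp x0' \<Longrightarrow> q \<in> loops Nsharp x0' \<Longrightarrow> p +++ q \<in> loops Nsharp x0'"
  by (auto simp: loops_def path_image_join)

lemma loops_reversepath: "p \<in> loops Nsharp x0' \<Longrightarrow> reversepath p \<in> loops Nsharp x0'"
  by (auto simp: loops_def)

lemma loops_winding:
  assumes "p \<in> loops Nsharp x0'" "q \<in> loops Nsharp x0'"
  shows "winding_number (zp (p +++ q)) 0 = winding_number (zp p) 0 + winding_number (zp q) 0"
    "winding_number (cp (p +++ q)) (- of_nat n) = winding_number (cp p) (- of_nat n) + winding_number (cp q) (- of_nat n)"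
    "winding_number (zp (reversepath p)) 0 = - winding_number (zp p) 0"
    "winding_number (cp (reversepath p)) (- of_nat n) = - winding_number (cp p) (- of_nat n)"
proof -
  have p: "path p" "path_image p \<subseteq> Nsharp" "pathfinish p = x0'" and q: "path q" "path_image q \<subseteq> Nsharp" "pathstart q = x0'"
    using assms by (auto simp: loops_def)
  note zp_facts[OF p(1,2)] zp_facts[OF q(1,2)]
  then show "winding_number (zp (p +++ q)) 0 = winding_number (zp p) 0 + winding_number (zp q) 0"
    "winding_number (cp (p +++ q)) (- of_nat n) = winding_number (cp p) (- of_nat n) + winding_number (cp q) (- of_nat n)"
    "winding_number (zp (reversepath p)) 0 = - winding_number (zp p) 0"
    "winding_number (cp (reversepath p)) (- of_nat n) = - winding_number (cp p) (- of_nat n)"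
    using p(3) q(3) by (simp_all add: winding_number_join winding_number_reversepath zp_ends)
qed

lemma closedlift_join: "closedlift p \<Longrightarrow> closedlift q \<Longrightarrow> closedlift (p +++ q)"
  by (auto simp: closedlift_def loops_join loops_winding simp del: zp_join cp_join)

lemma closedlift_reversepath: "closedlift p \<Longrightarrow> closedlift (reversepath p)"
  by (auto simp: closedlift_def loops_reversepath loops_winding simp del: zp_reversepath cp_reversepath)

lemma closedlift_unit: "closedlift (linepath x0' x0')"
proof -
  have "linepath x0' x0' \<in> loops Nsharp x0'" using x0'_Nsharp by (auto simp: loops_def)
  moreover have "zp (linepath x0' x0') = linepath (- 1) (- 1)" "cp (linepath x0' x0') = linepath (1 / 2) (1 / 2)"
    by (auto simp: zp_def cp_def linepath_refl x0'_def)
  moreover have "1 / 2 \<noteq> - (of_nat n :: complex)" for n by (rule half_neq_neg_nat)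
  ultimately show ?thesis by (simp add: closedlift_def winding_number_trivial)
qed

lemma closedlift_hom:
  assumes p: "closedlift p" and hom: "homotopic_paths Nsharp p q"
  shows "closedlift q"
proof -
  have "q \<in> loops Nsharp x0'"
    using p homotopic_paths_imp_path[OF hom] homotopic_paths_imp_subset[OF hom]
      homotopic_paths_imp_pathstart[OF hom] homotopic_paths_imp_pathfinish[OF hom]
    by (auto simp: closedlift_def loops_def)
  then show ?thesis using p homotopic_data[OF hom] by (simp add: closedlift_def)
qed

text \<open>Vanishing of the winding numbers is stable under all rules of \<open>loopgen\<close>;
  for the generators the contributions of \<open>a\<close> and \<open>b\<close> cancel against those
  of their reverses.\<close>

lemma derived1_closedlift:
  assumes "\<tau> \<in> derived1 Nsharp x0'"
  shows "closedlift \<tau>"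
  using assms unfolding derived1_def
proof (induction rule: loopgen.induct)
  case (base p)
  then obtain a b where ab: "a \<in> loops Nsharp x0'" "b \<in> loops Nsharp x0'"
    "p = a +++ (b +++ (reversepath a +++ reversepath b))" by (auto simp: commutators_def)
  note l = ab(1,2) loops_reversepath[OF ab(1)] loops_reversepath[OF ab(2)]
  note l2 = loops_join[OF l(3,4)]
  note l3 = loops_join[OF l(2) l2]
  show ?case
    using loops_join[OF l(1) l3]
    by (simp add: closedlift_def ab(3) loops_winding l l2 l3 del: zp_join cp_join zp_reversepath cp_reversepath)
qed (blast intro: closedlift_unit closedlift_join closedlift_reversepath closedlift_hom)+

lemma closedlift_cpaths: "closedlift p \<Longrightarrow> p \<in> cpaths"
  by (simp add: closedlift_def loops_cpaths)

text \<open>The lift along \<open>p\<close> returns to \<open>\<i> * pi\<close>, so along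
  \<open>g\<close> it continues as \<open>Wl g\<close> itself and not as a translate. Only for this
  reason do the winding numbers around a fixed \<open>per k\<close> add up.\<close>

lemma closedlift_join_data:
  assumes p: "closedlift p" and g: "g \<in> cpaths"
  shows "p +++ g \<in> cpaths" "Wl (p +++ g) 1 = Wl g 1"
    "winding_number (Wl (p +++ g)) (per k) = winding_number (Wl p) (per k) + winding_number (Wl g) (per k)"
    "lam n (p +++ g) = lam n g"
proof -
  note pc = closedlift_cpaths[OF p]
  have fin: "pathstart g = pathfinish p" using p cpathsD(3)[OF g] by (simp add: closedlift_def loops_def)
  note d = cpathsD(1,2)[OF g] fin
  have q: "continuous_on {0..1} (Wl g)" "\<And>t. t \<in> {0..1} \<Longrightarrow> exp (Wl g t) = zp g t" "Wl g 0 = Wl p 1"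
    using Wl_facts[OF g] Wl_end[OF pc] p by (auto simp: path_def closedlift_def)
  show "p +++ g \<in> cpaths" by (rule cpaths_join[OF pc d])
  show "Wl (p +++ g) 1 = Wl g 1" by (rule ell_join(3)[OF pc d q])
  show "winding_number (Wl (p +++ g)) (per k) = winding_number (Wl p) (per k) + winding_number (Wl g) (per k)"
    by (rule ell_join(1)[OF pc d q])
  show "lam n (p +++ g) = lam n g"
    using lam_join[OF pc d, of n] p by (simp add: lam_def closedlift_def)
qed

text \<open>The reversed lift starts at \<open>\<i> * pi\<close> because the lift is closed, so by
  uniqueness it is the lift of the reversed loop.\<close>

lemma closedlift_reversepath_data:
  assumes p: "closedlift p"
  shows "winding_number (Wl (reversepath p)) (per k) = - winding_number (Wl p) (per k)"
proof -
  note pc = closedlift_cpaths[OF p] and rc = closedlift_cpaths[OF closedlift_reversepath[OF p]]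
  have "Wl (reversepath p) t = reversepath (Wl p) t" if "t \<in> {0..1}" for t
  proof (rule Wl_unique[OF rc])
    show "continuous_on {0..1} (reversepath (Wl p))"
      using Wl_facts(1)[OF pc] by (simp flip: path_def)
    show "exp (reversepath (Wl p) t) = zp (reversepath p) t" if "t \<in> {0..1}" for t
      using Wl_facts(3)[OF pc, of "1 - t"] that unfolding zp_reversepath by (simp add: reversepath_def)
    show "reversepath (Wl p) 0 = \<i> * of_real pi"
      using Wl_end[OF pc] p by (simp add: reversepath_def closedlift_def)
  qed (rule that)
  then have "winding_number (Wl (reversepath p)) (per k) = winding_number (reversepath (Wl p)) (per k)"
    using Wl_facts(1,4)[OF rc] by (intro winding_number_cong) auto
  then show ?thesis using Wl_facts(1,4)[OF pc] by (simp add: winding_number_reversepath)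
qed

text \<open>\<open>closedlift\<close> is carried through the induction because additivity of the
  winding numbers of lifts depends on it.\<close>

lemma derived2_lift_data:
  assumes "\<tau> \<in> derived2 Nsharp x0'"
  shows "closedlift \<tau> \<and> (\<forall>k. winding_number (Wl \<tau>) (per k) = 0)"
  using assms unfolding derived2_def
proof (induction rule: loopgen.induct)
  case (base p)
  then obtain a b where ab: "closedlift a" "closedlift b" "p = a +++ (b +++ (reversepath a +++ reversepath b))"
    by (auto simp: commutators_def intro: derived1_closedlift)
  note l = ab(1,2) closedlift_reversepath[OF ab(1)] closedlift_reversepath[OF ab(2)]
  note l2 = closedlift_join[OF l(3,4)]
  note l3 = closedlift_join[OF l(2) l2]
  show ?case
    using closedlift_join[OF l(1) l3]
    by (simp add: ab(3) closedlift_join_data(3) closedlift_cpaths closedlift_reversepath_data l l2 l3)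
next
  case unit
  note u = closedlift_cpaths[OF closedlift_unit]
  have "zp (linepath x0' x0') t = - 1" for t by (simp add: zp_def linepath_refl x0'_def)
  then have W: "Wl (linepath x0' x0') t = linepath (\<i> * of_real pi) (\<i> * of_real pi) t" if "t \<in> {0..1}" for t
    by (intro Wl_unique[OF u]) (use that in \<open>auto simp: linepath_refl\<close>)
  have "winding_number (Wl (linepath x0' x0')) (per k) = 0" for k
  proof -
    have "winding_number (Wl (linepath x0' x0')) (per k) = winding_number (linepath (\<i> * of_real pi) (\<i> * of_real pi)) (per k)"
      using Wl_facts(1,4)[OF u] W by (intro winding_number_cong) auto
    moreover have "per k \<noteq> \<i> * of_real pi"
      using Wl_facts(2)[OF u] Wl_facts(4)[OF u, of k] by (force simp: path_image_def)
    ultimately show ?thesis by (simp add: winding_number_trivial)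
  qed
  then show ?case using closedlift_unit by blast
next
  case (join p q)
  then show ?case by (simp add: closedlift_join closedlift_join_data(3) closedlift_cpaths)
next
  case (rev p)
  then show ?case by (simp add: closedlift_reversepath closedlift_reversepath_data)
next
  case (hom p q)
  have "closedlift q" using hom by (auto intro: closedlift_hom)
  then show ?case
    using homotopic_lift_data(2)[OF hom(2)] hom by (metis closedlift_cpaths)
qed

section \<open>The continuation of the Lerch transcendent\<close>

text \<open>Bounding the whole path forces \<open>ell k g\<close> for \<open>k\<close> outside
  \<open>ibox K\<close>, and \<open>lam n g\<close> for \<open>n \<ge> N\<close>, to be principal
  logarithms at the end.\<close>

definition valid_bounds :: "nat \<Rightarrow> nat \<Rightarrow> (real \<Rightarrow> pt) \<Rightarrow> bool" where
  "valid_bounds K N g \<longleftrightarrow> (\<forall>t\<in>{0..1}. Wl g t \<in> strip K \<and> Re (cp g t) > - real N)"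

text \<open>The first \<open>N\<close> terms of the series plus the rest. The rest is
  \<open>z\<close> to the power \<open>N\<close> times \<open>exp (- (c + N) * log z)\<close> times
  the continued \<open>Eser\<close> at \<open>c + N\<close>; the powers of \<open>z\<close> cancel
  to \<open>exp (- c * Wl g 1)\<close>, and
  \<open>exp (per k * (c + N)) = exp (per k * c)\<close>.\<close>

definition Zval :: "nat \<Rightarrow> nat \<Rightarrow> (real \<Rightarrow> pt) \<Rightarrow> complex" where
  "Zval K N g = (case pathfinish g of (s, z, c) \<Rightarrow>
     (\<Sum>n<N. exp (of_nat n * Wl g 1 - s * lam n g)) +
     exp (- c * Wl g 1) * ((\<Sum>k\<in>ibox K. exp (per k * c) * sing s (ell k g)) + Rreg K (s, Wl g 1, c + of_nat N)))"

text \<open>The choice is harmless: by \<open>Zfun_eq\<close> all admissible cut-offs give the same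
  value.\<close>

definition Zfun :: "(real \<Rightarrow> pt) \<Rightarrow> complex" where
  "Zfun g = (SOME v. \<exists>K N. valid_bounds K N g \<and> v = Zval K N g)"

lemma valid_bounds_mono:
  assumes "valid_bounds K N g" "K \<le> K'" "N \<le> N'"
  shows "valid_bounds K' N' g"
  unfolding valid_bounds_def
proof
  fix t :: real assume "t \<in> {0..1}"
  then have "Wl g t \<in> strip K" "Re (cp g t) > - real N" using assms(1) by (auto simp: valid_bounds_def)
  then show "Wl g t \<in> strip K' \<and> Re (cp g t) > - real N'" using strip_mono[OF assms(2)] assms(3) by auto
qed

lemma valid_bounds_end:
  assumes "valid_bounds K N g" "pathfinish g = (s, z, c)"
  shows "Wl g 1 \<in> strip K" "Re c > - real N"
proof -
  have "cp g 1 = c" using assms(2) by (simp add: cp_def pathfinish_def)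
  then show "Wl g 1 \<in> strip K" "Re c > - real N" using assms(1) by (force simp: valid_bounds_def)+
qed

lemma valid_bounds_exist:
  assumes g: "g \<in> cpaths"
  obtains K N where "valid_bounds K N g"
proof -
  have "bounded (path_image (Wl g))" "bounded (path_image (cp g))"
    using Wl_facts(1)[OF g] zp_facts(4)[OF cpathsD(1,2)[OF g]] by (auto intro: bounded_path_image)
  then obtain A B where A: "\<And>t. t \<in> {0..1} \<Longrightarrow> norm (Wl g t) \<le> A" and B: "\<And>t. t \<in> {0..1} \<Longrightarrow> norm (cp g t) \<le> B"
    unfolding bounded_iff path_image_def by blast
  obtain K :: nat where K: "A < real K" using reals_Archimedean2 by blast
  obtain N :: nat where N: "B < real N" using reals_Archimedean2 by blast
  show ?thesis
  proof (rule that[of K N], unfold valid_bounds_def, intro ballI conjI)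
    fix t :: real assume t: "t \<in> {0..1}"
    have "\<bar>Im (Wl g t)\<bar> < real K + 1" using abs_Im_le_cmod[of "Wl g t"] A[OF t] K by linarith
    also have "1 * (real K + 1) \<le> 2 * pi * (real K + 1)" using pi_gt3 by (intro mult_right_mono) auto
    finally show "Wl g t \<in> strip K" by (simp add: strip_def)
    show "- real N < Re (cp g t)" using abs_Re_le_cmod[of "cp g t"] B[OF t] N by linarith
  qed
qed

text \<open>If \<open>per k - Wl g t\<close> never meets the cut, the principal logarithm is
  continuous along the path, and it has the same initial value as \<open>ell\<close>.\<close>

lemma ell_principal:
  assumes g: "g \<in> cpaths" and slit: "\<And>t. t \<in> {0..1} \<Longrightarrow> per k - Wl g t \<notin> \<real>\<^sub>\<le>\<^sub>0"
  shows "ell k g = Ln (per k - Wl g 1)"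
proof -
  note W = Wl_facts[OF g]
  have "logvar (Wl g) (per k) = Ln (per k - Wl g 1) - Ln (per k - Wl g 0)"
  proof (rule winding_number_eq_log_diff_neg[OF W(1,4)])
    show "continuous_on {0..1} (\<lambda>t. Ln (per k - Wl g t))"
      using W(1) slit by (intro continuous_intros) (auto simp: path_def)
    show "exp (Ln (per k - Wl g t)) = per k - Wl g t" if "t \<in> {0..1}" for t
      using slit[OF that] by (intro exp_Ln) auto
  qed
  then show ?thesis by (simp add: ell_def W(2))
qed

lemma lam_principal:
  assumes g: "g \<in> cpaths" and pos: "\<And>t. t \<in> {0..1} \<Longrightarrow> Re (cp g t) > - real n"
  shows "lam n g = Ln (snd (snd (pathfinish g)) + of_nat n)"
proof -
  note z = zp_facts[OF cpathsD(1,2)[OF g]]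
  have pos': "Re (cp g t + of_nat n) > 0" if "t \<in> {0..1}" for t using pos[OF that] by simp
  have "logvar (cp g) (- of_nat n) = Ln (cp g 1 + of_nat n) - Ln (cp g 0 + of_nat n)"
  proof (rule winding_number_eq_log_diff[OF z(4,5)])
    show "continuous_on {0..1} (\<lambda>t. Ln (cp g t + of_nat n))"
      using z(4) pos' by (intro continuous_intros) (auto simp: path_def complex_nonpos_Reals_iff not_le)
    show "exp (Ln (cp g t + of_nat n)) = cp g t - - of_nat n" if "t \<in> {0..1}" for t
    proof -
      have "cp g t + of_nat n \<noteq> 0" using pos'[OF that] by (metis less_irrefl zero_complex.sel(1))
      then show ?thesis by simp
    qed
  qed
  moreover have "cp g 1 = snd (snd (pathfinish g))" by (simp add: cp_def pathfinish_def)
  ultimately show ?thesis by (simp add: lam_def cpathsD(5)[OF g])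
qed

lemma exp_per_mult_add_nat: "exp (per k * (c + of_nat n)) = exp (per k * c)"
proof -
  have "exp (per k * of_nat n) = exp (per (k * int n))" by (simp add: per_def mult.assoc)
  then show ?thesis by (simp add: distrib_left exp_add)
qed

text \<open>The terms released by \<open>Rreg_change_K\<close> carry principal logarithms, which are
  the continued ones by the bound on the whole path.\<close>

lemma Zval_change_K:
  assumes g: "g \<in> cpaths" and v: "valid_bounds K N g" and K: "K \<le> K'"
  shows "Zval K N g = Zval K' N g"
proof -
  obtain s z c where fin: "pathfinish g = (s, z, c)" by (cases "pathfinish g")
  have W: "Wl g 1 \<in> strip K" and c: "Re (c + of_nat N) > 0"
    using valid_bounds_end[OF v fin] by auto
  have "ell k g = Ln (per k - Wl g 1)" if "k \<in> ibox K' - ibox K" for k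
    using v that by (intro ell_principal[OF g] per_minus_strip(2)[of _ K]) (auto simp: valid_bounds_def)
  then have "Rreg K (s, Wl g 1, c + of_nat N) = Rreg K' (s, Wl g 1, c + of_nat N) +
      (\<Sum>k\<in>ibox K' - ibox K. exp (per k * c) * sing s (ell k g))"
    unfolding Rreg_change_K[OF W c K] exp_per_mult_add_nat by simp
  moreover have "ibox K \<subseteq> ibox K'" using K by (auto simp: ibox_def)
  then have "(\<Sum>k\<in>ibox K'. exp (per k * c) * sing s (ell k g)) =
      (\<Sum>k\<in>ibox K' - ibox K. exp (per k * c) * sing s (ell k g)) + (\<Sum>k\<in>ibox K. exp (per k * c) * sing s (ell k g))"
    by (rule sum.subset_diff) simp
  ultimately show ?thesis by (simp add: Zval_def fin)
qed

text \<open>Likewise \<open>Rreg_shift\<close> releases a principal power of \<open>c + N\<close>,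
  and \<open>lam N g\<close> is principal on a path with \<open>Re c > - N\<close>.\<close>

lemma Zval_Suc_N:
  assumes g: "g \<in> cpaths" and v: "valid_bounds K N g"
  shows "Zval K N g = Zval K (Suc N) g"
proof -
  obtain s z c where fin: "pathfinish g = (s, z, c)" by (cases "pathfinish g")
  have W: "Wl g 1 \<in> strip K" and c: "Re (c + of_nat N) > 0"
    using valid_bounds_end[OF v fin] by auto
  have "lam N g = Ln (c + of_nat N)"
    using lam_principal[OF g, of N] v fin by (auto simp: valid_bounds_def)
  moreover have "c + of_nat N \<noteq> 0" using c by (metis less_irrefl zero_complex.sel(1))
  ultimately have "(c + of_nat N) powr (- s) = exp (- s * lam N g)" by (simp add: powr_def)
  then have "exp (- c * Wl g 1) * (exp ((c + of_nat N) * Wl g 1) * (c + of_nat N) powr (- s)) =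
      exp (of_nat N * Wl g 1 - s * lam N g)"
    by (simp add: algebra_simps flip: exp_add)
  then show ?thesis
    using Rreg_shift[OF W c, of s] by (simp add: Zval_def fin distrib_left add_ac)
qed

lemma Zval_change_N:
  assumes g: "g \<in> cpaths" and v: "valid_bounds K N g" and N: "N \<le> N'"
  shows "Zval K N g = Zval K N' g"
  using N
proof (induction N' rule: dec_induct)
  case (step n)
  then show ?case using Zval_Suc_N[OF g valid_bounds_mono[OF v, of K n]] by simp
qed simp

lemma Zfun_eq:
  assumes g: "g \<in> cpaths" and v: "valid_bounds K N g"
  shows "Zfun g = Zval K N g"
proof -
  have "\<exists>K N. valid_bounds K N g \<and> Zfun g = Zval K N g"
    unfolding Zfun_def by (rule someI[of _ "Zval K N g"]) (use v in blast)
  then obtain K' N' where v': "valid_bounds K' N' g" "Zfun g = Zval K' N' g" by blast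
  have "Zval K N g = Zval (max K K') N g" by (rule Zval_change_K[OF g v]) simp
  also have "\<dots> = Zval (max K K') (max N N') g"
    by (rule Zval_change_N[OF g valid_bounds_mono[OF v]]) auto
  also have "\<dots> = Zval (max K K') N' g"
    by (rule Zval_change_N[OF g valid_bounds_mono[OF v'(1)], symmetric]) auto
  also have "\<dots> = Zval K' N' g" by (rule Zval_change_K[OF g v'(1), symmetric]) simp
  finally show ?thesis using v'(2) by simp
qed

text \<open>Used twice in the end: for homotopic paths, and for \<open>\<tau> +++ g\<close> against
  \<open>g\<close>. Taking maxima of the cut-offs makes the two formulas literally
  comparable.\<close>

lemma Zfun_cong:
  assumes g: "g \<in> cpaths" and h: "h \<in> cpaths"
    and "pathfinish g = pathfinish h" "Wl g 1 = Wl h 1"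
    and "\<And>k. winding_number (Wl g) (per k) = winding_number (Wl h) (per k)" "\<And>n. lam n g = lam n h"
  shows "Zfun g = Zfun h"
proof -
  obtain K N where v: "valid_bounds K N g" by (rule valid_bounds_exist[OF g])
  obtain K' N' where v': "valid_bounds K' N' h" by (rule valid_bounds_exist[OF h])
  have "Zfun g = Zval (max K K') (max N N') g"
    by (rule Zfun_eq[OF g valid_bounds_mono[OF v]]) auto
  also have "\<dots> = Zval (max K K') (max N N') h"
    using assms(3-6) by (simp add: Zval_def ell_def)
  also have "\<dots> = Zfun h"
    by (rule Zfun_eq[OF h valid_bounds_mono[OF v'], symmetric]) auto
  finally show ?thesis .
qed

section \<open>Holomorphy of the continuation and agreement with the series\<close>

lemma open_Nsharp: "open Nsharp"
proof -
  have "Nsharp = UNIV \<times> (- {0, 1}) \<times> (- \<int>\<^sub>\<le>\<^sub>0)"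
    by (auto simp: Nsharp_def elim!: nonpos_Ints_cases')
  moreover have "open (UNIV \<times> (- {0, 1}) \<times> (- \<int>\<^sub>\<le>\<^sub>0) :: pt set)"
    by (intro open_Times open_Compl) auto
  ultimately show ?thesis by simp
qed

lemma sep_holo_compose:
  assumes F: "sep_holo F U" and b: "b holomorphic_on B" "open B" and d: "d holomorphic_on D" "open D"
    and V: "open V" "\<And>s z c. (s, z, c) \<in> V \<Longrightarrow> z \<in> B \<and> c \<in> D \<and> (s, b z, d c) \<in> U"
  shows "sep_holo (\<lambda>(s, z, c). F (s, b z, d c)) V"
proof (rule sep_holoI[OF V(1)])
  have "continuous_on V (\<lambda>x. b (fst (snd x)))" "continuous_on V (\<lambda>x. d (snd (snd x)))"
    using V(2) by (auto intro!: continuous_on_compose2[OF holomorphic_on_imp_continuous_on[OF b(1)]]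
        continuous_on_compose2[OF holomorphic_on_imp_continuous_on[OF d(1)]] continuous_intros)
  then have "continuous_on V (\<lambda>x. F (fst x, b (fst (snd x)), d (snd (snd x))))"
    using V(2) by (intro continuous_on_compose2[OF sep_holoD(2)[OF F]]) (auto intro!: continuous_intros)
  then show "continuous_on V (\<lambda>(s, z, c). F (s, b z, d c))" by (simp add: case_prod_unfold)
  fix s z c assume x: "(s, z, c) \<in> V"
  note U = V(2)[OF x]
  have bz: "b field_differentiable at z" and dc: "d field_differentiable at c"
    using U b d by (auto intro: holomorphic_on_imp_differentiable_at)
  show "(\<lambda>x. case (x, z, c) of (s, z, c) \<Rightarrow> F (s, b z, d c)) field_differentiable at s"
    using sep_holoD(3)[OF F] U by simp
  show "(\<lambda>x. case (s, x, c) of (s, z, c) \<Rightarrow> F (s, b z, d c)) field_differentiable at z"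
    using field_differentiable_compose[OF bz, of "\<lambda>x. F (s, x, d c)"] sep_holoD(4)[OF F] U by (simp add: o_def)
  show "(\<lambda>x. case (s, z, x) of (s, z, c) \<Rightarrow> F (s, b z, d c)) field_differentiable at c"
    using field_differentiable_compose[OF dc, of "\<lambda>x. F (s, b z, x)"] sep_holoD(5)[OF F] U by (simp add: o_def)
qed

lemma sep_holo_exp_forms:
  shows "sep_holo (\<lambda>(s, w, l). exp (a * w - s * l)) UNIV"
    and "sep_holo (\<lambda>(s, w, c). exp (0 - c * w)) UNIV"
    and "sep_holo (\<lambda>(s, w, c). exp (a * c)) UNIV"
  unfolding case_prod_unfold
  by (intro sep_holo_exp sep_holo_diff sep_holo_mult sep_holo_atoms open_UNIV)+

text \<open>Near the end of \<open>g\<close> each continued logarithm is its value there plus the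
  principal \<open>Ln\<close> of a ratio equal to 1 at the end point. On a ball where no such ratio
  meets the cut, these are holomorphic functions of the point alone, whichever path \<open>d\<close>
  in the ball leads to it.\<close>

lemma Zfun_local:
  assumes g: "g \<in> cpaths"
  shows "\<exists>r>0. \<exists>f. ball (pathfinish g) r \<subseteq> Nsharp \<and> holo3 f (ball (pathfinish g) r) \<and>
    (\<forall>d. path d \<and> path_image d \<subseteq> ball (pathfinish g) r \<and> pathstart d = pathfinish g
       \<longrightarrow> Zfun (g +++ d) = f (pathfinish d))"
proof -
  obtain K N where v: "valid_bounds K N g" by (rule valid_bounds_exist[OF g])
  obtain s0 z0 c0 where fin: "pathfinish g = (s0, z0, c0)" by (cases "pathfinish g")
  define w0 where "w0 = Wl g 1"
  have finN: "(s0, z0, c0) \<in> Nsharp"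
    using cpathsD(2)[OF g] pathfinish_in_path_image[of g] fin by auto
  have z0: "z0 \<noteq> 0" "exp w0 = z0" using exp_Wl_end[OF g] fin finN by (auto simp: w0_def Nsharp_def)
  have w0: "w0 \<in> strip K" and c0: "Re c0 > - real N"
    using valid_bounds_end[OF v fin] by (auto simp: w0_def)
  have ne_k: "per k - w0 \<noteq> 0" for k using exp_ell[OF g, of k] by (auto simp: w0_def)
  have ne_n: "c0 + of_nat n \<noteq> 0" for n using exp_lam[OF g, of n] fin by auto
  define wl where "wl = (\<lambda>z. w0 + Ln (z / z0))"
  define ll where "ll = (\<lambda>k z. ell k g + Ln ((per k - wl z) / (per k - w0)))"
  define lm where "lm = (\<lambda>n c. lam n g + Ln ((c + of_nat n) / (c0 + of_nat n)))"
  define B0 where "B0 = {z. z / z0 \<notin> \<real>\<^sub>\<le>\<^sub>0}"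
  define B where "B = B0 \<inter> wl -` (strip K \<inter> (\<Inter>k\<in>ibox K. {w. (per k - w) / (per k - w0) \<notin> \<real>\<^sub>\<le>\<^sub>0}))"
  define D where "D = {c. Re c > - real N} \<inter> (\<Inter>n<N. {c. (c + of_nat n) / (c0 + of_nat n) \<notin> \<real>\<^sub>\<le>\<^sub>0})"
  have open_slit: "open {x. f x \<notin> \<real>\<^sub>\<le>\<^sub>0}" if "continuous_on UNIV f" for f :: "complex \<Rightarrow> complex"
    using open_vimage[OF open_Compl[OF closed_nonpos_Reals_complex] that] by (simp add: vimage_def)
  have B0: "open B0" unfolding B0_def using z0 by (intro open_slit continuous_intros) auto
  have wl_hol: "wl holomorphic_on B0"
    unfolding wl_def by (intro holomorphic_intros) (auto simp: B0_def z0)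
  have "open (strip K \<inter> (\<Inter>k\<in>ibox K. {w. (per k - w) / (per k - w0) \<notin> \<real>\<^sub>\<le>\<^sub>0}))"
    using ne_k by (intro open_Int open_strip open_INT finite_ibox ballI open_slit continuous_intros) auto
  then have B: "open B"
    unfolding B_def by (rule continuous_open_preimage[OF holomorphic_on_imp_continuous_on[OF wl_hol] B0])
  have D: "open D"
    unfolding D_def using ne_n
    by (intro open_Int open_halfspace_Re_gt open_INT finite_lessThan ballI open_slit continuous_intros) auto
  have z0B: "z0 \<in> B" using z0 w0 ne_k by (auto simp: B_def B0_def wl_def)
  have c0D: "c0 \<in> D" using c0 ne_n by (auto simp: D_def)
  have "open (Nsharp \<inter> UNIV \<times> B \<times> D)" by (intro open_Int open_Nsharp open_Times B D) auto
  then obtain r where r: "r > 0" "ball (s0, z0, c0) r \<subseteq> Nsharp \<inter> UNIV \<times> B \<times> D"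
    using finN z0B c0D unfolding open_contains_ball by blast
  define V where "V = ball (s0, z0, c0) r"
  have V: "open V" "\<And>s z c. (s, z, c) \<in> V \<Longrightarrow> z \<in> B \<and> c \<in> D"
    using r(2) by (auto simp: V_def)
  define f where "f = (\<lambda>(s, z, c). (\<Sum>n<N. exp (of_nat n * wl z - s * lm n c)) +
     exp (- c * wl z) * ((\<Sum>k\<in>ibox K. exp (per k * c) * sing s (ll k z)) + Rreg K (s, wl z, c + of_nat N)))"
  have wlB: "wl holomorphic_on B" using wl_hol by (rule holomorphic_on_subset) (auto simp: B_def)
  have llB: "ll k holomorphic_on B" if "k \<in> ibox K" for k
    unfolding ll_def by (intro holomorphic_intros wlB) (use that ne_k in \<open>auto simp: B_def\<close>)
  have lmD: "lm n holomorphic_on D" if "n < N" for n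
    unfolding lm_def by (intro holomorphic_intros) (use that ne_n in \<open>auto simp: D_def\<close>)
  have "sep_holo (\<lambda>x. (\<Sum>n<N. (case x of (s, z, c) \<Rightarrow> exp (of_nat n * wl z - s * lm n c))) +
     (case x of (s, z, c) \<Rightarrow> exp (- c * wl z)) * ((\<Sum>k\<in>ibox K. (case x of (s, z, c) \<Rightarrow> exp (per k * c)) *
        (case x of (s, z, c) \<Rightarrow> sing s (ll k z))) + (case x of (s, z, c) \<Rightarrow> Rreg K (s, wl z, c + of_nat N)))) V"
  proof (intro sep_holo_add sep_holo_mult sep_holo_sum V(1))
    fix n assume n: "n \<in> {..<N}"
    show "sep_holo (\<lambda>(s, z, c). exp (of_nat n * wl z - s * lm n c)) V"
      using sep_holo_compose[OF sep_holo_exp_forms(1)[of "of_nat n"] wlB B lmD D V(1)] V(2) n by auto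
  next
    show "sep_holo (\<lambda>(s, z, c). exp (- c * wl z)) V"
      using sep_holo_compose[OF sep_holo_exp_forms(2) wlB B holomorphic_on_ident[of UNIV] open_UNIV V(1)] V(2) by auto
    show "sep_holo (\<lambda>(s, z, c). exp (per k * c)) V" for k
      by (rule sep_holo_subset[OF sep_holo_exp_forms(3) V(1)]) simp
    show "sep_holo (\<lambda>(s, z, c). sing s (ll k z)) V" if "k \<in> ibox K" for k
      using sep_holo_compose[OF sep_holo_sing llB[OF that] B holomorphic_on_ident[of UNIV] open_UNIV V(1)] V(2) by auto
    have "(\<lambda>c. c + of_nat N) holomorphic_on D" by (intro holomorphic_intros)
    moreover have "z \<in> B \<and> c \<in> D \<and> (s, wl z, c + of_nat N) \<in> Udom K" if "(s, z, c) \<in> V" for s z c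
      using V(2)[OF that] by (auto simp: Udom_def B_def D_def)
    ultimately show "sep_holo (\<lambda>(s, z, c). Rreg K (s, wl z, c + of_nat N)) V"
      by (intro sep_holo_compose[OF sep_holo_Rreg wlB B _ D V(1)])
  qed
  then have "sep_holo f V" by (rule sep_holo_cong) (auto simp: f_def)
  then have holo: "holo3 f V" by (rule osgood_holo3)
  have "Zfun (g +++ d) = f (pathfinish d)"
    if d: "path d" "path_image d \<subseteq> V" "pathstart d = pathfinish g" for d
  proof -
    have dN: "path_image d \<subseteq> Nsharp" using d(2) r(2) by (auto simp: V_def)
    have dV: "zp d t \<in> B" "cp d t \<in> D" if "t \<in> {0..1}" for t
    proof -
      have "d t \<in> V" using d(2) that by (auto simp: path_image_def)
      then show "zp d t \<in> B" "cp d t \<in> D" using V(2)[of "fst (d t)" "zp d t" "cp d t"] by (auto simp: zp_def cp_def)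
    qed
    have d0: "zp d 0 = z0" "cp d 0 = c0" using d(3) fin by (auto simp: zp_def cp_def pathstart_def)
    note gd = cpaths_join[OF g d(1) dN d(3)]
    note zd = zp_facts[OF d(1) dN]
    define q where "q = (\<lambda>t. wl (zp d t))"
    have q: "continuous_on {0..1} q"
      unfolding q_def by (rule continuous_on_compose2[OF holomorphic_on_imp_continuous_on[OF wlB]])
        (use zd(1) dV in \<open>auto simp: path_def\<close>)
    have qe: "exp (q t) = zp d t" if "t \<in> {0..1}" for t
    proof -
      have "zp d t \<noteq> 0" using zd(2) that by (force simp: path_image_def)
      then show ?thesis using z0 by (simp add: q_def wl_def exp_add)
    qed
    have q0: "q 0 = Wl g 1" using z0 by (simp add: q_def wl_def d0 w0_def)
    have W1: "Wl (g +++ d) 1 = q 1" by (rule ell_join(3)[OF g d(1) dN d(3) q qe q0])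
    have ell: "ell k (g +++ d) = ll k (zp d 1)" if k: "k \<in> ibox K" for k
    proof -
      have slit: "(per k - q t) / (per k - w0) \<notin> \<real>\<^sub>\<le>\<^sub>0" if "t \<in> {0..1}" for t
        using dV(1)[OF that] k by (auto simp: B_def q_def)
      \<comment> \<open>The constant \<open>Ln (per k - w0)\<close> makes the candidate a logarithm
        of \<open>per k - q t\<close> itself; it cancels in the difference.\<close>
      have "logvar q (per k) =
          (Ln ((per k - q 1) / (per k - w0)) + Ln (per k - w0)) - (Ln ((per k - q 0) / (per k - w0)) + Ln (per k - w0))"
      proof (rule winding_number_eq_log_diff_neg)
        show "path q" using q by (simp add: path_def)
        show "per k \<notin> path_image q" by (rule ell_join(2)[OF g d(1) dN d(3) q qe q0])
        show "continuous_on {0..1} (\<lambda>t. Ln ((per k - q t) / (per k - w0)) + Ln (per k - w0))"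
          by (intro continuous_intros q) (use ne_k slit in auto)
        show "exp (Ln ((per k - q t) / (per k - w0)) + Ln (per k - w0)) = per k - q t" if "t \<in> {0..1}" for t
        proof -
          have "(per k - q t) / (per k - w0) \<noteq> 0" using slit[OF that] by auto
          then show ?thesis using ne_k[of k] by (simp add: exp_add)
        qed
      qed
      then have "logvar q (per k) = Ln ((per k - q 1) / (per k - w0))"
        using q0 ne_k[of k] by (simp add: w0_def)
      then show ?thesis
        using ell_join(1)[OF g d(1) dN d(3) q qe q0, of k]
        by (simp add: ell_def ll_def distrib_left add.assoc q_def)
    qed
    have lam: "lam n (g +++ d) = lm n (cp d 1)" if n: "n < N" for n
    proof -
      have slit: "(cp d t + of_nat n) / (c0 + of_nat n) \<notin> \<real>\<^sub>\<le>\<^sub>0" if "t \<in> {0..1}" for t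
        using dV(2)[OF that] n by (auto simp: D_def)
      have "logvar (cp d) (- of_nat n) =
          (Ln ((cp d 1 + of_nat n) / (c0 + of_nat n)) + Ln (c0 + of_nat n)) -
          (Ln ((cp d 0 + of_nat n) / (c0 + of_nat n)) + Ln (c0 + of_nat n))"
      proof (rule winding_number_eq_log_diff[OF zd(4,5)])
        show "continuous_on {0..1} (\<lambda>t. Ln ((cp d t + of_nat n) / (c0 + of_nat n)) + Ln (c0 + of_nat n))"
          by (intro continuous_intros) (use zd(4) ne_n slit in \<open>auto simp: path_def\<close>)
        show "exp (Ln ((cp d t + of_nat n) / (c0 + of_nat n)) + Ln (c0 + of_nat n)) = cp d t - - of_nat n" if "t \<in> {0..1}" for t
        proof -
          have "(cp d t + of_nat n) / (c0 + of_nat n) \<noteq> 0" using slit[OF that] by auto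
          then show ?thesis using ne_n[of n] by (simp add: exp_add)
        qed
      qed
      then show ?thesis
        using lam_join[OF g d(1) dN d(3), of n] ne_n[of n] by (simp add: lm_def d0)
    qed
    \<comment> \<open>Membership in \<open>B\<close> and \<open>D\<close> includes the bounds, so
      the cut-offs of \<open>g\<close> also serve for its extension.\<close>
    have "valid_bounds K N (g +++ d)"
      unfolding valid_bounds_def
    proof (intro ballI conjI)
      fix t :: real assume t: "t \<in> {0..1}"
      have *: "q t \<in> strip K" "Re (cp d t) > - real N" if "t \<in> {0..1}" for t
        using dV[OF that] by (auto simp: B_def D_def q_def)
      have "(Wl g +++ q) t \<in> strip K"
        using t v *(1)[of "2 * t - 1"] by (auto simp: joinpaths_def valid_bounds_def)
      then show "Wl (g +++ d) t \<in> strip K" using Wl_join[OF g d(1) dN d(3) q qe q0 t] by simp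
      show "Re (cp (g +++ d) t) > - real N"
        unfolding cp_join using t v *(2)[of "2 * t - 1"] by (auto simp: joinpaths_def valid_bounds_def)
    qed
    then have "Zfun (g +++ d) = Zval K N (g +++ d)" by (rule Zfun_eq[OF gd])
    also have "\<dots> = f (pathfinish d)"
    proof -
      obtain s z c where e: "pathfinish d = (s, z, c)" by (cases "pathfinish d")
      then have e': "zp d 1 = z" "cp d 1 = c" by (auto simp: zp_def cp_def pathfinish_def)
      have "q 1 = wl z" by (simp add: q_def e')
      then show ?thesis
        unfolding Zval_def f_def by (simp add: e W1 ell lam e' cong: sum.cong_simp)
    qed
    finally show ?thesis .
  qed
  then show ?thesis using r holo unfolding V_def fin by (intro exI[of _ r] conjI exI[of _ f]) auto
qed

text \<open>Along these paths \<open>norm z \<le> 1\<close> and \<open>Re c > 0\<close>. So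
  \<open>N = 0\<close> is admissible and \<open>per k - log z\<close> stays in the closed right
  half-plane away from 0: all logarithms are principal, and the singular sum cancels the one in
  \<open>Lpart\<close>.\<close>

lemma Zfun_Lerch:
  assumes d: "path d" "path_image d \<subseteq> LerchDom \<inter> Nsharp" "pathstart d = x1"
  shows "Zfun (linepath x0' x1 +++ d) = Lerch (pathfinish d)"
proof -
  define g where "g = linepath x0' x1 +++ d"
  have seg: "fst (snd (linepath x0' x1 t)) = of_real (- 1 + t / 2)" "snd (snd (linepath x0' x1 t)) = 1 / 2" for t
    by (simp_all add: linepath_def x0'_def x1_def scaleR_conv_of_real field_simps)
  have segN: "linepath x0' x1 t \<in> Nsharp" if "t \<in> {0..1}" for t
  proof -
    have "of_real (- 1 + t / 2) \<noteq> (0 :: complex)" "of_real (- 1 + t / 2) \<noteq> (1 :: complex)"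
      unfolding of_real_eq_0_iff of_real_eq_1_iff using that by auto
    then have "fst (snd (linepath x0' x1 t)) \<noteq> 0" "fst (snd (linepath x0' x1 t)) \<noteq> 1"
      "\<forall>n. snd (snd (linepath x0' x1 t)) \<noteq> - of_nat n" unfolding seg using half_neq_neg_nat by auto
    then show ?thesis by (auto simp: Nsharp_def case_prod_unfold)
  qed
  have lp: "linepath x0' x1 \<in> cpaths"
    using segN by (auto simp: cpaths_def path_image_def simp del: path_image_linepath)
  have dN: "path_image d \<subseteq> Nsharp" using d(2) by auto
  have g: "g \<in> cpaths" unfolding g_def by (rule cpaths_join[OF lp d(1) dN]) (simp add: d(3))
  have dL: "norm (zp d t) < 1" "Re (cp d t) > 0" if "t \<in> {0..1}" for t
  proof -
    have "d t \<in> LerchDom" using d(2) that by (auto simp: path_image_def)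
    then show "norm (zp d t) < 1" "Re (cp d t) > 0" by (auto simp: LerchDom_def zp_def cp_def)
  qed
  have zle: "norm (zp g t) \<le> 1" and cpos: "Re (cp g t) > 0" if t: "t \<in> {0..1}" for t
  proof -
    have "norm (of_real (- 1 + t / 2) :: complex) \<le> 1" if "t \<in> {0..1}" for t :: real
      unfolding norm_of_real using that by auto
    then have *: "norm (zp (linepath x0' x1) t) \<le> 1" "Re (cp (linepath x0' x1) t) > 0" if "t \<in> {0..1}" for t
      using that unfolding zp_def cp_def seg by auto
    show "norm (zp g t) \<le> 1"
      unfolding g_def zp_join using t *(1)[of "2 * t"] dL(1)[of "2 * t - 1"] by (auto simp: joinpaths_def)
    show "Re (cp g t) > 0"
      unfolding g_def cp_join using t *(2)[of "2 * t"] dL(2)[of "2 * t - 1"] by (auto simp: joinpaths_def)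
  qed
  obtain K N where "valid_bounds K N g" by (rule valid_bounds_exist[OF g])
  then have v: "valid_bounds K 0 g" using cpos by (auto simp: valid_bounds_def)
  obtain s z c where fin: "pathfinish d = (s, z, c)" by (cases "pathfinish d")
  have fing: "pathfinish g = (s, z, c)" by (simp add: g_def fin)
  define w where "w = Wl g 1"
  have ew: "exp w = z" using exp_Wl_end[OF g] fing by (simp add: w_def)
  have z: "norm z < 1" and c: "Re c > 0" using dL[of 1] fin by (auto simp: zp_def cp_def pathfinish_def)
  have w: "Re w < 0" using z by (simp flip: ew)
  have ws: "w \<in> strip K" using v by (auto simp: valid_bounds_def w_def)
  have ell: "ell k g = Ln (per k - w)" for k
    unfolding w_def
  proof (rule ell_principal[OF g])
    fix t :: real assume t: "t \<in> {0..1}"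
    \<comment> \<open>At the base point \<open>norm z = 1\<close>, so the real part can vanish; then
      the lift avoiding \<open>per k\<close> keeps the difference off 0.\<close>
    have "exp (Re (Wl g t)) \<le> 1" using zle[OF t] Wl_facts(3)[OF g t] by (metis norm_exp_eq_Re)
    then have "Re (per k - Wl g t) \<ge> 0" by simp
    moreover have "per k \<noteq> Wl g t" using Wl_facts(4)[OF g, of k] t by (auto simp: path_image_def)
    ultimately show "per k - Wl g t \<notin> \<real>\<^sub>\<le>\<^sub>0" by (auto simp: complex_nonpos_Reals_iff complex_eq_iff)
  qed
  have "Zfun g = Zval K 0 g" by (rule Zfun_eq[OF g v])
  also have "\<dots> = exp (- c * w) * ((\<Sum>k\<in>ibox K. exp (per k * c) * sing s (Ln (per k - w))) + Rreg K (s, w, c))"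
    by (simp add: Zval_def fing ell flip: w_def)
  also have "(\<Sum>k\<in>ibox K. exp (per k * c) * sing s (Ln (per k - w))) = (\<Sum>k\<in>ibox K. exp (per k * c) * sing0 s (w - per k))"
    using sing_Ln[of "w - _" s] w by (intro sum.cong) auto
  also have "Rreg K (s, w, c) = Lpart K (s, w, c)"
    by (rule Rreg_Lpart) (use ws c w in \<open>auto simp: Udom_def\<close>)
  also have "(\<Sum>k\<in>ibox K. exp (per k * c) * sing0 s (w - per k)) + Lpart K (s, w, c) = exp (c * w) * Lerch (s, exp w, c)"
    by (simp add: Lpart_def Eser_Lerch(1)[OF w c])
  also have "exp (- c * w) * (exp (c * w) * Lerch (s, exp w, c)) = Lerch (s, z, c)"
    by (simp add: ew exp_minus)
  finally show ?thesis by (simp add: g_def fin)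
qed

theorem theorem3p6:
  shows "\<exists>Z :: (real \<Rightarrow> pt) \<Rightarrow> complex.
     \<comment> \<open>single-valued on the universal cover: depends only on the homotopy class\<close>
     (\<forall>g\<in>cpaths. \<forall>h\<in>cpaths. homotopic_paths Nsharp g h \<longrightarrow> Z g = Z h) \<and>
     \<comment> \<open>holomorphic on the universal cover: locally given by holomorphic functions\<close>
     (\<forall>g\<in>cpaths. \<exists>r>0. \<exists>f. ball (pathfinish g) r \<subseteq> Nsharp \<and>
         holo3 f (ball (pathfinish g) r) \<and>
         (\<forall>d. path d \<and> path_image d \<subseteq> ball (pathfinish g) r \<and> pathstart d = pathfinish g
              \<longrightarrow> Z (g +++ d) = f (pathfinish d))) \<and>
     \<comment> \<open>continuation of the Lerch transcendent\<close>
     (\<forall>d. path d \<and> path_image d \<subseteq> LerchDom \<inter> Nsharp \<and> pathstart d = x1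
          \<longrightarrow> Z (linepath x0' x1 +++ d) = Lerch (pathfinish d)) \<and>
     \<comment> \<open>vanishing monodromy for the second commutator subgroup\<close>
     (\<forall>\<tau>\<in>derived2 Nsharp x0'. \<forall>g\<in>cpaths. Z (\<tau> +++ g) - Z g = 0)"
proof (intro exI[of _ Zfun] conjI ballI allI impI)
  fix g h assume g: "g \<in> cpaths" and h: "h \<in> cpaths" and hom: "homotopic_paths Nsharp g h"
  show "Zfun g = Zfun h"
    by (rule Zfun_cong[OF g h homotopic_paths_imp_pathfinish[OF hom] homotopic_lift_data[OF hom g h]])
next
  fix d assume "path d \<and> path_image d \<subseteq> LerchDom \<inter> Nsharp \<and> pathstart d = x1"
  then show "Zfun (linepath x0' x1 +++ d) = Lerch (pathfinish d)" by (intro Zfun_Lerch) auto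
next
  fix \<tau> g assume \<tau>: "\<tau> \<in> derived2 Nsharp x0'" and g: "g \<in> cpaths"
  note D = derived2_lift_data[OF \<tau>]
  note J = closedlift_join_data[OF conjunct1[OF D] g]
  have "Zfun (\<tau> +++ g) = Zfun g"
    by (rule Zfun_cong[OF J(1) g _ J(2) _ J(4)]) (use D J(3) in auto)
  then show "Zfun (\<tau> +++ g) - Zfun g = 0" by simp
qed (rule Zfun_local)

end
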